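(* Let $n\ge 1$, $0<p\le 1$, $\delta>n/p-(n+1)/2$ and let $w\in A_1$ be a weight on $\mathbb R^n$. Then there exists a constant $C>0$ such that for every $f\in WH^p_w(\mathbb R^n)$, $$\big\|T^\delta_*(f)\big\|_{WL^p_w}\le C\,\|f\|_{WH^p_w},$$ where $C$ is independent of $f$.
   Context: **Bochner-Riesz operators.** For $\delta>0$ and $0<R<\infty$, $T^\delta_R$ is defined initially for Schwartz functions $f$ on $\mathbb R^n$ by $\widehat{T^\delta_R f}(\xi)=\big(1-|\xi|^2/R^2\big)^\delta_+\,\hat f(\xi)$, where $\hat f(\xi)=\int f(x)e^{-2\pi i x\cdot\xi}\,dx$. Equivalently $T^\delta_R f=\phi_{1/R}*f$, where $\phi$ is the Fourier transform of $\xi\mapsto(1-|\xi|^2)^\delta_+$ and $\phi_{1/R}(x)=R^n\phi(Rx)$; explicitly $\phi(x)=\pi^{-\delta}\Gamma(\delta+1)|x|^{-(n/2+\delta)}J_{n/2+\delta}(2\pi|x|)$, with $J_\mu$ the Bessel function. For a tempered distribution $f\in WH^p_w(\mathbb R^n)$ (defined below), the function $T^\delta_R f=\phi_{1/R}*f$ is understood as the convolution $\phi_{1/R}*(\psi*f)$ of functions, where $\psi\in\mathscr S(\mathbb R^n)$ is any Schwartz function with $\hat\psi=1$ on a neighbourhood of $\{|\xi|\le R\}$. The maximal Bochner-Riesz operator is $T^\delta_* f(x)=\sup_{R>0}|T^\delta_R f(x)|$. **Weights.** A weight $w$ is a nonnegative locally integrable function on $\mathbb R^n$; cubes have sides parallel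 to the coordinate axes. $w\in A_q$ ($1<q<\infty$) means that there is a constant $C$ with $\big(\frac1{|Q|}\int_Q w\big)\big(\frac1{|Q|}\int_Q w^{-1/(q-1)}\big)^{q-1}\le C$ for every cube $Q$. $w\in A_1$ means that there is a constant $C$ with $\frac1{|Q|}\int_Q w\,dx\le C\,\operatorname{ess\,inf}_{x\in Q}w(x)$ for every cube $Q$. $A_\infty=\bigcup_{1<q<\infty}A_q$, and $q_w=\inf\{q>1:w\in A_q\}$ (so $q_w=1$ if $w\in A_1$). For measurable $E$, $w(E)=\int_E w(x)\,dx$. **Weak Lebesgue space.** $\|g\|_{WL^p_w}=\sup_{\lambda>0}\lambda\, w(\{x\in\mathbb R^n:|g(x)|>\lambda\})^{1/p}$, and $WL^p_w(\mathbb R^n)$ is the set of measurable $g$ for which this is finite. **Weighted weak Hardy space.** Let $w\in A_\infty$, $0<p\le1$, and fix an integer $N\ge[n(q_w/p-1)]$ ($[\cdot]$ is the integer part). Put $$\mathscr A_{N,w}=\Big\{\varphi\in\mathscr S(\mathbb R^n):\sup_{x\in\mathbb R^n}\sup_{|\alpha|\le N+1}(1+|x|)^{N+n+1}|D^\alpha\varphi(x)|\le1\Big\},$$ and $\varphi_t(x)=t^{-n}\varphi(x/t)$. For $f\in\mathscr S'(\mathbb R^n)$ let $G_wf(x)=\sup_{\varphi\in\mathscr A_{N,w}}\sup_{|y-x|<t}|(\varphi_t*f)(y)|$. Then $WH^p_w(\mathbb R^n)=\{f\in\mathscr S'(\mathbb R^n):G_wf\in WL^p_w(\mathbb R^n)\}$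 with $\|f\|_{WH^p_w}=\|G_wf\|_{WL^p_w}$. The same space, with an equivalent quasi-norm, is obtained by replacing $G_w f$ by the radial grand maximal function $G^+_wf(x)=\sup_{\varphi\in\mathscr A_{N,w}}\sup_{t>0}|(\varphi_t*f)(x)|$. *)

theory Defs
  imports "HOL-Analysis.Analysis"
begin

section \<open>Schwartz functions and tempered distributions\<close>

definition partial_deriv :: "'n \<Rightarrow> (real^'n \<Rightarrow> complex) \<Rightarrow> real^'n::finite \<Rightarrow> complex" where
  "partial_deriv i f x = frechet_derivative f (at x) (axis i 1)"

text \<open>Multi-indices are encoded as lists of coordinates: \<^term>\<open>[i\<^sub>1, i\<^sub>2]\<close> stands for
  the second-order operator differentiating in \<^term>\<open>i\<^sub>2\<close> and then in \<^term>\<open>i\<^sub>1\<close>, and the order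
  is the length. Smooth functions have commuting partial derivatives, so the lists of length
  \<^term>\<open>k\<close> give exactly the derivatives of order \<^term>\<open>k\<close> (with repetitions).\<close>

definition iter_deriv :: "'n list \<Rightarrow> (real^'n \<Rightarrow> complex) \<Rightarrow> real^'n::finite \<Rightarrow> complex" where
  "iter_deriv \<alpha> f = foldr partial_deriv \<alpha> f"

definition smooth :: "(real^'n::finite \<Rightarrow> complex) \<Rightarrow> bool" where
  "smooth f \<longleftrightarrow> (\<forall>\<alpha> x. iter_deriv \<alpha> f differentiable (at x))"

definition schwartz_seminorm :: "nat \<Rightarrow> nat \<Rightarrow> (real^'n::finite \<Rightarrow> complex) \<Rightarrow> ennreal" where
  "schwartz_seminorm k m f =
     (SUP x. SUP \<alpha>\<in>{\<alpha>. length \<alpha> \<le> m}. ennreal ((1 + norm x) ^ k * cmod (iter_deriv \<alpha> f x)))"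

definition schwartz :: "(real^'n::finite \<Rightarrow> complex) set" where
  "schwartz = {f. smooth f \<and> (\<forall>k m. schwartz_seminorm k m f < \<infinity>)}"

text \<open>A tempered distribution is represented by a functional on all functions, of which only the
  values on \<^term>\<open>schwartz\<close> are constrained and used.\<close>

definition tempered :: "((real^'n::finite \<Rightarrow> complex) \<Rightarrow> complex) \<Rightarrow> bool" where
  "tempered u \<longleftrightarrow>
     (\<forall>\<phi>\<in>schwartz. \<forall>\<psi>\<in>schwartz. u (\<lambda>x. \<phi> x + \<psi> x) = u \<phi> + u \<psi>) \<and>
     (\<forall>c. \<forall>\<phi>\<in>schwartz. u (\<lambda>x. c * \<phi> x) = c * u \<phi>) \<and>
     (\<exists>k m. \<exists>C::real. \<forall>\<phi>\<in>schwartz. ennreal (cmod (u \<phi>)) \<le> ennreal C * schwartz_seminorm k m \<phi>)"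

definition distr_conv ::
  "(real^'n::finite \<Rightarrow> complex) \<Rightarrow> ((real^'n \<Rightarrow> complex) \<Rightarrow> complex) \<Rightarrow> real^'n \<Rightarrow> complex" where
  "distr_conv \<phi> u x = u (\<lambda>y. \<phi> (x - y))"

definition dilate :: "real \<Rightarrow> (real^'n::finite \<Rightarrow> complex) \<Rightarrow> real^'n \<Rightarrow> complex" where
  "dilate t \<phi> x = of_real (1 / t ^ CARD('n)) * \<phi> ((1 / t) *\<^sub>R x)"

definition fourier :: "(real^'n::finite \<Rightarrow> complex) \<Rightarrow> real^'n \<Rightarrow> complex" where
  "fourier f \<xi> = (\<integral>x. f x * cis (- 2 * pi * (x \<bullet> \<xi>)) \<partial>lebesgue)"

section \<open>Bochner-Riesz operators\<close>

definition br_kernel :: "real \<Rightarrow> real^'n::finite \<Rightarrow> complex" where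
  "br_kernel \<delta> = fourier (\<lambda>\<xi>. of_real (max 0 (1 - (norm \<xi>)\<^sup>2) powr \<delta>))"

definition cutoffs :: "real \<Rightarrow> (real^'n::finite \<Rightarrow> complex) set" where
  "cutoffs R = {\<psi> \<in> schwartz. \<exists>U. open U \<and> cball 0 R \<subseteq> U \<and> (\<forall>\<xi>\<in>U. fourier \<psi> \<xi> = 1)}"

text \<open>The cutoff is an explicit argument: for \<^term>\<open>\<psi> \<in> cutoffs R\<close> the value does not depend on
  \<^term>\<open>\<psi>\<close> mathematically, and results are to be stated for every choice of cutoffs.\<close>

definition bochner_riesz ::
  "real \<Rightarrow> real \<Rightarrow> (real^'n::finite \<Rightarrow> complex) \<Rightarrow> ((real^'n \<Rightarrow> complex) \<Rightarrow> complex) \<Rightarrow>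
   real^'n \<Rightarrow> complex" where
  "bochner_riesz \<delta> R \<psi> f x =
     (\<integral>y. dilate (1 / R) (br_kernel \<delta>) (x - y) * distr_conv \<psi> f y \<partial>lebesgue)"

definition max_bochner_riesz ::
  "real \<Rightarrow> (real \<Rightarrow> real^'n::finite \<Rightarrow> complex) \<Rightarrow> ((real^'n \<Rightarrow> complex) \<Rightarrow> complex) \<Rightarrow>
   real^'n \<Rightarrow> ennreal" where
  "max_bochner_riesz \<delta> \<Psi> f x = (SUP R\<in>{0<..}. ennreal (cmod (bochner_riesz \<delta> R (\<Psi> R) f x)))"

section \<open>Muckenhoupt weights\<close>

text \<open>Only used with positive exponents.\<close>

definition epowr :: "ennreal \<Rightarrow> real \<Rightarrow> ennreal" where
  "epowr x a = (if x = \<infinity> then \<infinity> else ennreal (enn2real x powr a))"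

definition weight :: "(real^'n::finite \<Rightarrow> real) \<Rightarrow> bool" where
  "weight w \<longleftrightarrow> (\<forall>x. 0 \<le> w x) \<and> (\<forall>K. compact K \<longrightarrow> set_integrable lebesgue K w)"

definition cubes :: "(real^'n::finite) set set" where
  "cubes = {cbox a (a + (\<chi> i. l)) | a l. 0 < l}"

definition average :: "(real^'n::finite) set \<Rightarrow> (real^'n \<Rightarrow> ennreal) \<Rightarrow> ennreal" where
  "average Q g = (\<integral>\<^sup>+x\<in>Q. g x \<partial>lebesgue) / emeasure lebesgue Q"

definition ess_inf :: "(real^'n::finite) set \<Rightarrow> (real^'n \<Rightarrow> ennreal) \<Rightarrow> ennreal" where
  "ess_inf Q g = Sup {c. AE x in lebesgue. x \<in> Q \<longrightarrow> c \<le> g x}"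

text \<open>The power $w^{-1/(q-1)}$ is taken in the extended nonnegative reals, so that it is infinite
  where \<^term>\<open>w\<close> vanishes.\<close>

definition Aq_weights :: "real \<Rightarrow> (real^'n::finite \<Rightarrow> real) set" where
  "Aq_weights q = {w. weight w \<and> (\<exists>C::real. \<forall>Q\<in>cubes.
     average Q (\<lambda>x. ennreal (w x)) *
     epowr (average Q (\<lambda>x. epowr (inverse (ennreal (w x))) (1 / (q - 1)))) (q - 1) \<le> ennreal C)}"

definition A1_weights :: "(real^'n::finite \<Rightarrow> real) set" where
  "A1_weights = {w. weight w \<and> (\<exists>C::real. \<forall>Q\<in>cubes.
     average Q (\<lambda>x. ennreal (w x)) \<le> ennreal C * ess_inf Q (\<lambda>x. ennreal (w x)))}"

definition critical_index :: "(real^'n::finite \<Rightarrow> real) \<Rightarrow> real" where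
  "critical_index w = Inf {q. 1 < q \<and> w \<in> Aq_weights q}"

definition weighted_measure :: "(real^'n::finite \<Rightarrow> real) \<Rightarrow> (real^'n) set \<Rightarrow> ennreal" where
  "weighted_measure w E = (\<integral>\<^sup>+x\<in>E. ennreal (w x) \<partial>lebesgue)"

section \<open>Weighted weak Lebesgue and weak Hardy spaces\<close>

text \<open>Functions in the weak Lebesgue space are given by their moduli, with values in
  \<^typ>\<open>ennreal\<close>, since maximal functions may a priori be infinite.\<close>

definition weak_norm :: "real \<Rightarrow> (real^'n::finite \<Rightarrow> real) \<Rightarrow> (real^'n \<Rightarrow> ennreal) \<Rightarrow> ennreal" where
  "weak_norm p w g =
     (SUP l\<in>{0<..}. ennreal l * epowr (weighted_measure w {x. g x > ennreal l}) (1 / p))"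

definition weak_Lp :: "real \<Rightarrow> (real^'n::finite \<Rightarrow> real) \<Rightarrow> (real^'n \<Rightarrow> ennreal) set" where
  "weak_Lp p w = {g \<in> borel_measurable lebesgue. weak_norm p w g < \<infinity>}"

definition test_class :: "nat \<Rightarrow> (real^'n::finite \<Rightarrow> complex) set" where
  "test_class N = {\<phi> \<in> schwartz. schwartz_seminorm (N + CARD('n) + 1) (N + 1) \<phi> \<le> 1}"

text \<open>The inner supremum is over the cone $|y - x| < t$; in particular $t > 0$. The weight enters
  only through the admissible values of \<^term>\<open>N\<close>.\<close>

definition grand_maximal ::
  "nat \<Rightarrow> ((real^'n::finite \<Rightarrow> complex) \<Rightarrow> complex) \<Rightarrow> real^'n \<Rightarrow> ennreal" where
  "grand_maximal N f x =
     (SUP \<phi>\<in>test_class N. SUP (y, t)\<in>{(y, t). norm (y - x) < t}.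
        ennreal (cmod (distr_conv (dilate t \<phi>) f y)))"

definition weak_Hardy ::
  "nat \<Rightarrow> real \<Rightarrow> (real^'n::finite \<Rightarrow> real) \<Rightarrow> ((real^'n \<Rightarrow> complex) \<Rightarrow> complex) set" where
  "weak_Hardy N p w = {f. tempered f \<and> grand_maximal N f \<in> weak_Lp p w}"

definition weak_Hardy_norm ::
  "nat \<Rightarrow> real \<Rightarrow> (real^'n::finite \<Rightarrow> real) \<Rightarrow> ((real^'n \<Rightarrow> complex) \<Rightarrow> complex) \<Rightarrow> ennreal" where
  "weak_Hardy_norm N p w f = weak_norm p w (grand_maximal N f)"

end

theory Submission
  imports Defs "HOL-Real_Asymp.Real_Asymp"
begin

text \<open>The maximal operator is controlled pointwise, without an atomic decomposition. Put
  $a = \delta + (n+1)/2 > n/p$ and choose $r < p$ with $a > n/r$. All derivatives of the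
  Bochner-Riesz kernel decay like $(1+|x|)^{-a}$, so localising the kernel with translates of a
  Gaussian writes $\phi_{1/R} * f(x)$ as an average, with weight $(1+|z|)^{-a}$, of quantities
  that are bounded by the grand maximal function $G f$ on the balls $B(x - z/R, 1/R)$. As
  $r \le 1$, such an average is at most a constant times $M((G f)^r)(x)^{1/r}$ with the
  Hardy-Littlewood maximal operator $M$, which is bounded on $WL^{p/r}_w$ since $p/r > 1$ and
  $w$ is an A1 weight.

  The kernel at $x$ is a multiple of $\int_{-1}^1 (1-s^2)^\mu \cos(2\pi|x|s)\,ds$ with
  $\mu = \delta + (n-1)/2$; its decay is read off from Bessel's differential equation by an
  energy estimate.\<close>

section \<open>Polynomial weights\<close>

text \<open>The kernel has only finite polynomial decay, so it is no Schwartz function and a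
  tempered distribution cannot be paired with it. It is therefore first multiplied by a wide
  Gaussian \<open>gauss (\<epsilon> *\<^sub>R x)\<close>. Because convolution with the cutoff
  reproduces the kernel, the resulting error has size \<epsilon>^\<tau> and the slightly weaker
  decay a - \<tau>, which the strict inequality a > n/r affords.

  The averaging step uses r \<le> 1 as follows. Let k(z) be the size of the piece at z with its
  weight removed, and write k = k^r k^(1-r). Since k(z) is at most G on the unit ball about z, which
  lies in the ball of radius 1+|z| about the origin, k^r is at most a multiple of (1+|z|)^n times
  the bound for the averages of G^r. Hence k^(1-r) costs (1+|z|)^(n(1-r)/r), and the total weight
  has exponent -(a - n/r + n), integrable exactly when a > n/r.

  The exponent \<mu> arises by slicing: integrating the multiplier over each of the n-1 coordinates
  orthogonal to x adds 1/2 to \<delta>.\<close>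

definition wt :: "real \<Rightarrow> 'a::real_normed_vector \<Rightarrow> real" where
  "wt s x = (1 + norm x) powr s"

lemma wt_pos [simp]: "0 < wt s x" and wt_nonneg [simp]: "0 \<le> wt s x" and wt_neq_0 [simp]: "wt s x \<noteq> 0"
proof -
  have *: "0 < 1 + norm x" by (simp add: add_pos_nonneg)
  show "0 < wt s x" using * by (simp add: wt_def)
  then show "0 \<le> wt s x" "wt s x \<noteq> 0" by auto
qed

lemma wt_0 [simp]: "wt 0 x = 1"
proof -
  have *: "1 + norm x \<noteq> 0" by (metis add_pos_nonneg less_irrefl norm_ge_zero zero_less_one)
  then show ?thesis by (simp add: wt_def)
qed

lemma wt_add: "wt (s + t) x = wt s x * wt t x"
  by (simp add: wt_def powr_add)

lemma wt_minus: "wt (- s) x = inverse (wt s x)"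
  by (simp add: wt_def powr_minus)

lemma wt_mono: "s \<le> t \<Longrightarrow> wt s x \<le> wt t x"
  by (simp add: wt_def powr_mono)

lemma wt_ge_1: "0 \<le> s \<Longrightarrow> 1 \<le> wt s x"
  using wt_mono[of 0 s x] by simp

lemma wt_le_1: "s \<le> 0 \<Longrightarrow> wt s x \<le> 1"
  using wt_mono[of s 0 x] by simp

lemma wt_of_nat: "wt (real k) x = (1 + norm x) ^ k"
proof -
  have *: "0 < 1 + norm x" by (simp add: add_pos_nonneg)
  then show ?thesis by (simp add: wt_def powr_realpow)
qed

lemma wt_peetre:
  assumes "0 \<le> s" shows "wt s (x + y) \<le> wt s x * wt s y"
proof -
  have "1 + norm (x + y) \<le> (1 + norm x) * (1 + norm y)"
    
    using norm_triangle_ineq[of x y] mult_nonneg_nonneg[OF norm_ge_zero[of x] norm_ge_zero[of y]]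
    by (simp only: distrib_left distrib_right mult_1 mult_1_right)
  then show ?thesis using assms
    by (auto simp: wt_def powr_mult[symmetric] intro!: powr_mono2 add_nonneg_nonneg)
qed

text \<open>Peetre's inequality for decaying weights, from the growing case applied to x = (x + y) +
  (-y). It moves decay from a translated argument to the original one at a polynomial price in the
  shift, and is behind every estimate for translates and convolutions below.\<close>

lemma wt_peetre_minus:
  assumes "0 \<le> s" shows "wt (- s) (x + y) \<le> wt (- s) x * wt s y"
proof -
  have "wt s x \<le> wt s (x + y) * wt s y"
    using wt_peetre[OF assms, of "x + y" "- y"] by (simp add: wt_def)
  then show ?thesis by (simp add: wt_minus field_simps)
qed

lemma wt_norm_cong: "norm x = norm y \<Longrightarrow> wt s x = wt s y"
  by (simp add: wt_def)

lemma wt_uminus [simp]: "wt s (- x) = wt s x"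
  by (simp add: wt_def)

lemma continuous_on_wt [continuous_intros]:
  "continuous_on A f \<Longrightarrow> continuous_on A (\<lambda>x. wt s (f x))"
proof -
  assume f: "continuous_on A f"
  have "1 + norm (f x) \<noteq> 0" for x by (metis add_pos_nonneg less_irrefl norm_ge_zero zero_less_one)
  then show ?thesis unfolding wt_def by (intro continuous_intros f) auto
qed

lemma borel_measurable_wt [measurable]: "(wt s :: 'a::euclidean_space \<Rightarrow> real) \<in> borel_measurable borel"
  by (intro borel_measurable_continuous_onI continuous_intros)

section \<open>Calculus of iterated partial derivatives\<close>

lemma iter_deriv_Nil [simp]: "iter_deriv [] f = f"
  and iter_deriv_Cons: "iter_deriv (i # \<alpha>) f = partial_deriv i (iter_deriv \<alpha> f)"
  and iter_deriv_append: "iter_deriv (\<alpha> @ \<beta>) f = iter_deriv \<alpha> (iter_deriv \<beta> f)"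
  by (simp_all add: iter_deriv_def)

lemma iter_deriv_snoc: "iter_deriv (\<alpha> @ [i]) f = iter_deriv \<alpha> (partial_deriv i f)"
  by (simp add: iter_deriv_append iter_deriv_Cons)

lemma partial_deriv_eqI: "(f has_derivative f') (at x) \<Longrightarrow> partial_deriv i f x = f' (axis i 1)"
  by (simp add: partial_deriv_def frechet_derivative_at[symmetric])

lemma has_derivative_frechet:
  "f differentiable (at x) \<Longrightarrow> (f has_derivative frechet_derivative f (at x)) (at x)"
  by (simp add: frechet_derivative_works)

lemma frechet_eq_sum_partial:
  fixes f :: "real^'n::finite \<Rightarrow> complex"
  assumes "f differentiable (at x)"
  shows "frechet_derivative f (at x) h = (\<Sum>i\<in>UNIV. h $ i *\<^sub>R partial_deriv i f x)"
proof -
  interpret bounded_linear "frechet_derivative f (at x)"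
    using has_derivative_frechet[OF assms] by (rule has_derivative_bounded_linear)
  have "h = (\<Sum>i\<in>UNIV. h $ i *\<^sub>R axis i 1)"
    by (metis basis_expansion scalar_mult_eq_scaleR)
  then have "frechet_derivative f (at x) h = frechet_derivative f (at x) (\<Sum>i\<in>UNIV. h $ i *\<^sub>R axis i 1)"
    by simp
  then show ?thesis by (simp add: sum scaleR partial_deriv_def)
qed

lemma has_derivative_partials:
  fixes f :: "real^'n::finite \<Rightarrow> complex"
  assumes "f differentiable (at x)"
  shows "(f has_derivative (\<lambda>h. \<Sum>i\<in>UNIV. h $ i *\<^sub>R partial_deriv i f x)) (at x)"
proof -
  have "(\<lambda>h. \<Sum>i\<in>UNIV. h $ i *\<^sub>R partial_deriv i f x) = frechet_derivative f (at x)"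
    by (rule ext) (simp add: frechet_eq_sum_partial[OF assms])
  then show ?thesis using has_derivative_frechet[OF assms] by simp
qed

text \<open>Differentiability and size are bundled so that the side conditions of the sum, product
  and chain rules travel with the estimates. One majorant for all orders up to m suffices because no
  derivative considered here needs better decay than the function itself.\<close>

definition deriv_bound :: "nat \<Rightarrow> (real^'n::finite \<Rightarrow> real) \<Rightarrow> (real^'n \<Rightarrow> complex) \<Rightarrow> bool" where
  "deriv_bound m b f \<longleftrightarrow>
     (\<forall>\<alpha> x. length \<alpha> \<le> m \<longrightarrow> iter_deriv \<alpha> f differentiable (at x) \<and> cmod (iter_deriv \<alpha> f x) \<le> b x)"

lemma deriv_boundD:
  assumes "deriv_bound m b f" "length \<alpha> \<le> m"
  shows "iter_deriv \<alpha> f differentiable (at x)" "cmod (iter_deriv \<alpha> f x) \<le> b x"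
  using assms by (auto simp: deriv_bound_def)

lemma deriv_bound_zero:
  assumes "deriv_bound m b f"
  shows "f differentiable (at x)" "cmod (f x) \<le> b x"
  using deriv_boundD[OF assms, of "[]"] by auto

lemma deriv_bound_0:
  "deriv_bound 0 b f \<longleftrightarrow> (\<forall>x. f differentiable (at x) \<and> cmod (f x) \<le> b x)"
  by (simp add: deriv_bound_def)

text \<open>The innermost derivative, the last entry of the list, is split off. Inductions on m can
  then generalise over the function and apply a first-order rule to it before the remaining
  derivatives act.\<close>

lemma deriv_bound_Suc:
  "deriv_bound (Suc m) b f \<longleftrightarrow>
     (\<forall>x. f differentiable (at x) \<and> cmod (f x) \<le> b x) \<and> (\<forall>i. deriv_bound m b (partial_deriv i f))"
proof safe
  fix i assume *: "deriv_bound (Suc m) b f"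
  show "deriv_bound m b (partial_deriv i f)"
    unfolding deriv_bound_def iter_deriv_snoc[symmetric] using * by (simp add: deriv_bound_def)
next
  assume *: "\<forall>x. f differentiable at x \<and> cmod (f x) \<le> b x" "\<forall>i. deriv_bound m b (partial_deriv i f)"
  show "deriv_bound (Suc m) b f" unfolding deriv_bound_def
  proof (intro allI impI)
    fix \<alpha> :: "'a list" and x assume "length \<alpha> \<le> Suc m"
    then show "iter_deriv \<alpha> f differentiable at x \<and> cmod (iter_deriv \<alpha> f x) \<le> b x"
      using * by (cases \<alpha> rule: rev_cases) (auto simp: iter_deriv_snoc deriv_bound_def)
  qed
qed (use deriv_bound_zero in blast)+

lemma deriv_bound_mono:
  assumes "deriv_bound m b f" "m' \<le> m" "\<And>x. b x \<le> c x"
  shows "deriv_bound m' c f"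
  using assms unfolding deriv_bound_def by (meson order_trans)

lemma partial_deriv_add:
  assumes "\<And>x. f differentiable (at x)" "\<And>x. g differentiable (at x)"
  shows "partial_deriv i (\<lambda>x. f x + g x) = (\<lambda>x. partial_deriv i f x + partial_deriv i g x)"
proof
  fix x show "partial_deriv i (\<lambda>x. f x + g x) x = partial_deriv i f x + partial_deriv i g x"
    by (subst partial_deriv_eqI)
      (rule has_derivative_add has_derivative_frechet assms refl | simp add: partial_deriv_def)+
qed

lemma partial_deriv_mult:
  assumes "\<And>x. f differentiable (at x)" "\<And>x. g differentiable (at x)"
  shows "partial_deriv i (\<lambda>x. f x * g x) = (\<lambda>x. partial_deriv i f x * g x + f x * partial_deriv i g x)"
proof
  fix x show "partial_deriv i (\<lambda>x. f x * g x) x = partial_deriv i f x * g x + f x * partial_deriv i g x"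
    by (subst partial_deriv_eqI)
      (rule has_derivative_mult has_derivative_frechet assms refl | simp add: partial_deriv_def)+
qed

lemma partial_deriv_const: "partial_deriv i (\<lambda>x. c) = (\<lambda>x. 0)"
proof
  fix x :: "real^'a" show "partial_deriv i (\<lambda>x. c) x = 0"
    by (subst partial_deriv_eqI) (rule has_derivative_const | simp)+
qed

lemma partial_deriv_affine:
  fixes f :: "real^'n::finite \<Rightarrow> complex"
  assumes "\<And>x. f differentiable (at x)"
  shows "partial_deriv i (\<lambda>x. f (c *\<^sub>R x + v)) = (\<lambda>x. of_real c * partial_deriv i f (c *\<^sub>R x + v))"
    and "(\<lambda>x. f (c *\<^sub>R x + v)) differentiable (at x)"
proof -
  have *: "((\<lambda>x. f (c *\<^sub>R x + v)) has_derivative (\<lambda>h. frechet_derivative f (at (c *\<^sub>R x + v)) (c *\<^sub>R h))) (at x)" for x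
    by (rule has_derivative_compose[OF _ has_derivative_frechet[OF assms], of "\<lambda>x. c *\<^sub>R x + v"])
       (auto intro!: derivative_eq_intros)
  show "(\<lambda>x. f (c *\<^sub>R x + v)) differentiable (at x)" using * by (auto simp: differentiable_def)
  show "partial_deriv i (\<lambda>x. f (c *\<^sub>R x + v)) = (\<lambda>x. of_real c * partial_deriv i f (c *\<^sub>R x + v))"
  proof
    fix x
    have "bounded_linear (frechet_derivative f (at (c *\<^sub>R x + v)))"
      using has_derivative_frechet[OF assms] by (rule has_derivative_bounded_linear)
    then have "frechet_derivative f (at (c *\<^sub>R x + v)) (c *\<^sub>R axis i 1) =
        c *\<^sub>R frechet_derivative f (at (c *\<^sub>R x + v)) (axis i 1)"
      by (rule linear_cmul[OF bounded_linear.linear])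
    then show "partial_deriv i (\<lambda>x. f (c *\<^sub>R x + v)) x = of_real c * partial_deriv i f (c *\<^sub>R x + v)"
      unfolding partial_deriv_eqI[OF *] partial_deriv_def by (simp only: scaleR_conv_of_real[where 'a=complex])
  qed
qed

lemma deriv_bound_add:
  "deriv_bound m b f \<Longrightarrow> deriv_bound m c g \<Longrightarrow> deriv_bound m (\<lambda>x. b x + c x) (\<lambda>x. f x + g x)"
proof (induction m arbitrary: f g)
  case 0
  then show ?case by (auto simp: deriv_bound_0 intro: norm_triangle_mono)
next
  case (Suc m)
  then show ?case
    by (auto simp: deriv_bound_Suc partial_deriv_add intro: norm_triangle_mono)
qed

text \<open>Each application of the Leibniz rule doubles the number of terms, whence the factor
  2^m.\<close>

lemma deriv_bound_mult:
  "deriv_bound m b f \<Longrightarrow> deriv_bound m c g \<Longrightarrow> deriv_bound m (\<lambda>x. 2 ^ m * (b x * c x)) (\<lambda>x. f x * g x)"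
proof (induction m arbitrary: f g)
  case 0
  then show ?case unfolding deriv_bound_0
    by (auto simp: norm_mult intro!: mult_mono intro: order_trans[OF norm_ge_zero])
next
  case (Suc m)
  have nn: "0 \<le> b x" "0 \<le> c x" for x
    using deriv_bound_zero[OF Suc.prems(1)] deriv_bound_zero[OF Suc.prems(2)] norm_ge_zero order_trans by blast+
  have d: "\<And>x. f differentiable (at x)" "\<And>x. g differentiable (at x)"
    using Suc.prems by (auto simp: deriv_bound_Suc)
  have fm: "deriv_bound m b f" "deriv_bound m c g"
    using Suc.prems by (auto intro: deriv_bound_mono)
  have "deriv_bound m (\<lambda>x. 2 ^ Suc m * (b x * c x)) (partial_deriv i (\<lambda>x. f x * g x))" for i
    unfolding partial_deriv_mult[OF d]
    using Suc.prems fm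
    by (auto simp: deriv_bound_Suc intro!: deriv_bound_mono[OF deriv_bound_add[OF Suc.IH Suc.IH]])
  moreover have "cmod (f x * g x) \<le> 2 ^ Suc m * (b x * c x)" for x
  proof -
    have "cmod (f x * g x) \<le> 1 * (b x * c x)"
      using deriv_bound_zero[OF Suc.prems(1)] deriv_bound_zero[OF Suc.prems(2)]
      by (auto simp: norm_mult nn intro!: mult_mono)
    also have "\<dots> \<le> 2 ^ Suc m * (b x * c x)"
      using nn by (intro mult_right_mono) (auto simp: one_le_power intro: order_trans[of _ "2 ^ m"])
    finally show ?thesis .
  qed
  ultimately show ?case using d by (auto simp: deriv_bound_Suc)
qed

lemma deriv_bound_const: "deriv_bound m (\<lambda>x. cmod c) (\<lambda>x::real^'n::finite. c)"
proof (induction m arbitrary: c)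
  case (Suc m)
  have "deriv_bound m (\<lambda>x. cmod c) (partial_deriv i (\<lambda>x. c))" for i :: 'n
    unfolding partial_deriv_const using deriv_bound_mono[OF Suc[of 0], of m "\<lambda>x. cmod c"] by simp
  then show ?case by (auto simp: deriv_bound_Suc)
qed (auto simp: deriv_bound_0)

lemma iter_deriv_cmult_aux:
  "deriv_bound m b f \<Longrightarrow> length \<alpha> \<le> m \<Longrightarrow> iter_deriv \<alpha> (\<lambda>x. c * f x) = (\<lambda>x. c * iter_deriv \<alpha> f x)"
proof (induction m arbitrary: f \<alpha>)
  case (Suc m)
  have "partial_deriv i (\<lambda>x. c * f x) = (\<lambda>x. c * partial_deriv i f x)" for i
    using Suc.prems by (subst partial_deriv_mult) (auto simp: deriv_bound_Suc partial_deriv_const)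
  then show ?case using Suc by (cases \<alpha> rule: rev_cases) (auto simp: iter_deriv_snoc deriv_bound_Suc)
qed auto

lemma deriv_bound_cmult:
  assumes "deriv_bound m b f"
  shows "deriv_bound m (\<lambda>x. cmod c * b x) (\<lambda>x. c * f x)"
  unfolding deriv_bound_def
  using deriv_boundD[OF assms]
  by (auto simp: iter_deriv_cmult_aux[OF assms] norm_mult intro!: mult_left_mono)

lemma iter_deriv_affine_aux:
  fixes f :: "real^'n::finite \<Rightarrow> complex"
  shows "deriv_bound m b f \<Longrightarrow> length \<alpha> \<le> m \<Longrightarrow>
    iter_deriv \<alpha> (\<lambda>x. f (c *\<^sub>R x + v)) = (\<lambda>x. of_real c ^ length \<alpha> * iter_deriv \<alpha> f (c *\<^sub>R x + v))"
proof (induction m arbitrary: f \<alpha> b)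
  case (Suc m)
  have d: "\<And>x. f differentiable (at x)" using Suc.prems by (auto simp: deriv_bound_Suc)
  show ?case
  proof (cases \<alpha> rule: rev_cases)
    case (snoc \<beta> i)
    let ?g = "\<lambda>x. partial_deriv i f (c *\<^sub>R x + v)"
    have l: "length \<beta> \<le> m" and pb: "deriv_bound m b (partial_deriv i f)"
      using Suc.prems snoc by (auto simp: deriv_bound_Suc)
    have e: "iter_deriv \<gamma> ?g = (\<lambda>x. of_real c ^ length \<gamma> * iter_deriv \<gamma> (partial_deriv i f) (c *\<^sub>R x + v))"
      if "length \<gamma> \<le> m" for \<gamma> using Suc.IH[OF pb] that by simp
    \<comment> \<open>Moving the constant of the chain rule past the outer derivatives requires
      their existence; this bound supplies it in the form that \<open>iter_deriv_cmult_aux\<close>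
      expects.\<close>
    have "deriv_bound m (\<lambda>x. max 1 \<bar>c\<bar> ^ m * b (c *\<^sub>R x + v)) ?g"
      unfolding deriv_bound_def
    proof (intro allI impI conjI)
      fix \<gamma> :: "'n list" and x assume g: "length \<gamma> \<le> m"
      show "iter_deriv \<gamma> ?g differentiable at x"
        unfolding e[OF g] by (intro differentiable_mult differentiable_const partial_deriv_affine(2) deriv_boundD[OF pb g])
      have "\<bar>c\<bar> ^ length \<gamma> \<le> max 1 \<bar>c\<bar> ^ length \<gamma>" by (intro power_mono) auto
      also have "\<dots> \<le> max 1 \<bar>c\<bar> ^ m" using g by (intro power_increasing) auto
      finally show "cmod (iter_deriv \<gamma> ?g x) \<le> max 1 \<bar>c\<bar> ^ m * b (c *\<^sub>R x + v)"
        unfolding e[OF g] norm_mult norm_power norm_of_real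
        using deriv_boundD[OF pb g] by (intro mult_mono) auto
    qed
    from iter_deriv_cmult_aux[OF this l, of "of_real c"] show ?thesis
      by (simp add: snoc iter_deriv_snoc partial_deriv_affine[OF d] e[OF l] mult_ac)
  qed auto
qed auto

lemma deriv_bound_affine:
  fixes f :: "real^'n::finite \<Rightarrow> complex"
  assumes "deriv_bound m b f"
  shows "deriv_bound m (\<lambda>x. max 1 \<bar>c\<bar> ^ m * b (c *\<^sub>R x + v)) (\<lambda>x. f (c *\<^sub>R x + v))"
  unfolding deriv_bound_def
proof (intro allI impI conjI)
  fix \<gamma> :: "'n list" and x assume g: "length \<gamma> \<le> m"
  note e = iter_deriv_affine_aux[OF assms g]
  show "iter_deriv \<gamma> (\<lambda>x. f (c *\<^sub>R x + v)) differentiable at x"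
    unfolding e by (intro differentiable_mult differentiable_const partial_deriv_affine(2) deriv_boundD[OF assms g])
  have "\<bar>c\<bar> ^ length \<gamma> \<le> max 1 \<bar>c\<bar> ^ length \<gamma>" by (intro power_mono) auto
  also have "\<dots> \<le> max 1 \<bar>c\<bar> ^ m" using g by (intro power_increasing) auto
  finally show "cmod (iter_deriv \<gamma> (\<lambda>x. f (c *\<^sub>R x + v)) x) \<le> max 1 \<bar>c\<bar> ^ m * b (c *\<^sub>R x + v)"
    unfolding e norm_mult norm_power norm_of_real
    using deriv_boundD[OF assms g] by (intro mult_mono) auto
qed

text \<open>There are finitely many lists of length at most m, so the sum of the moduli of all these
  derivatives is an admissible majorant.\<close>

lemma smooth_iff: "smooth f \<longleftrightarrow> (\<forall>m. \<exists>b. deriv_bound m b f)"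
proof
  assume s: "smooth f"
  show "\<forall>m. \<exists>b. deriv_bound m b f"
  proof
    fix m
    have "finite {\<alpha>::'a list. length \<alpha> \<le> m}"
      using finite_lists_length_le[of "UNIV :: 'a set" m] by simp
    then show "\<exists>b. deriv_bound m b f" using s
      by (intro exI[of _ "\<lambda>x. \<Sum>\<alpha> | length \<alpha> \<le> m. cmod (iter_deriv \<alpha> f x)"])
         (auto simp: deriv_bound_def smooth_def intro!: member_le_sum)
  qed
next
  assume "\<forall>m. \<exists>b. deriv_bound m b f"
  then show "smooth f" unfolding smooth_def deriv_bound_def by (meson order_refl)
qed

lemma smooth_differentiable: "smooth f \<Longrightarrow> iter_deriv \<alpha> f differentiable (at x)"
  by (simp add: smooth_def)

lemma smooth_continuous: "smooth f \<Longrightarrow> continuous_on A (iter_deriv \<alpha> f)"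
  by (meson continuous_at_imp_continuous_on differentiable_imp_continuous_within smooth_differentiable)

lemma smooth_partial_deriv: "smooth f \<Longrightarrow> smooth (partial_deriv i f)"
  unfolding smooth_def by (simp add: iter_deriv_snoc[symmetric])

lemma smooth_mult: "smooth f \<Longrightarrow> smooth g \<Longrightarrow> smooth (\<lambda>x. f x * g x)"
proof -
  assume fg: "smooth f" "smooth g"
  have "\<exists>b. deriv_bound m b (\<lambda>x. f x * g x)" for m
  proof -
    from fg obtain b c where "deriv_bound m b f" "deriv_bound m c g" unfolding smooth_iff by metis
    from deriv_bound_mult[OF this] show ?thesis by blast
  qed
  then show ?thesis by (simp add: smooth_iff)
qed

lemma smooth_const: "smooth (\<lambda>x. c)"
  unfolding smooth_iff using deriv_bound_const by blast

lemma smooth_affine: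
  fixes f :: "real^'n::finite \<Rightarrow> complex"
  shows "smooth f \<Longrightarrow> smooth (\<lambda>x. f (c *\<^sub>R x + v))"
  unfolding smooth_iff using deriv_bound_affine[of _ _ f c v] by blast

lemma iter_deriv_cmult: "smooth f \<Longrightarrow> iter_deriv \<alpha> (\<lambda>x. c * f x) = (\<lambda>x. c * iter_deriv \<alpha> f x)"
  using iter_deriv_cmult_aux unfolding smooth_iff by blast

lemma iter_deriv_affine:
  fixes f :: "real^'n::finite \<Rightarrow> complex"
  shows "smooth f \<Longrightarrow>
    iter_deriv \<alpha> (\<lambda>x. f (c *\<^sub>R x + v)) = (\<lambda>x. of_real c ^ length \<alpha> * iter_deriv \<alpha> f (c *\<^sub>R x + v))"
  using iter_deriv_affine_aux unfolding smooth_iff by blast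

lemma iter_deriv_add:
  "smooth f \<Longrightarrow> smooth g \<Longrightarrow> iter_deriv \<alpha> (\<lambda>x. f x + g x) = (\<lambda>x. iter_deriv \<alpha> f x + iter_deriv \<alpha> g x)"
proof (induction \<alpha> arbitrary: f g rule: rev_induct)
  case (snoc i \<alpha>)
  then show ?case
    using smooth_differentiable[OF snoc.prems(1), of "[]"] smooth_differentiable[OF snoc.prems(2), of "[]"]
    by (simp add: iter_deriv_snoc partial_deriv_add smooth_partial_deriv)
qed auto

section \<open>Schwartz functions\<close>

lemma schwartz_seminorm_le_iff:
  assumes "0 \<le> C"
  shows "schwartz_seminorm k m f \<le> ennreal C \<longleftrightarrow>
    (\<forall>x \<alpha>. length \<alpha> \<le> m \<longrightarrow> (1 + norm x) ^ k * cmod (iter_deriv \<alpha> f x) \<le> C)"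
  using assms by (auto simp: schwartz_seminorm_def SUP_le_iff)

lemma schwartz_seminorm_le:
  assumes "deriv_bound m (\<lambda>x. C * wt (- real k) x) f" "0 \<le> C"
  shows "schwartz_seminorm k m f \<le> ennreal C"
  unfolding schwartz_seminorm_le_iff[OF assms(2)]
proof (intro allI impI)
  fix x \<alpha> assume "length (\<alpha>::'a list) \<le> m"
  from deriv_boundD(2)[OF assms(1) this, of x]
  show "(1 + norm x) ^ k * cmod (iter_deriv \<alpha> f x) \<le> C"
    by (simp add: wt_of_nat[symmetric] wt_minus field_simps)
qed

lemma deriv_bound_of_seminorm:
  assumes "smooth f" "schwartz_seminorm k m f \<le> ennreal C" "0 \<le> C"
  shows "deriv_bound m (\<lambda>x. C * wt (- real k) x) f"
  unfolding deriv_bound_def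
proof (intro allI impI conjI)
  fix x \<alpha> assume "length (\<alpha>::'a list) \<le> m"
  then have "(1 + norm x) ^ k * cmod (iter_deriv \<alpha> f x) \<le> C"
    using assms schwartz_seminorm_le_iff[OF assms(3)] by blast
  then show "cmod (iter_deriv \<alpha> f x) \<le> C * wt (- real k) x"
    by (simp add: wt_of_nat[symmetric] wt_minus field_simps)
qed (use assms in \<open>auto simp: smooth_def\<close>)

text \<open>Real exponents s replace the integers of the seminorms, since the weights coming from
  the kernel are not integral; an integer above s links the two.\<close>

lemma schwartz_iff:
  "f \<in> schwartz \<longleftrightarrow> (\<forall>m s. \<exists>C\<ge>0. deriv_bound m (\<lambda>x. C * wt (- s) x) f)"
proof
  assume f: "f \<in> schwartz"
  show "\<forall>m s. \<exists>C\<ge>0. deriv_bound m (\<lambda>x. C * wt (- s) x) f"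
  proof (intro allI)
    fix m :: nat and s :: real
    obtain k where k: "s \<le> real k" using real_arch_simple by blast
    have "schwartz_seminorm k m f < \<infinity>" using f by (simp add: schwartz_def)
    then obtain C where C: "0 \<le> C" "schwartz_seminorm k m f = ennreal C"
      by (cases "schwartz_seminorm k m f") auto
    then have "deriv_bound m (\<lambda>x. C * wt (- real k) x) f"
      using f by (intro deriv_bound_of_seminorm) (auto simp: schwartz_def)
    then have "deriv_bound m (\<lambda>x. C * wt (- s) x) f"
      by (rule deriv_bound_mono) (use k C in \<open>auto intro!: mult_left_mono wt_mono\<close>)
    with C show "\<exists>C\<ge>0. deriv_bound m (\<lambda>x. C * wt (- s) x) f" by blast
  qed
next
  assume *: "\<forall>m s. \<exists>C\<ge>0. deriv_bound m (\<lambda>x. C * wt (- s) x) f"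
  then have "smooth f" unfolding smooth_iff by blast
  moreover have "schwartz_seminorm k m f < \<infinity>" for k m
  proof -
    from * obtain C where "0 \<le> C" "deriv_bound m (\<lambda>x. C * wt (- real k) x) f" by blast
    from schwartz_seminorm_le[OF this(2,1)] show ?thesis by (simp add: le_less_trans)
  qed
  ultimately show "f \<in> schwartz" by (simp add: schwartz_def)
qed

lemma schwartzE:
  assumes "f \<in> schwartz" obtains C where "0 \<le> C" "deriv_bound m (\<lambda>x. C * wt (- s) x) f"
  using assms schwartz_iff by blast

lemma schwartz_smooth: "f \<in> schwartz \<Longrightarrow> smooth f"
  by (simp add: schwartz_def)

lemma schwartz_add: "f \<in> schwartz \<Longrightarrow> g \<in> schwartz \<Longrightarrow> (\<lambda>x. f x + g x) \<in> schwartz"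
  unfolding schwartz_iff
proof (intro allI)
  fix m s
  assume "\<forall>m s. \<exists>C\<ge>0. deriv_bound m (\<lambda>x. C * wt (- s) x) f" "\<forall>m s. \<exists>C\<ge>0. deriv_bound m (\<lambda>x. C * wt (- s) x) g"
  then obtain C D where "C \<ge> 0" "D \<ge> 0" "deriv_bound m (\<lambda>x. C * wt (- s) x) f" "deriv_bound m (\<lambda>x. D * wt (- s) x) g"
    by metis
  then show "\<exists>C\<ge>0. deriv_bound m (\<lambda>x. C * wt (- s) x) (\<lambda>x. f x + g x)"
    by (intro exI[of _ "C + D"]) (auto simp: distrib_right intro: deriv_bound_add)
qed

text \<open>If g grows with exponent t at order m, it suffices to ask f for decay s + t. The
  exponent may depend on m; this covers multiplication by the kernel, which is not Schwartz.\<close>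

lemma schwartz_mult_moderate:
  assumes f: "f \<in> schwartz" and g: "\<And>m. \<exists>C s. 0 \<le> C \<and> deriv_bound m (\<lambda>x. C * wt s x) g"
  shows "(\<lambda>x. f x * g x) \<in> schwartz"
  unfolding schwartz_iff
proof (intro allI)
  fix m s
  obtain D t where D: "0 \<le> D" "deriv_bound m (\<lambda>x. D * wt t x) g" using g by blast
  obtain C where C: "0 \<le> C" "deriv_bound m (\<lambda>x. C * wt (- (s + t)) x) f" using f by (rule schwartzE)
  have "wt (-(s+t)) x * wt t x = wt (-s) x" for x :: "real^'a" by (simp add: wt_add[symmetric])
  then have "2 ^ m * (C * wt (- (s + t)) x * (D * wt t x)) = (2 ^ m * C * D) * wt (-s) x" for x :: "real^'a"
    by (metis mult.assoc mult.left_commute)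
  then have "deriv_bound m (\<lambda>x. (2 ^ m * C * D) * wt (-s) x) (\<lambda>x. f x * g x)"
    using deriv_bound_mult[OF C(2) D(2)] by presburger
  then show "\<exists>C\<ge>0. deriv_bound m (\<lambda>x. C * wt (- s) x) (\<lambda>x. f x * g x)"
    using C(1) D(1) by (intro exI[of _ "2 ^ m * C * D"]) auto
qed

lemma schwartz_cmult: "f \<in> schwartz \<Longrightarrow> (\<lambda>x. c * f x) \<in> schwartz"
proof -
  assume f: "f \<in> schwartz"
  have "(\<lambda>x. f x * c) \<in> schwartz"
    using deriv_bound_const[of _ c]
    by (intro schwartz_mult_moderate[OF f] exI[of _ "cmod c"] exI[of _ 0]) auto
  then show ?thesis by (simp add: mult.commute)
qed

lemma schwartz_zero: "(\<lambda>x. 0) \<in> schwartz"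
  unfolding schwartz_iff using deriv_bound_const[of _ 0] by (intro allI exI[of _ 0]) auto

lemma wt_affine_le:
  fixes v :: "'a::real_normed_vector"
  assumes "c \<noteq> 0" "0 \<le> s"
  obtains M where "0 < M" "\<And>x::'a. wt (- s) (c *\<^sub>R x + v) \<le> M * wt (- s) x"
proof
  \<comment> \<open>With this L one has 1 + |x| \<le> L (1 + |c x|), whether c stretches or
    shrinks.\<close>
  define L where "L = max 1 (1 / \<bar>c\<bar>)"
  show "0 < wt s v * L powr s" by (simp add: L_def)
  fix x :: 'a
  have "1 + norm x \<le> L * (1 + norm (c *\<^sub>R x))"
  proof -
    have "norm x = (1 / \<bar>c\<bar>) * norm (c *\<^sub>R x)" using assms by simp
    also have "\<dots> \<le> L * norm (c *\<^sub>R x)" by (intro mult_right_mono) (auto simp: L_def)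
    finally show ?thesis by (simp add: distrib_left L_def)
  qed
  then have "wt s x \<le> L powr s * wt s (c *\<^sub>R x)"
    using assms(2) by (auto simp: wt_def L_def powr_mult[symmetric] intro!: powr_mono2 add_nonneg_nonneg)
  then have 1: "wt (-s) (c *\<^sub>R x) \<le> L powr s * wt (-s) x" by (simp add: wt_minus field_simps)
  have "wt (-s) (c *\<^sub>R x + v) \<le> wt (-s) (c *\<^sub>R x) * wt s v" by (rule wt_peetre_minus[OF assms(2)])
  also have "\<dots> \<le> (L powr s * wt (-s) x) * wt s v" by (intro mult_right_mono 1) auto
  finally show "wt (-s) (c *\<^sub>R x + v) \<le> wt s v * L powr s * wt (-s) x" by (simp add: mult_ac)
qed

lemma schwartz_affine:
  assumes f: "f \<in> schwartz" and c: "c \<noteq> 0"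
  shows "(\<lambda>x. f (c *\<^sub>R x + v)) \<in> schwartz"
  unfolding schwartz_iff
proof (intro allI)
  fix m s
  obtain C where C: "0 \<le> C" "deriv_bound m (\<lambda>x. C * wt (- \<bar>s\<bar>) x) f" using f by (rule schwartzE)
  obtain M where M: "0 < M" "\<And>x. wt (- \<bar>s\<bar>) (c *\<^sub>R x + v) \<le> M * wt (- \<bar>s\<bar>) x"
    using wt_affine_le[OF c abs_ge_zero] by metis
  have "max 1 \<bar>c\<bar> ^ m * (C * wt (- \<bar>s\<bar>) (c *\<^sub>R x + v)) \<le> (max 1 \<bar>c\<bar> ^ m * C * M) * wt (- s) x" for x
  proof -
    have "C * wt (- \<bar>s\<bar>) (c *\<^sub>R x + v) \<le> C * (M * wt (- s) x)"
      using M(2)[of x] M(1) wt_mono[of "- \<bar>s\<bar>" "- s" x] C(1)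
      by (intro mult_left_mono) (auto intro: order_trans)
    then show ?thesis by (simp add: mult.assoc mult_left_mono)
  qed
  with deriv_bound_affine[OF C(2), of c v] C(1) M(1)
  show "\<exists>C\<ge>0. deriv_bound m (\<lambda>x. C * wt (- s) x) (\<lambda>x. f (c *\<^sub>R x + v))"
    by (intro exI[of _ "max 1 \<bar>c\<bar> ^ m * C * M"] conjI) (auto intro: deriv_bound_mono)
qed

section \<open>Coordinate functions and the Gaussian\<close>

lemma deriv_bound_coord: "deriv_bound m (\<lambda>x. wt 1 x) (\<lambda>x. complex_of_real (x $ i))"
proof (cases m)
  have d: "((\<lambda>x. complex_of_real (x $ i)) has_derivative (\<lambda>h. complex_of_real (h $ i))) (at x)" for x
    by (intro bounded_linear.has_derivative[OF bounded_linear_of_real] bounded_linear.has_derivative[OF bounded_linear_vec_nth] has_derivative_ident)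
  have 1: "(\<lambda>x. complex_of_real (x $ i)) differentiable at x \<and> cmod (complex_of_real (x $ i)) \<le> wt 1 x" for x
    using d component_le_norm_cart[of x i] by (auto simp: differentiable_def wt_def)
  {
    case 0 then show ?thesis using 1 by (auto simp: deriv_bound_0)
  next
    case (Suc k)
  have "partial_deriv j (\<lambda>x. complex_of_real (x $ i)) = (\<lambda>x. complex_of_real (axis j 1 $ i))" for j
    by (rule ext) (simp add: partial_deriv_eqI[OF d])
  then have "deriv_bound k (\<lambda>x. wt 1 x) (partial_deriv j (\<lambda>x. complex_of_real (x $ i)))" for j
    by (auto simp: axis_def wt_ge_1 intro!: deriv_bound_mono[OF deriv_bound_const])
  then show ?thesis unfolding Suc deriv_bound_Suc using 1 by auto
  }
qed

definition gauss :: "real^'n::finite \<Rightarrow> complex" where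
  "gauss x = of_real (exp (- (norm x)\<^sup>2))"

lemma gauss_0 [simp]: "gauss 0 = 1"
  by (simp add: gauss_def)

lemma gauss_has_derivative: "(gauss has_derivative (\<lambda>h. of_real (- 2 * (x \<bullet> h)) * gauss x)) (at x)"
proof -
  have "((\<lambda>x. exp (- (x \<bullet> x))) has_derivative (\<lambda>h. - 2 * (x \<bullet> h) * exp (- (x \<bullet> x)))) (at x)"
    by (auto intro!: derivative_eq_intros simp: inner_commute algebra_simps)
  from bounded_linear.has_derivative[OF bounded_linear_of_real this]
  show ?thesis unfolding gauss_def[abs_def] power2_norm_eq_inner by simp
qed

lemma gauss_differentiable: "gauss differentiable (at x)"
  using gauss_has_derivative unfolding differentiable_def by blast

text \<open>Every derivative of the Gaussian produces a factor -2 x_i, so each order costs one power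
  of the weight.\<close>

lemma gauss_deriv_bound:
  "\<exists>C\<ge>0. deriv_bound m (\<lambda>x. C * (wt (real m) x * exp (- (norm x)\<^sup>2))) (gauss :: real^'n::finite \<Rightarrow> complex)"
proof (induction m)
  case 0
  then show ?case
    by (intro exI[of _ 1]) (auto simp: deriv_bound_0 gauss_differentiable, simp add: gauss_def)
next
  case (Suc m)
  then obtain C where C: "0 \<le> C" "deriv_bound m (\<lambda>x. C * (wt (real m) x * exp (- (norm x)\<^sup>2))) (gauss :: real^'n \<Rightarrow> complex)"
    by blast
  define D where "D = 2 * 2 ^ m * C + 1"
  have "partial_deriv i gauss = (\<lambda>x. (-2) * (of_real (x $ i) * gauss x))" for i :: 'n
    by (rule ext, subst partial_deriv_eqI[OF gauss_has_derivative])
       (simp add: inner_axis)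
  moreover have "deriv_bound m (\<lambda>x. D * (wt (real (Suc m)) x * exp (- (norm x)\<^sup>2)))
      (\<lambda>x. (-2) * (of_real (x $ i) * gauss x))" for i :: 'n
  proof (rule deriv_bound_mono[OF deriv_bound_cmult[OF deriv_bound_mult[OF deriv_bound_coord C(2)]]])
    fix x :: "real^'n"
    have "cmod (-2) * (2 ^ m * (wt 1 x * (C * (wt (real m) x * exp (- (norm x)\<^sup>2))))) =
       2 * 2 ^ m * C * (wt (real (Suc m)) x * exp (- (norm x)\<^sup>2))"
      by (simp add: wt_add of_nat_Suc)
    also have "\<dots> \<le> D * (wt (real (Suc m)) x * exp (- (norm x)\<^sup>2))"
      by (intro mult_right_mono) (auto simp: D_def)
    finally show "cmod (-2) * (2 ^ m * (wt 1 x * (C * (wt (real m) x * exp (- (norm x)\<^sup>2))))) \<le>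
       D * (wt (real (Suc m)) x * exp (- (norm x)\<^sup>2))" .
  qed auto
  moreover have "cmod (gauss x) \<le> D * (wt (real (Suc m)) x * exp (- (norm x)\<^sup>2))" for x :: "real^'n"
  proof -
    have "cmod (gauss x) = 1 * (1 * exp (- (norm x)\<^sup>2))" by (simp add: gauss_def)
    also have "\<dots> \<le> D * (wt (real (Suc m)) x * exp (- (norm x)\<^sup>2))"
      using C wt_ge_1[of "real (Suc m)" x] by (intro mult_mono) (auto simp: D_def)
    finally show ?thesis .
  qed
  ultimately show ?case using C
    by (intro exI[of _ D]) (auto simp: deriv_bound_Suc gauss_differentiable D_def)
qed

lemma schwartz_gauss: "gauss \<in> schwartz"
  unfolding schwartz_iff
proof (intro allI)
  fix m :: nat and s :: real
  obtain C where C: "0 \<le> C" "deriv_bound m (\<lambda>x. C * (wt (real m) x * exp (- (norm x)\<^sup>2))) (gauss :: real^'n \<Rightarrow> complex)"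
    using gauss_deriv_bound by blast
  have "((\<lambda>t::real. (1 + t) powr (real m + s) * exp (- t\<^sup>2)) \<longlongrightarrow> 0) at_top" by real_asymp
  then have "eventually (\<lambda>t::real. (1 + t) powr (real m + s) * exp (- t\<^sup>2) < 1) at_top"
    by (rule order_tendstoD) simp
  then obtain T where T: "\<And>t. t \<ge> T \<Longrightarrow> (1 + t) powr (real m + s) * exp (- t\<^sup>2) < 1"
    by (auto simp: eventually_at_top_linorder)
  define M where "M = (1 + \<bar>T\<bar>) powr \<bar>real m + s\<bar> + 1"
  have M: "wt (real m + s) x * exp (- (norm x)\<^sup>2) \<le> M" for x :: "real^'n"
  proof (cases "norm x \<ge> T")
    case True
    then show ?thesis using T[of "norm x"] by (auto simp: wt_def M_def intro: add_increasing)
  next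
    case False
    have "wt (real m + s) x * exp (- (norm x)\<^sup>2) \<le> wt (real m + s) x * 1" by (intro mult_left_mono) auto
    also have "\<dots> \<le> wt \<bar>real m + s\<bar> x" using wt_mono[OF abs_ge_self, of "real m + s" x] by simp
    also have "\<dots> \<le> (1 + \<bar>T\<bar>) powr \<bar>real m + s\<bar>"
      unfolding wt_def using False by (intro powr_mono2) (auto simp del: abs_le_iff)
    finally show ?thesis by (simp add: M_def)
  qed
  have "deriv_bound m (\<lambda>x. C * M * wt (- s) x) (gauss :: real^'n \<Rightarrow> complex)"
  proof (rule deriv_bound_mono[OF C(2)])
    fix x :: "real^'n"
    have "wt (real m) x * exp (- (norm x)\<^sup>2) = (wt (real m + s) x * exp (- (norm x)\<^sup>2)) * wt (-s) x"
      by (simp add: wt_add wt_minus)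
    also have "\<dots> \<le> M * wt (-s) x" by (intro mult_right_mono M) auto
    finally show "C * (wt (real m) x * exp (- (norm x)\<^sup>2)) \<le> C * M * wt (-s) x"
      using C by (simp add: mult_left_mono mult.assoc)
  qed auto
  then show "\<exists>C\<ge>0. deriv_bound m (\<lambda>x. C * wt (- s) x) (gauss :: real^'n \<Rightarrow> complex)"
    using C(1) by (intro exI[of _ "C * M"]) (auto simp: M_def)
qed

section \<open>Integrals of families of test functions\<close>

lemma integral_norm_le:
  fixes f :: "'a \<Rightarrow> 'b::{banach, second_countable_topology}"
  assumes "integrable M f" "integrable M g" "\<And>x. norm (f x) \<le> g x"
  shows "norm (\<integral>x. f x \<partial>M) \<le> (\<integral>x. g x \<partial>M)"
  using assms by (intro order_trans[OF integral_norm_bound integral_mono]) auto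

text \<open>Dyadic decomposition: at distance about 2^k the weight is at most 2^b 2^(-kb), while g
  has mass at most \<mu> 2^(kn) on the ball of that radius; the geometric series with ratio 2^(n-b)
  converges. Full balls may replace the shells because only an upper bound is wanted. The case g = 1
  gives integrability of the weight, and g = G^r is the case needed for the maximal
  function.\<close>

lemma nn_integral_wt_le:
  assumes b: "real CARD('n) < b"
  obtains C where "0 \<le> C"
    "\<And>(g :: real^'n::finite \<Rightarrow> ennreal) \<mu>. \<lbrakk>g \<in> borel_measurable lebesgue; 0 \<le> \<mu>;
       \<And>\<rho>. 0 < \<rho> \<Longrightarrow> (\<integral>\<^sup>+z\<in>cball 0 \<rho>. g z \<partial>lebesgue) \<le> ennreal (\<mu> * \<rho> ^ CARD('n))\<rbrakk> \<Longrightarrow>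
     (\<integral>\<^sup>+z. ennreal (wt (- b) z) * g z \<partial>lebesgue) \<le> ennreal (C * \<mu>)"
proof -
  define n where "n = real CARD('n)"
  define q where "q = 2 powr (n - b)"
  have q: "0 < q" "q < 1" using b powr_less_mono[of "n - b" 0 2] by (simp_all add: q_def n_def)
  define C where "C = 2 powr b / (1 - q)"
  show ?thesis
  proof (rule that[of C])
    show "0 \<le> C" using q by (simp add: C_def)
    fix g :: "real^'n \<Rightarrow> ennreal" and \<mu> :: real
    assume g [measurable]: "g \<in> borel_measurable lebesgue" and \<mu>: "0 \<le> \<mu>"
      and le: "\<And>\<rho>. 0 < \<rho> \<Longrightarrow> (\<integral>\<^sup>+z\<in>cball 0 \<rho>. g z \<partial>lebesgue) \<le> ennreal (\<mu> * \<rho> ^ CARD('n))"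
    define F where "F k z = ennreal (2 powr b * (2 ^ k) powr - b) * (g z * indicator (cball 0 (2 ^ k)) z)" for k :: nat and z
    have F: "F k \<in> borel_measurable lebesgue" for k
    proof -
      have [measurable]: "cball 0 (2 ^ k) \<in> sets (lebesgue :: (real^'n) measure)" by simp
      show ?thesis unfolding F_def by measurable
    qed
    have "ennreal (wt (- b) z) * g z \<le> (\<Sum>k. F k z)" for z
    proof -
      obtain m where "norm z < 2 ^ m" using real_arch_pow[of 2 "norm z"] by auto
      then have ex: "\<exists>m. norm z \<le> 2 ^ m" by (auto intro: less_imp_le)
      \<comment> \<open>Minimality puts z outside the ball of radius 2^(k-1), except when k = 0,
        where the weight is at most 1.\<close>
      define k where "k = (LEAST m. norm z \<le> 2 ^ m)"
      have k: "norm z \<le> 2 ^ k" unfolding k_def by (rule LeastI_ex[OF ex])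
      have b0: "0 \<le> b" using b of_nat_0_le_iff[of "CARD('n)"] by linarith
      have "wt (- b) z \<le> 2 powr b * (2 ^ k) powr - b"
      proof (cases k)
        case 0
        have "wt (- b) z \<le> 1" by (rule wt_le_1) (use b0 in simp)
        also have "\<dots> \<le> 2 powr b" using b0 by (simp add: ge_one_powr_ge_zero)
        finally show ?thesis using 0 by simp
      next
        case (Suc j)
        have "2 ^ j < norm z" using not_less_Least[of j "\<lambda>m. norm z \<le> 2 ^ m"] Suc by (simp add: k_def)
        then have "wt (- b) z \<le> (2 ^ j) powr - b"
          unfolding wt_def using b0 by (intro powr_mono2') auto
        also have "\<dots> = 2 powr b * (2 ^ k) powr - b"
          unfolding Suc by (simp add: powr_mult powr_minus)
        finally show ?thesis .
      qed
      then have "ennreal (wt (- b) z) * g z \<le> F k z"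
        using k by (auto simp: F_def intro!: mult_right_mono ennreal_leI)
      also have "F k z \<le> (\<Sum>k. F k z)"
        using sum_le_suminf[OF summableI, of "{k}" "\<lambda>k. F k z"] by simp
      finally show ?thesis .
    qed
    then have "(\<integral>\<^sup>+z. ennreal (wt (- b) z) * g z \<partial>lebesgue) \<le> (\<integral>\<^sup>+z. (\<Sum>k. F k z) \<partial>lebesgue)"
      by (intro nn_integral_mono)
    also have "\<dots> = (\<Sum>k. \<integral>\<^sup>+z. F k z \<partial>lebesgue)" by (rule nn_integral_suminf[OF F])
    also have "\<dots> \<le> (\<Sum>k. ennreal (2 powr b * \<mu> * q ^ k))"
    proof (rule suminf_le)
      fix k
      have [measurable]: "cball 0 (2 ^ k) \<in> sets (lebesgue :: (real^'n) measure)" by simp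
      have "(\<integral>\<^sup>+z. F k z \<partial>lebesgue) = ennreal (2 powr b * (2 ^ k) powr - b) * (\<integral>\<^sup>+z\<in>cball 0 (2 ^ k). g z \<partial>lebesgue)"
        unfolding F_def by (rule nn_integral_cmult) measurable
      also have "\<dots> \<le> ennreal (2 powr b * (2 ^ k) powr - b) * ennreal (\<mu> * (2 ^ k) ^ CARD('n))"
        by (intro mult_left_mono le) auto
      also have "\<dots> = ennreal (2 powr b * \<mu> * q ^ k)"
      proof -
        have "q ^ k = (2 ^ k) powr (n + - b)"
          by (simp add: q_def powr_powr powr_realpow[symmetric] mult.commute)
        also have "\<dots> = (2 ^ k) ^ CARD('n) * (2 ^ k) powr - b"
          unfolding powr_add n_def by (simp add: powr_realpow)
        finally show ?thesis using \<mu> by (simp add: ennreal_mult[symmetric] mult_ac)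
      qed
      finally show "(\<integral>\<^sup>+z. F k z \<partial>lebesgue) \<le> ennreal (2 powr b * \<mu> * q ^ k)" .
    qed (auto intro: summableI)
    also have "\<dots> = ennreal (2 powr b * \<mu> * (1 / (1 - q)))"
      using q \<mu> by (intro suminf_ennreal_eq sums_mult geometric_sums) auto
    finally show "(\<integral>\<^sup>+z. ennreal (wt (- b) z) * g z \<partial>lebesgue) \<le> ennreal (C * \<mu>)"
      by (simp add: C_def mult_ac)
  qed
qed

lemma integrable_wt:
  assumes b: "real CARD('n) < b"
  shows "integrable lborel (wt (- b) :: real^'n::finite \<Rightarrow> real)"
proof -
  obtain C where C: "0 \<le> C"
    "\<And>(g :: real^'n \<Rightarrow> ennreal) \<mu>. \<lbrakk>g \<in> borel_measurable lebesgue; 0 \<le> \<mu>;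
       \<And>\<rho>. 0 < \<rho> \<Longrightarrow> (\<integral>\<^sup>+z\<in>cball 0 \<rho>. g z \<partial>lebesgue) \<le> ennreal (\<mu> * \<rho> ^ CARD('n))\<rbrakk> \<Longrightarrow>
     (\<integral>\<^sup>+z. ennreal (wt (- b) z) * g z \<partial>lebesgue) \<le> ennreal (C * \<mu>)"
    by (rule nn_integral_wt_le[OF b]) (rule that, assumption, blast)
  have "(\<integral>\<^sup>+(z::real^'n). ennreal (wt (- b) z) * 1 \<partial>lebesgue) \<le> ennreal (C * unit_ball_vol CARD('n))"
  proof (rule C(2))
    fix \<rho> :: real assume "0 < \<rho>"
    then show "(\<integral>\<^sup>+z\<in>cball 0 \<rho>. 1 \<partial>(lebesgue :: (real^'n) measure)) \<le> ennreal (unit_ball_vol CARD('n) * \<rho> ^ CARD('n))"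
      by (simp add: emeasure_cball)
  qed auto
  then have "(\<integral>\<^sup>+(z::real^'n). ennreal (norm (wt (- b) z)) \<partial>lborel) < \<infinity>"
    by (simp add: nn_integral_completion le_less_trans)
  then show ?thesis by (intro integrableI_bounded) auto
qed

section \<open>Taylor estimates and differentiation under the integral sign\<close>

lemma deriv_bound_lipschitz:
  fixes f :: "real^'n::finite \<Rightarrow> complex"
  assumes f: "deriv_bound 1 (\<lambda>_. B) f"
  shows "cmod (f x - f y) \<le> real CARD('n) * B * norm (x - y)"
proof (rule differentiable_bound[of UNIV f "\<lambda>x h. \<Sum>i\<in>UNIV. h $ i *\<^sub>R partial_deriv i f x"])
  fix x
  have d: "f differentiable (at x)" and p: "cmod (partial_deriv i f x) \<le> B" for i
    using f unfolding One_nat_def deriv_bound_Suc deriv_bound_0 by auto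
  show "(f has_derivative (\<lambda>h. \<Sum>i\<in>UNIV. h $ i *\<^sub>R partial_deriv i f x)) (at x within UNIV)"
    using has_derivative_partials[OF d] by simp
  show "onorm (\<lambda>h. \<Sum>i\<in>UNIV. h $ i *\<^sub>R partial_deriv i f x) \<le> real CARD('n) * B"
  proof (rule onorm_le)
    fix h :: "real^'n"
    have "norm (\<Sum>i\<in>UNIV. h $ i *\<^sub>R partial_deriv i f x) \<le> (\<Sum>i\<in>(UNIV::'n set). norm h * B)"
      using component_le_norm_cart[of h] p by (intro sum_norm_le) (auto intro!: mult_mono)
    then show "norm (\<Sum>i\<in>UNIV. h $ i *\<^sub>R partial_deriv i f x) \<le> real CARD('n) * B * norm h"
      by (simp add: mult_ac)
  qed
qed auto

text \<open>The mean value inequality is applied to s \<mapsto> f(x + s) minus its linear part, on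
  the ball of radius |h|. The derivative of this map is a difference of gradients, which the
  Lipschitz bound for the partial derivatives makes O(|h|).\<close>

lemma deriv_bound_taylor:
  fixes f :: "real^'n::finite \<Rightarrow> complex"
  assumes f: "deriv_bound 2 (\<lambda>_. B) f"
  shows "cmod (f (x + h) - f x - (\<Sum>i\<in>UNIV. h $ i *\<^sub>R partial_deriv i f x)) \<le> (real CARD('n))\<^sup>2 * B * (norm h)\<^sup>2"
proof -
  have d: "f differentiable (at y)" and p: "deriv_bound 1 (\<lambda>_. B) (partial_deriv i f)" for i y
    using f unfolding numeral_2_eq_2 One_nat_def deriv_bound_Suc[of "Suc 0"] by auto
  have B: "0 \<le> B" using deriv_bound_zero(2)[OF f, of 0] norm_ge_zero order_trans by blast
  let ?D = "\<lambda>y h. \<Sum>i\<in>UNIV. h $ i *\<^sub>R partial_deriv i f y"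
  let ?g = "\<lambda>s. f (x + s) - ?D x s"
  have lin: "bounded_linear (?D y)" for y
    using has_derivative_partials[OF d] by (rule has_derivative_bounded_linear)
  have "norm (?g h - ?g 0) \<le> ((real CARD('n))\<^sup>2 * B * norm h) * norm (h - 0)"
  proof (rule differentiable_bound[of "cball 0 (norm h)" ?g "\<lambda>s k. ?D (x + s) k - ?D x k"])
    fix s :: "real^'n" assume s: "s \<in> cball 0 (norm h)"
    have "((\<lambda>s. f (x + s)) has_derivative ?D (x + s)) (at s)"
      by (rule has_derivative_compose[OF _ has_derivative_partials[OF d], of "\<lambda>s. x + s" "\<lambda>k. k", simplified])
         (auto intro!: derivative_eq_intros)
    then have "(?g has_derivative (\<lambda>k. ?D (x + s) k - ?D x k)) (at s)"
      by (intro has_derivative_diff bounded_linear_imp_has_derivative[OF lin])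
    then show "(?g has_derivative (\<lambda>k. ?D (x + s) k - ?D x k)) (at s within cball 0 (norm h))"
      by (rule has_derivative_at_withinI)
    show "onorm (\<lambda>k. ?D (x + s) k - ?D x k) \<le> (real CARD('n))\<^sup>2 * B * norm h"
    proof (rule onorm_le)
      fix k :: "real^'n"
      have "?D (x + s) k - ?D x k = (\<Sum>i\<in>UNIV. k $ i *\<^sub>R (partial_deriv i f (x + s) - partial_deriv i f x))"
        by (simp add: sum_subtractf scaleR_diff_right)
      also have "norm \<dots> \<le> (\<Sum>i\<in>(UNIV::'n set). norm k * (real CARD('n) * B * norm h))"
      proof (rule sum_norm_le)
        fix i :: 'n
        have "cmod (partial_deriv i f (x + s) - partial_deriv i f x) \<le> real CARD('n) * B * norm s"
          using deriv_bound_lipschitz[OF p, where x = "x + s" and y = x] by simp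
        also have "\<dots> \<le> real CARD('n) * B * norm h"
          using s B by (intro mult_left_mono) auto
        finally show "norm (k $ i *\<^sub>R (partial_deriv i f (x + s) - partial_deriv i f x)) \<le> norm k * (real CARD('n) * B * norm h)"
          using component_le_norm_cart[of k i] by (auto intro!: mult_mono)
      qed
      finally show "norm (?D (x + s) k - ?D x k) \<le> (real CARD('n))\<^sup>2 * B * norm h * norm k"
        by (simp add: power2_eq_square mult_ac)
    qed
  qed auto
  then show ?thesis by (simp add: power2_eq_square mult_ac algebra_simps)
qed

text \<open>The hypotheses for differentiating an integral over z to any order. The majorant depends
  on z alone, so that a Taylor remainder can be integrated uniformly in x.\<close>

definition dom_family :: "(real^'n::finite \<Rightarrow> real^'n \<Rightarrow> complex) \<Rightarrow> bool" where
  "dom_family H \<longleftrightarrow>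
     (\<forall>m. \<exists>b. integrable lborel b \<and> (\<forall>z. deriv_bound m (\<lambda>_. b z) (H z))) \<and>
     (\<forall>\<alpha> x. (\<lambda>z. iter_deriv \<alpha> (H z) x) \<in> borel_measurable borel)"

lemma dom_family_partial_deriv:
  assumes "dom_family H" shows "dom_family (\<lambda>z. partial_deriv i (H z))"
proof -
  have "\<exists>b. integrable lborel b \<and> (\<forall>z. deriv_bound m (\<lambda>_. b z) (partial_deriv i (H z)))" for m
  proof -
    obtain b where "integrable lborel b" "\<forall>z. deriv_bound (Suc m) (\<lambda>_. b z) (H z)"
      using assms unfolding dom_family_def by blast
    then show ?thesis by (auto simp: deriv_bound_Suc)
  qed
  then show ?thesis using assms by (auto simp: dom_family_def iter_deriv_snoc[symmetric])
qed

lemma dom_family_integrable: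
  assumes "dom_family H" shows "integrable lborel (\<lambda>z. iter_deriv \<alpha> (H z) x)"
proof -
  obtain b where b: "integrable lborel b" "\<forall>z. deriv_bound (length \<alpha>) (\<lambda>_. b z) (H z)"
    using assms unfolding dom_family_def by blast
  have "(\<lambda>z. iter_deriv \<alpha> (H z) x) \<in> borel_measurable lborel" using assms by (simp add: dom_family_def)
  moreover have "AE z in lborel. norm (iter_deriv \<alpha> (H z) x) \<le> norm (b z)"
    using b(2) by (auto intro!: AE_I2 order_trans[OF deriv_boundD(2) abs_ge_self])
  ultimately show ?thesis by (rule Bochner_Integration.integrable_bound[OF b(1)])
qed

text \<open>Integrating the second-order Taylor remainder in z bounds the error by M |h|^2 with M
  proportional to the integral of the majorant, so the derivative is obtained directly from its
  definition.\<close>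

lemma dom_family_has_derivative:
  assumes H: "dom_family H"
  shows "((\<lambda>x. \<integral>z. H z x \<partial>lborel) has_derivative (\<lambda>h. \<Sum>i\<in>UNIV. h $ i *\<^sub>R (\<integral>z. partial_deriv i (H z) x \<partial>lborel))) (at (x :: real^'n::finite))"
proof -
  obtain b where b: "integrable lborel b" "\<And>z. deriv_bound 2 (\<lambda>_. b z) (H z)"
    using H unfolding dom_family_def by blast
  have i0: "integrable lborel (\<lambda>z. H z y)" for y using dom_family_integrable[OF H, of "[]"] by simp
  have i1: "integrable lborel (\<lambda>z. partial_deriv i (H z) y)" for i y
    using dom_family_integrable[OF H, of "[i]"] by (simp add: iter_deriv_Cons)
  define D where "D h = (\<Sum>i\<in>UNIV. h $ i *\<^sub>R (\<integral>z. partial_deriv i (H z) x \<partial>lborel))" for h :: "real^'n"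
  define M where "M = (real CARD('n))\<^sup>2 * (\<integral>z. b z \<partial>lborel)"
  have lin: "bounded_linear D"
    unfolding D_def
    by (intro bounded_linear_sum bounded_linear_scaleR_const[OF bounded_linear_vec_nth])
  have rem: "norm ((\<integral>z. H z (x + h) \<partial>lborel) - (\<integral>z. H z x \<partial>lborel) - D h) \<le> M * (norm h)\<^sup>2" for h
  proof -
    let ?f = "\<lambda>z. H z (x + h) - H z x - (\<Sum>i\<in>UNIV. h $ i *\<^sub>R partial_deriv i (H z) x)"
    have e: "(\<integral>z. H z (x + h) \<partial>lborel) - (\<integral>z. H z x \<partial>lborel) - D h = (\<integral>z. ?f z \<partial>lborel)"
      unfolding D_def by (simp add: i0 i1 integral_sum)
    have "norm (\<integral>z. ?f z \<partial>lborel) \<le> (\<integral>z. (real CARD('n))\<^sup>2 * b z * (norm h)\<^sup>2 \<partial>lborel)"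
      by (intro integral_norm_le Bochner_Integration.integrable_diff Bochner_Integration.integrable_sum
          integrable_scaleR_right i0 i1 integrable_mult_left integrable_mult_right b(1) deriv_bound_taylor b(2))
    also have "\<dots> = M * (norm h)\<^sup>2" by (simp add: M_def)
    finally show ?thesis unfolding e .
  qed
  have "((\<lambda>x. \<integral>z. H z x \<partial>lborel) has_derivative D) (at x)"
    unfolding has_derivative_at
  proof (intro conjI lin)
    have "((\<lambda>h::real^'n. M * norm h) \<longlongrightarrow> M * norm (0::real^'n)) (at 0)" by (intro tendsto_intros)
    then have lim: "((\<lambda>h::real^'n. M * norm h) \<longlongrightarrow> 0) (at 0)" by simp
    show "((\<lambda>h. norm ((\<integral>z. H z (x + h) \<partial>lborel) - (\<integral>z. H z x \<partial>lborel) - D h) / norm h) \<longlongrightarrow> 0) (at 0)"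
    proof (rule tendsto_sandwich[OF _ _ tendsto_const lim])
      show "\<forall>\<^sub>F h in at 0. norm ((\<integral>z. H z (x + h) \<partial>lborel) - (\<integral>z. H z x \<partial>lborel) - D h) / norm h \<le> M * norm h"
        unfolding eventually_at_filter
        by (rule always_eventually) (use rem in \<open>auto simp: divide_le_eq power2_eq_square mult.assoc\<close>)
    qed auto
  qed
  then show ?thesis unfolding D_def .
qed

lemma iter_deriv_dom_family_aux:
  "dom_family H \<Longrightarrow> iter_deriv \<alpha> (\<lambda>x. \<integral>z. H z x \<partial>lborel) = (\<lambda>x. \<integral>z. iter_deriv \<alpha> (H z) x \<partial>lborel) \<and>
     (\<forall>x. iter_deriv \<alpha> (\<lambda>x. \<integral>z. H z x \<partial>lborel) differentiable (at x))"
proof (induction \<alpha> arbitrary: H rule: rev_induct)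
  case Nil
  then show ?case using dom_family_has_derivative[OF Nil] by (auto simp: differentiable_def)
next
  case (snoc i \<alpha>)
  have eq: "partial_deriv i (\<lambda>x. \<integral>z. H z x \<partial>lborel) = (\<lambda>x. \<integral>z. partial_deriv i (H z) x \<partial>lborel)"
  proof
    fix x
    have "(\<Sum>j\<in>UNIV. axis i 1 $ j *\<^sub>R (\<integral>z. partial_deriv j (H z) x \<partial>lborel)) = (\<integral>z. partial_deriv i (H z) x \<partial>lborel)"
      by (simp add: axis_def if_distrib[of "\<lambda>c. c *\<^sub>R _"] cong: if_cong)
    then show "partial_deriv i (\<lambda>x. \<integral>z. H z x \<partial>lborel) x = (\<integral>z. partial_deriv i (H z) x \<partial>lborel)"
      using partial_deriv_eqI[OF dom_family_has_derivative[OF snoc.prems]] by simp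
  qed
  show ?case
    unfolding iter_deriv_snoc eq by (rule snoc.IH[OF dom_family_partial_deriv[OF snoc.prems]])
qed

lemma iter_deriv_dom_family:
  assumes "dom_family H"
  shows "smooth (\<lambda>x. \<integral>z. H z x \<partial>lborel)"
    and "iter_deriv \<alpha> (\<lambda>x. \<integral>z. H z x \<partial>lborel) x = (\<integral>z. iter_deriv \<alpha> (H z) x \<partial>lborel)"
  using iter_deriv_dom_family_aux[OF assms] unfolding smooth_def by (blast, simp)

section \<open>Families depending continuously on a parameter\<close>

definition jointly_continuous :: "(real^'n::finite \<Rightarrow> real^'n \<Rightarrow> complex) \<Rightarrow> bool" where
  "jointly_continuous H \<longleftrightarrow>
     (\<forall>z. smooth (H z)) \<and> (\<forall>\<alpha>. continuous_on UNIV (\<lambda>(z, x). iter_deriv \<alpha> (H z) x))"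

lemma jointly_continuous_measurable:
  assumes "jointly_continuous H"
  shows "(\<lambda>z. iter_deriv \<alpha> (H z) x) \<in> borel_measurable borel"
proof (rule borel_measurable_continuous_onI)
  have "continuous_on UNIV (\<lambda>(z, x). iter_deriv \<alpha> (H z) x)"
    using assms by (simp add: jointly_continuous_def)
  then have "continuous_on UNIV (\<lambda>z. (\<lambda>(z, x). iter_deriv \<alpha> (H z) x) (z, x))"
    by (rule continuous_on_compose2) (auto intro!: continuous_intros)
  then show "continuous_on UNIV (\<lambda>z. iter_deriv \<alpha> (H z) x)" by simp
qed

lemma jointly_continuous_partial_deriv:
  "jointly_continuous H \<Longrightarrow> jointly_continuous (\<lambda>z. partial_deriv i (H z))"
  by (auto simp: jointly_continuous_def iter_deriv_snoc[symmetric] smooth_partial_deriv)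

lemma jointly_continuous_mult:
  assumes "jointly_continuous F" "jointly_continuous G"
  shows "jointly_continuous (\<lambda>z x. F z x * G z x)"
proof -
  have "continuous_on UNIV (\<lambda>(z, x). iter_deriv \<alpha> (\<lambda>x. F z x * G z x) x)"
    if "jointly_continuous F" "jointly_continuous G" for \<alpha> and F G :: "real^'a \<Rightarrow> real^'a \<Rightarrow> complex"
    using that
  proof (induction \<alpha> arbitrary: F G rule: rev_induct)
    case Nil
    then have "continuous_on UNIV (\<lambda>(z, x). iter_deriv [] (F z) x)" "continuous_on UNIV (\<lambda>(z, x). iter_deriv [] (G z) x)"
      unfolding jointly_continuous_def by blast+
    then show ?case unfolding case_prod_unfold iter_deriv_Nil by (rule continuous_on_mult)
  next
    case (snoc i \<alpha>)
    let ?F = "\<lambda>z. partial_deriv i (F z)" and ?G = "\<lambda>z. partial_deriv i (G z)"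
    have s: "smooth (F z)" "smooth (G z)" "smooth (?F z)" "smooth (?G z)" for z
      using snoc.prems by (auto simp: jointly_continuous_def smooth_partial_deriv)
    have "partial_deriv i (\<lambda>x. F z x * G z x) = (\<lambda>x. ?F z x * G z x + F z x * ?G z x)" for z
      using smooth_differentiable[OF s(1), of "[]"] smooth_differentiable[OF s(2), of "[]"]
      by (intro partial_deriv_mult) simp_all
    then have "iter_deriv (\<alpha> @ [i]) (\<lambda>x. F z x * G z x) =
        (\<lambda>x. iter_deriv \<alpha> (\<lambda>x. ?F z x * G z x) x + iter_deriv \<alpha> (\<lambda>x. F z x * ?G z x) x)" for z
      by (simp add: iter_deriv_snoc iter_deriv_add smooth_mult s)
    moreover have "continuous_on UNIV (\<lambda>(z, x). iter_deriv \<alpha> (\<lambda>x. ?F z x * G z x) x)"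
      "continuous_on UNIV (\<lambda>(z, x). iter_deriv \<alpha> (\<lambda>x. F z x * ?G z x) x)"
      by (intro snoc.IH snoc.prems jointly_continuous_partial_deriv)+
    ultimately show ?case unfolding case_prod_unfold by (simp add: continuous_on_add)
  qed
  from this[OF assms] show ?thesis using assms by (simp add: jointly_continuous_def smooth_mult)
qed

lemma jointly_continuous_translate:
  assumes "smooth f" shows "jointly_continuous (\<lambda>z x. f (x - z))"
proof -
  have e: "f (x - z) = f (1 *\<^sub>R x + - z)" for x z by simp
  have "iter_deriv \<alpha> (\<lambda>x. f (x - z)) x = iter_deriv \<alpha> f (x - z)" for \<alpha> z x
    unfolding e iter_deriv_affine[OF assms] by simp
  moreover have "smooth (\<lambda>x. f (x - z))" for z
    unfolding e by (rule smooth_affine[OF assms])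
  ultimately show ?thesis
    by (auto simp: jointly_continuous_def case_prod_unfold
        intro!: continuous_on_compose2[OF smooth_continuous[OF assms, of UNIV]] continuous_intros)
qed

lemma jointly_continuous_const: "smooth f \<Longrightarrow> jointly_continuous (\<lambda>z. f)"
  by (auto simp: jointly_continuous_def case_prod_unfold
        intro!: continuous_on_compose2[OF smooth_continuous[of f UNIV]] continuous_intros)

lemma jointly_continuous_scalar:
  fixes c :: "real^'n::finite \<Rightarrow> complex"
  assumes "continuous_on UNIV c" shows "jointly_continuous (\<lambda>z x. c z)"
proof -
  have "iter_deriv \<alpha> (\<lambda>x::real^'n. c z) = (\<lambda>x. if \<alpha> = [] then c z else 0)" for \<alpha> z
  proof (cases \<alpha> rule: rev_cases)
    case (snoc \<beta> i)
    have "iter_deriv \<beta> (\<lambda>x::real^'n. 0 :: complex) = (\<lambda>x. 0)"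
      by (induction \<beta>) (simp_all add: iter_deriv_Cons partial_deriv_const)
    then show ?thesis using snoc by (simp add: iter_deriv_snoc partial_deriv_const)
  qed simp
  moreover have "continuous_on UNIV (\<lambda>p::(real^'n) \<times> (real^'n). if \<alpha> = [] then c (fst p) else 0)" for \<alpha> :: "'n list"
    by (cases "\<alpha> = []") (auto intro!: continuous_on_compose2[OF assms] continuous_intros)
  ultimately show ?thesis by (simp add: jointly_continuous_def case_prod_unfold smooth_const)
qed

text \<open>Families that can be integrated over z inside the Schwartz space: n + 1 serves as an
  integrable rate in z, and all Schwartz bounds in x hold uniformly. Joint continuity of all
  derivatives yields measurability in z and, on compact sets, the uniform continuity needed for
  Riemann sums.\<close>

definition schwartz_family :: "(real^'n::finite \<Rightarrow> real^'n \<Rightarrow> complex) \<Rightarrow> bool" where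
  "schwartz_family H \<longleftrightarrow> jointly_continuous H \<and>
     (\<forall>m s. \<exists>C\<ge>0. \<forall>z. deriv_bound m (\<lambda>x. C * wt (- (real CARD('n) + 1)) z * wt (- s) x) (H z))"

lemma schwartz_familyE:
  assumes "schwartz_family H"
  obtains C where "0 \<le> C" "\<And>z. deriv_bound m (\<lambda>x. C * wt (- (real CARD('n) + 1)) z * wt (- s) x) (H (z::real^'n::finite))"
proof -
  have "\<exists>C\<ge>0. \<forall>z. deriv_bound m (\<lambda>x. C * wt (- (real CARD('n) + 1)) z * wt (- s) x) (H z)"
    using assms by (simp add: schwartz_family_def)
  then show ?thesis using that by blast
qed

lemma schwartz_family_schwartz:
  assumes "schwartz_family H" shows "H z \<in> schwartz"
  unfolding schwartz_iff
proof (intro allI)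
  fix m s
  obtain C where "0 \<le> C" "\<And>z. deriv_bound m (\<lambda>x. C * wt (- (real CARD('a) + 1)) z * wt (- s) x) (H z)"
    using schwartz_familyE[OF assms, of m s] by blast
  then show "\<exists>C\<ge>0. deriv_bound m (\<lambda>x. C * wt (- s) x) (H z)"
    by (intro exI[of _ "C * wt (- (real CARD('a) + 1)) z"]) simp
qed

lemma schwartz_family_dom:
  assumes H: "schwartz_family H" shows "dom_family (H :: real^'n::finite \<Rightarrow> _)"
proof -
  have "\<exists>b. integrable lborel b \<and> (\<forall>z. deriv_bound m (\<lambda>_. b z) (H z))" for m
  proof -
    obtain C where C: "0 \<le> C" "\<And>z. deriv_bound m (\<lambda>x. C * wt (- (real CARD('n) + 1)) z * wt (- 0) x) (H z)"
      using schwartz_familyE[OF H, of m 0] by blast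
    have "integrable lborel (\<lambda>z::real^'n. C * wt (- (real CARD('n) + 1)) z)"
      by (rule integrable_mult_right) (rule integrable_wt, simp)
    moreover have "deriv_bound m (\<lambda>_. C * wt (- (real CARD('n) + 1)) z) (H z)" for z using C(2)[of z] by simp
    ultimately show ?thesis by blast
  qed
  moreover have "(\<lambda>z. iter_deriv \<alpha> (H z) x) \<in> borel_measurable borel" for \<alpha> x
    using H by (intro jointly_continuous_measurable) (simp add: schwartz_family_def)
  ultimately show ?thesis by (simp add: dom_family_def)
qed

lemma schwartz_family_integral:
  assumes H: "schwartz_family H" shows "(\<lambda>x. \<integral>z. H z x \<partial>lborel) \<in> schwartz"
  unfolding schwartz_iff
proof (intro allI)
  fix m s
  obtain C where C: "0 \<le> C" "\<And>z. deriv_bound m (\<lambda>x. C * wt (- (real CARD('a) + 1)) z * wt (- s) x) (H z)"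
    using schwartz_familyE[OF H, of m s] by blast
  note dom = schwartz_family_dom[OF H]
  let ?J = "\<integral>z. wt (- (real CARD('a) + 1)) (z::real^'a) \<partial>lborel"
  have "deriv_bound m (\<lambda>x. C * ?J * wt (- s) x) (\<lambda>x. \<integral>z. H z x \<partial>lborel)"
    unfolding deriv_bound_def
  proof (intro allI impI conjI)
    fix \<alpha> x assume \<alpha>: "length (\<alpha>::'a list) \<le> m"
    show "iter_deriv \<alpha> (\<lambda>x. \<integral>z. H z x \<partial>lborel) differentiable at x"
      using iter_deriv_dom_family(1)[OF dom] by (rule smooth_differentiable)
    have "norm (\<integral>z. iter_deriv \<alpha> (H z) x \<partial>lborel) \<le> (\<integral>z. C * wt (- (real CARD('a) + 1)) (z::real^'a) * wt (- s) x \<partial>lborel)"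
      using deriv_boundD(2)[OF C(2) \<alpha>]
      by (intro integral_norm_le dom_family_integrable[OF dom] integrable_mult_left integrable_mult_right integrable_wt) auto
    then show "cmod (iter_deriv \<alpha> (\<lambda>x. \<integral>z. H z x \<partial>lborel) x) \<le> C * ?J * wt (- s) x"
      by (simp add: iter_deriv_dom_family(2)[OF dom])
  qed
  then show "\<exists>C\<ge>0. deriv_bound m (\<lambda>x. C * wt (- s) x) (\<lambda>x. \<integral>z. H z x \<partial>lborel)"
    using C(1) by (intro exI[of _ "C * ?J"]) simp
qed

section \<open>Tempered distributions under the integral sign\<close>

lemma finite_disjoint_refinement:
  assumes "finite P" "\<And>p. p \<in> P \<Longrightarrow> B p \<in> sets M"
  shows "\<exists>A. (\<forall>p\<in>P. A p \<in> sets M \<and> A p \<subseteq> B p) \<and> disjoint_family_on A P \<and> (\<Union>p\<in>P. A p) = (\<Union>p\<in>P. B p)"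
  using assms
proof (induction rule: finite_induct)
  case empty
  then show ?case by (simp add: disjoint_family_on_def)
next
  case (insert q P)
  then obtain A where A: "\<forall>p\<in>P. A p \<in> sets M \<and> A p \<subseteq> B p" "disjoint_family_on A P" "(\<Union>p\<in>P. A p) = (\<Union>p\<in>P. B p)"
    by auto
  let ?A = "A(q := B q - (\<Union>p\<in>P. B p))"
  have eq: "?A p = A p" if "p \<in> P" for p using that insert.hyps by auto
  have "(\<Union>p\<in>P. ?A p) = (\<Union>p\<in>P. B p)" using eq A(3) by simp
  then have "(\<Union>p\<in>insert q P. ?A p) = (\<Union>p\<in>insert q P. B p)" by auto
  moreover have "disjoint_family_on ?A (insert q P)"
  proof -
    have 1: "disjoint_family_on ?A P"
      using A(2) eq by (simp add: disjoint_family_on_def)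
    have "A p \<inter> (B q - (\<Union>p\<in>P. B p)) = {}" if "p \<in> P" for p using A(1) that by blast
    then have "?A q \<inter> (\<Union>p\<in>P. ?A p) = {}" using eq by auto
    then show ?thesis using 1 insert.hyps by (simp add: disjoint_family_on_insert)
  qed
  moreover have "B q - (\<Union>p\<in>P. B p) \<in> sets M"
    using insert.hyps(1) insert.prems by (intro sets.Diff sets.finite_UN) auto
  ultimately show ?case using A(1) eq by (intro exI[of _ ?A]) (auto simp del: fun_upd_apply, auto)
qed

text \<open>Error of a Riemann sum: oscillation times volume inside the ball, the tail of the
  majorant outside. The sample point p need not lie in its cell A p; only closeness of the values
  matters. The same estimate later serves for the scalars u(H z) and for the derivatives of H z at a
  fixed point.\<close>

lemma step_approximation:
  fixes f :: "'a::euclidean_space \<Rightarrow> complex" and b :: "'a \<Rightarrow> real"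
  assumes fin: "finite P" and A: "\<And>p. p \<in> P \<Longrightarrow> A p \<in> sets borel" and disj: "disjoint_family_on A P"
    and U: "(\<Union>p\<in>P. A p) = cball 0 L"
    and f: "integrable lborel f" and b: "integrable lborel b" and fb: "\<And>z. cmod (f z) \<le> b z"
    and e: "\<And>p z. p \<in> P \<Longrightarrow> z \<in> A p \<Longrightarrow> cmod (f z - f p) \<le> e"
  shows "cmod ((\<integral>z. f z \<partial>lborel) - (\<Sum>p\<in>P. measure lborel (A p) *\<^sub>R f p)) \<le>
     e * measure lborel (cball (0::'a) L) + (\<integral>z. indicator (- cball 0 L) z * b z \<partial>lborel)"
proof -
  have fA: "emeasure lborel (A p) < \<infinity>" if "p \<in> P" for p
  proof -
    have "A p \<subseteq> cball 0 L" using U that by blast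
    then have "bounded (A p)" by (rule bounded_subset[OF bounded_cball])
    then show ?thesis by (rule emeasure_bounded_finite)
  qed
  let ?s = "\<lambda>z. \<Sum>p\<in>P. indicator (A p) z *\<^sub>R f p"
  have si: "integrable lborel ?s"
    using fA A by (intro Bochner_Integration.integrable_sum integrable_scaleR_left integrable_real_indicator) auto
  have "(\<integral>z. ?s z \<partial>lborel) = (\<Sum>p\<in>P. measure lborel (A p) *\<^sub>R f p)"
    using fA A by (subst Bochner_Integration.integral_sum) (auto intro!: integrable_scaleR_left integrable_real_indicator)
  then have "(\<integral>z. f z \<partial>lborel) - (\<Sum>p\<in>P. measure lborel (A p) *\<^sub>R f p) = (\<integral>z. f z - ?s z \<partial>lborel)"
    using f si by simp
  also have "cmod \<dots> \<le> (\<integral>z. e * indicator (cball 0 L) z + indicator (- cball 0 L) z * b z \<partial>lborel)"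
  proof (rule integral_norm_le)
    show "integrable lborel (\<lambda>z. f z - ?s z)" using f si by simp
    have "integrable lborel (\<lambda>z. indicator (- cball 0 L) z *\<^sub>R b z)"
      by (rule integrable_mult_indicator[OF _ b]) simp
    moreover have "integrable lborel (indicator (cball (0::'a) L) :: 'a \<Rightarrow> real)"
      by (intro integrable_real_indicator emeasure_bounded_finite) auto
    ultimately show "integrable lborel (\<lambda>z. e * indicator (cball 0 L) z + indicator (- cball 0 L) z * b z)"
      by (intro Bochner_Integration.integrable_add integrable_mult_right) simp_all
    fix z
    show "norm (f z - ?s z) \<le> e * indicator (cball 0 L) z + indicator (- cball 0 L) z * b z"
    proof (cases "z \<in> cball 0 L")
      case True
      then obtain p where p: "p \<in> P" "z \<in> A p" using U by blast
      have "indicator (A q) z = (0::real)" if "q \<in> P" "q \<noteq> p" for q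
        using disj p that by (auto simp: disjoint_family_on_def indicator_def)
      then have "?s z = (\<Sum>q\<in>P. if q = p then f p else 0)"
        using p by (intro sum.cong) auto
      then have "?s z = f p" using fin p by simp
      then show ?thesis using e[OF p] True by simp
    next
      case False
      then have "indicator (A q) z = (0::real)" if "q \<in> P" for q using U that by (auto simp: indicator_def)
      then have "?s z = 0" by simp
      then show ?thesis using False fb by simp
    qed
  qed
  also have "\<dots> = e * measure lborel (cball (0::'a) L) + (\<integral>z. indicator (- cball 0 L) z * b z \<partial>lborel)"
  proof (subst Bochner_Integration.integral_add)
    have "integrable lborel (indicator (cball (0::'a) L) :: 'a \<Rightarrow> real)"
      by (intro integrable_real_indicator emeasure_bounded_finite) auto
    then show "integrable lborel (\<lambda>z::'a. e * indicator (cball 0 L) z)" by (rule integrable_mult_right)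
    have "integrable lborel (\<lambda>z. indicator (- cball 0 L) z *\<^sub>R b z)"
      by (rule integrable_mult_indicator[OF _ b]) simp
    then show "integrable lborel (\<lambda>z. indicator (- cball 0 L) z * b z)" by simp
  qed simp
  finally show ?thesis .
qed

lemma tempered_bound:
  fixes u :: "(real^'n::finite \<Rightarrow> complex) \<Rightarrow> complex"
  assumes "tempered u"
  shows "\<exists>k m C. 0 \<le> C \<and>
    (\<forall>\<phi>\<in>schwartz. \<forall>c\<ge>0. deriv_bound m (\<lambda>x. c * wt (- real k) x) \<phi> \<longrightarrow> cmod (u \<phi>) \<le> C * c)"
proof -
  obtain k m C where u: "\<And>\<phi>. \<phi> \<in> schwartz \<Longrightarrow> ennreal (cmod (u \<phi>)) \<le> ennreal C * schwartz_seminorm k m \<phi>"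
    using assms unfolding tempered_def by blast
  \<comment> \<open>A negative C becomes 0 under \<open>ennreal\<close>, so \<open>max 0 C\<close>
    is an equally valid constant.\<close>
  show ?thesis
  proof (rule exI[of _ k], rule exI[of _ m], rule exI[of _ "max 0 C"], intro conjI ballI allI impI)
    fix \<phi> :: "real^'n \<Rightarrow> complex" and c assume \<phi>: "\<phi> \<in> schwartz" "0 \<le> c" "deriv_bound m (\<lambda>x. c * wt (- real k) x) \<phi>"
    have "ennreal (cmod (u \<phi>)) \<le> ennreal (max 0 C) * ennreal c"
      using u[OF \<phi>(1)] schwartz_seminorm_le[OF \<phi>(3,2)]
      by (meson mult_mono order_trans ennreal_leI max.cobounded2 zero_le)
    then show "cmod (u \<phi>) \<le> max 0 C * c" using \<phi>(2) by (simp add: ennreal_mult[symmetric])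
  qed simp
qed

lemma tempered_add: "tempered u \<Longrightarrow> f \<in> schwartz \<Longrightarrow> g \<in> schwartz \<Longrightarrow> u (\<lambda>x. f x + g x) = u f + u g"
  and tempered_cmult: "tempered u \<Longrightarrow> f \<in> schwartz \<Longrightarrow> u (\<lambda>x. c * f x) = c * u f"
  by (simp_all add: tempered_def)

lemma schwartz_diff: "f \<in> schwartz \<Longrightarrow> g \<in> schwartz \<Longrightarrow> (\<lambda>x. f x - g x) \<in> schwartz"
  using schwartz_add[of f "\<lambda>x. (-1) * g x"] schwartz_cmult[of g "-1"] by simp

lemma tempered_diff: "tempered u \<Longrightarrow> f \<in> schwartz \<Longrightarrow> g \<in> schwartz \<Longrightarrow> u (\<lambda>x. f x - g x) = u f - u g"
  using tempered_add[of u f "\<lambda>x. (-1) * g x"] tempered_cmult[of u g "-1"] schwartz_cmult[of g "-1"] by simp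

lemma iter_deriv_diff:
  "smooth f \<Longrightarrow> smooth g \<Longrightarrow> iter_deriv \<alpha> (\<lambda>x. f x - g x) = (\<lambda>x. iter_deriv \<alpha> f x - iter_deriv \<alpha> g x)"
  using iter_deriv_add[of f "\<lambda>x. (-1) * g x" \<alpha>] iter_deriv_cmult[of g \<alpha> "-1"] smooth_mult[OF smooth_const[of "-1"], of g]
  by simp

lemma sum_schwartz_family:
  assumes fin: "finite P" and H: "\<And>p. p \<in> P \<Longrightarrow> H p \<in> schwartz"
  shows "(\<lambda>x. \<Sum>p\<in>P. c p *\<^sub>R H p x) \<in> schwartz"
    and "tempered u \<Longrightarrow> u (\<lambda>x. \<Sum>p\<in>P. c p *\<^sub>R H p x) = (\<Sum>p\<in>P. c p *\<^sub>R u (H p))"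
    and "iter_deriv \<alpha> (\<lambda>x. \<Sum>p\<in>P. c p *\<^sub>R H p x) = (\<lambda>x. \<Sum>p\<in>P. c p *\<^sub>R iter_deriv \<alpha> (H p) x)"
proof -
  have "(\<lambda>x. \<Sum>p\<in>P. c p *\<^sub>R H p x) \<in> schwartz \<and>
    (tempered u \<longrightarrow> u (\<lambda>x. \<Sum>p\<in>P. c p *\<^sub>R H p x) = (\<Sum>p\<in>P. c p *\<^sub>R u (H p))) \<and>
    iter_deriv \<alpha> (\<lambda>x. \<Sum>p\<in>P. c p *\<^sub>R H p x) = (\<lambda>x. \<Sum>p\<in>P. c p *\<^sub>R iter_deriv \<alpha> (H p) x)"
    using fin H
  proof (induction rule: finite_induct)
    case empty
    have "u (\<lambda>x. 0) = 0" if "tempered u" using tempered_cmult[OF that schwartz_zero, of 0] by simp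
    moreover have "iter_deriv \<alpha> (\<lambda>x::real^'b. 0 :: complex) = (\<lambda>x. 0)"
      by (induction \<alpha>) (simp_all add: iter_deriv_Cons partial_deriv_const)
    ultimately show ?case by (simp add: schwartz_zero)
  next
    case (insert p P)
    have p: "H p \<in> schwartz" "(\<lambda>x. of_real (c p) * H p x) \<in> schwartz" using insert.prems by (auto intro: schwartz_cmult)
    from insert have IH: "(\<lambda>x. \<Sum>p\<in>P. c p *\<^sub>R H p x) \<in> schwartz"
      "tempered u \<Longrightarrow> u (\<lambda>x. \<Sum>p\<in>P. c p *\<^sub>R H p x) = (\<Sum>p\<in>P. c p *\<^sub>R u (H p))"
      "iter_deriv \<alpha> (\<lambda>x. \<Sum>p\<in>P. c p *\<^sub>R H p x) = (\<lambda>x. \<Sum>p\<in>P. c p *\<^sub>R iter_deriv \<alpha> (H p) x)"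
      by auto
    show ?case
      using insert.hyps schwartz_add[OF p(2) IH(1)] tempered_add[OF _ p(2) IH(1), of u] IH tempered_cmult[OF _ p(1), of u "of_real (c p)"]
        iter_deriv_add[OF schwartz_smooth[OF p(2)] schwartz_smooth[OF IH(1)], of \<alpha>]
        iter_deriv_cmult[OF schwartz_smooth[OF p(1)], of \<alpha> "of_real (c p)"]
      by (simp add: scaleR_conv_of_real)
  qed
  then show "(\<lambda>x. \<Sum>p\<in>P. c p *\<^sub>R H p x) \<in> schwartz"
    "tempered u \<Longrightarrow> u (\<lambda>x. \<Sum>p\<in>P. c p *\<^sub>R H p x) = (\<Sum>p\<in>P. c p *\<^sub>R u (H p))"
    "iter_deriv \<alpha> (\<lambda>x. \<Sum>p\<in>P. c p *\<^sub>R H p x) = (\<lambda>x. \<Sum>p\<in>P. c p *\<^sub>R iter_deriv \<alpha> (H p) x)" by blast+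
qed

text \<open>Continuity of z \<mapsto> H z in a Schwartz seminorm. On a large compact set of x, joint
  continuity is uniform; beyond it, one power of decay more than the weight k demands makes each of
  the two terms at most \<epsilon>/2. The finitely many multi-indices allow a common d.\<close>

lemma schwartz_family_uniformly_continuous:
  fixes H :: "real^'n::finite \<Rightarrow> real^'n \<Rightarrow> complex"
  assumes H: "schwartz_family H" and \<epsilon>: "0 < \<epsilon>"
  obtains d where "0 < d"
    "\<And>z z'. \<lbrakk>z \<in> cball 0 L; z' \<in> cball 0 L; dist z z' < d\<rbrakk> \<Longrightarrow>
       deriv_bound m (\<lambda>x. \<epsilon> * wt (- real k) x) (\<lambda>x. H z x - H z' x)"
proof -
  obtain C where C: "0 \<le> C" "\<And>z. deriv_bound m (\<lambda>x. C * wt (- (real CARD('n) + 1)) z * wt (- (real k + 1)) x) (H z)"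
    using schwartz_familyE[OF H, of m "real k + 1"] by blast
  have sm: "smooth (H z)" for z using H by (simp add: schwartz_family_def jointly_continuous_def)
  have C': "wt (real k) x * cmod (iter_deriv \<alpha> (H z) x) \<le> C * wt (- 1) x" if "length \<alpha> \<le> m" for \<alpha> z x
  proof -
    have "cmod (iter_deriv \<alpha> (H z) x) \<le> C * wt (- (real CARD('n) + 1)) z * wt (- (real k + 1)) x"
      by (rule deriv_boundD(2)[OF C(2) that])
    also have "\<dots> \<le> C * 1 * wt (- (real k + 1)) x"
      using C(1) by (intro mult_right_mono mult_left_mono wt_le_1) auto
    also have "wt (- (real k + 1)) x = wt (- 1) x * inverse (wt (real k) x)"
    proof -
      have "- (real k + 1) = - 1 + - real k" by simp
      then show ?thesis by (simp only: wt_add wt_minus[of "real k"])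
    qed
    finally show ?thesis by (simp add: field_simps)
  qed
  \<comment> \<open>Beyond this radius the surplus decay gives C / (1 + |x|) \<le> \<epsilon> /
    2.\<close>
  define X where "X = 2 * C / \<epsilon>"
  have X: "C * wt (- 1) x \<le> \<epsilon> / 2" if "X \<le> norm x" for x :: "real^'n"
    using that \<epsilon> C(1) by (simp add: X_def wt_def powr_minus_divide field_simps add_pos_nonneg)
  have one: "\<exists>d>0. \<forall>z z' x. z \<in> cball 0 L \<longrightarrow> z' \<in> cball 0 L \<longrightarrow> dist z z' < d \<longrightarrow>
      wt (real k) x * cmod (iter_deriv \<alpha> (H z) x - iter_deriv \<alpha> (H z') x) \<le> \<epsilon>" if \<alpha>: "length \<alpha> \<le> m" for \<alpha>
  proof -
    let ?F = "\<lambda>p. wt (real k) (snd p) *\<^sub>R (\<lambda>(z, x). iter_deriv \<alpha> (H z) x) p"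
    have "continuous_on UNIV (\<lambda>(z, x). iter_deriv \<alpha> (H z) x)"
      using H by (simp add: schwartz_family_def jointly_continuous_def)
    then have "continuous_on (cball 0 L \<times> cball 0 X) (\<lambda>(z, x). iter_deriv \<alpha> (H z) x)"
      by (rule continuous_on_subset) auto
    then have "continuous_on (cball 0 L \<times> cball 0 X) ?F"
      by (intro continuous_on_scaleR continuous_on_wt continuous_on_snd continuous_on_id)
    moreover have "compact (cball (0::real^'n) L \<times> cball (0::real^'n) X)" by (intro compact_Times compact_cball)
    ultimately have "uniformly_continuous_on (cball 0 L \<times> cball 0 X) ?F" by (rule compact_uniformly_continuous)
    then obtain d where d: "0 < d" "\<And>p q. p \<in> cball 0 L \<times> cball 0 X \<Longrightarrow> q \<in> cball 0 L \<times> cball 0 X \<Longrightarrow> dist q p < d \<Longrightarrow> dist (?F q) (?F p) < \<epsilon>"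
      using \<epsilon> unfolding uniformly_continuous_on_def by meson
    have "wt (real k) x * cmod (iter_deriv \<alpha> (H z) x - iter_deriv \<alpha> (H z') x) \<le> \<epsilon>"
      if z: "z \<in> cball 0 L" "z' \<in> cball 0 L" "dist z z' < d" for z z' x
    proof (cases "norm x \<le> X")
      case True
      have "dist (z, x) (z', x) < d" using z by (simp add: dist_Pair_Pair)
      then have "dist (?F (z, x)) (?F (z', x)) < \<epsilon>" using z True by (intro d(2)) auto
      moreover have "dist (?F (z, x)) (?F (z', x)) = wt (real k) x * cmod (iter_deriv \<alpha> (H z) x - iter_deriv \<alpha> (H z') x)"
        by (simp add: dist_norm scaleR_diff_right[symmetric])
      ultimately show ?thesis by simp
    next
      case False
      have "wt (real k) x * cmod (iter_deriv \<alpha> (H z) x - iter_deriv \<alpha> (H z') x) \<le>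
          wt (real k) x * (cmod (iter_deriv \<alpha> (H z) x) + cmod (iter_deriv \<alpha> (H z') x))"
        by (intro mult_left_mono norm_triangle_ineq4) auto
      also have "\<dots> \<le> \<epsilon> / 2 + \<epsilon> / 2"
        using C'[OF \<alpha>, of x z] C'[OF \<alpha>, of x z'] X[of x] False by (simp add: distrib_left)
      finally show ?thesis by simp
    qed
    with d(1) show ?thesis by blast
  qed
  have "\<exists>d. \<forall>\<alpha>\<in>{\<alpha>. length \<alpha> \<le> m}. 0 < d \<alpha> \<and> (\<forall>z z' x. z \<in> cball 0 L \<longrightarrow> z' \<in> cball 0 L \<longrightarrow> dist z z' < d \<alpha> \<longrightarrow>
      wt (real k) x * cmod (iter_deriv \<alpha> (H z) x - iter_deriv \<alpha> (H z') x) \<le> \<epsilon>)"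
    by (rule bchoice) (use one in blast)
  then obtain d where d: "\<And>\<alpha>. length \<alpha> \<le> m \<Longrightarrow> 0 < d \<alpha>"
    "\<And>\<alpha> z z' x. length \<alpha> \<le> m \<Longrightarrow> z \<in> cball 0 L \<Longrightarrow> z' \<in> cball 0 L \<Longrightarrow> dist z z' < d \<alpha> \<Longrightarrow>
      wt (real k) x * cmod (iter_deriv \<alpha> (H z) x - iter_deriv \<alpha> (H z') x) \<le> \<epsilon>" by blast
  have fin: "finite {\<alpha>::'n list. length \<alpha> \<le> m}"
    using finite_lists_length_le[of "UNIV :: 'n set" m] by simp
  define d0 where "d0 = Min (d ` {\<alpha>. length \<alpha> \<le> m})"
  have ne: "d ` {\<alpha>. length \<alpha> \<le> m} \<noteq> {}" by (metis (mono_tags, lifting) empty_iff image_is_empty le0 list.size(3) mem_Collect_eq)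
  show ?thesis
  proof (rule that[of d0])
    show "0 < d0" unfolding d0_def using fin ne d(1) by (subst Min_gr_iff) auto
    fix z z' :: "real^'n" assume z: "z \<in> cball 0 L" "z' \<in> cball 0 L" "dist z z' < d0"
    show "deriv_bound m (\<lambda>x. \<epsilon> * wt (- real k) x) (\<lambda>x. H z x - H z' x)"
      unfolding deriv_bound_def iter_deriv_diff[OF sm sm]
    proof (intro allI impI conjI)
      fix \<alpha> :: "'n list" and x assume \<alpha>: "length \<alpha> \<le> m"
      show "(\<lambda>x. iter_deriv \<alpha> (H z) x - iter_deriv \<alpha> (H z') x) differentiable at x"
        by (intro differentiable_diff smooth_differentiable sm)
      have "d0 \<le> d \<alpha>" unfolding d0_def using fin \<alpha> by (intro Min_le) auto
      then have "wt (real k) x * cmod (iter_deriv \<alpha> (H z) x - iter_deriv \<alpha> (H z') x) \<le> \<epsilon>"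
        using z by (intro d(2)[OF \<alpha>]) auto
      then show "cmod (iter_deriv \<alpha> (H z) x - iter_deriv \<alpha> (H z') x) \<le> \<epsilon> * wt (- real k) x"
        by (simp add: wt_minus field_simps)
    qed
  qed
qed

text \<open>By linearity u commutes exactly with finite sums. One partition is chosen for which the
  Riemann sums approximate both the integral of u(H z) and, in the seminorm that controls u, the
  function obtained by integrating H. Both errors are multiples of an arbitrary \<eta>.\<close>

lemma tempered_integral_family:
  fixes H :: "real^'n::finite \<Rightarrow> real^'n \<Rightarrow> complex"
  assumes u: "tempered u" and H: "schwartz_family H"
  shows "continuous_on UNIV (\<lambda>z. u (H z))" and "integrable lborel (\<lambda>z. u (H z))"
    and "u (\<lambda>x. \<integral>z. H z x \<partial>lborel) = (\<integral>z. u (H z) \<partial>lborel)"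
proof -
  from tempered_bound[OF u] obtain k m C0 where C0': "0 \<le> C0 \<and>
    (\<forall>\<phi>\<in>schwartz. \<forall>c\<ge>0. deriv_bound m (\<lambda>x. c * wt (- real k) x) \<phi> \<longrightarrow> cmod (u \<phi>) \<le> C0 * c)"
    by (elim exE)
  have C0: "0 \<le> C0"
    "\<And>\<phi> c. \<lbrakk>\<phi> \<in> schwartz; 0 \<le> c; deriv_bound m (\<lambda>x. c * wt (- real k) x) \<phi>\<rbrakk> \<Longrightarrow> cmod (u \<phi>) \<le> C0 * c"
    using C0' by simp_all
  obtain C where C: "0 \<le> C" "\<And>z. deriv_bound m (\<lambda>x. C * wt (- (real CARD('n) + 1)) z * wt (- real k) x) (H z)"
    using schwartz_familyE[OF H, of m "real k"] by blast
  note HS = schwartz_family_schwartz[OF H] and dom = schwartz_family_dom[OF H]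
  let ?W = "wt (- (real CARD('n) + 1)) :: real^'n \<Rightarrow> real"
  have W: "integrable lborel ?W" by (rule integrable_wt) simp
  have diff: "cmod (u (H z) - u (H z')) \<le> C0 * \<epsilon>"
    if "0 < \<epsilon>" "deriv_bound m (\<lambda>x. \<epsilon> * wt (- real k) x) (\<lambda>x. H z x - H z' x)" for z z' \<epsilon>
    using C0(2)[OF schwartz_diff[OF HS HS] _ that(2)] that(1) by (simp add: tempered_diff[OF u HS HS])
  show cont: "continuous_on UNIV (\<lambda>z. u (H z))"
  proof (intro continuous_at_imp_continuous_on ballI, unfold continuous_at_eps_delta, intro allI impI)
    fix z0 :: "real^'n" and e :: real assume e: "0 < e"
    define \<epsilon> where "\<epsilon> = e / (C0 + 1)"
    have \<epsilon>: "0 < \<epsilon>" "C0 * \<epsilon> < e" using e C0(1) by (auto simp: \<epsilon>_def field_simps)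
    obtain d where d: "0 < d" "\<And>z z'. \<lbrakk>z \<in> cball 0 (norm z0 + 1); z' \<in> cball 0 (norm z0 + 1); dist z z' < d\<rbrakk> \<Longrightarrow>
       deriv_bound m (\<lambda>x. \<epsilon> * wt (- real k) x) (\<lambda>x. H z x - H z' x)"
      using schwartz_family_uniformly_continuous[OF H \<epsilon>(1)] by blast
    have "dist (u (H z)) (u (H z0)) < e" if "dist z z0 < min d 1" for z
    proof -
      have "norm z \<le> norm z0 + 1" using that norm_triangle_ineq2[of z z0] by (simp add: dist_norm)
      then have "cmod (u (H z) - u (H z0)) \<le> C0 * \<epsilon>" using that by (intro diff \<epsilon> d(2)) auto
      then show ?thesis using \<epsilon>(2) by (simp add: dist_norm)
    qed
    then show "\<exists>d>0. \<forall>x'. dist x' z0 < d \<longrightarrow> dist (u (H x')) (u (H z0)) < e"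
      using d(1) by (intro exI[of _ "min d 1"]) simp
  qed
  have ub: "cmod (u (H z)) \<le> C0 * C * ?W z" for z
    using C0(2)[OF HS _ C(2), of z] C(1) by (simp add: mult.assoc)
  have WC: "integrable lborel (\<lambda>z. C0 * C * ?W z)" using W by simp
  show int: "integrable lborel (\<lambda>z. u (H z))"
  proof (rule Bochner_Integration.integrable_bound[OF WC])
    show "(\<lambda>z. u (H z)) \<in> borel_measurable lborel" using borel_measurable_continuous_onI[OF cont] by simp
    show "AE z in lborel. norm (u (H z)) \<le> norm (C0 * C * ?W z)" using ub by (auto intro!: AE_I2 order_trans[OF ub])
  qed
  let ?I = "\<lambda>x. \<integral>z. H z x \<partial>lborel"
  have IS: "?I \<in> schwartz" by (rule schwartz_family_integral[OF H])
  have main: "cmod (u ?I - (\<integral>z. u (H z) \<partial>lborel)) \<le> 2 * C0 * (1 + C) * \<eta>" if \<eta>: "0 < \<eta>" for \<eta>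
  proof -
    have "(\<lambda>j::nat. \<integral>z. indicator (- cball 0 (real j)) z * ?W z \<partial>lborel) \<longlonglongrightarrow> (\<integral>(z::real^'n). 0 \<partial>lborel)"
    proof (rule integral_dominated_convergence[where w = ?W])
      show "AE z in lborel. (\<lambda>j. indicator (- cball 0 (real j)) z * ?W z) \<longlonglongrightarrow> 0"
      proof (rule AE_I2, rule tendsto_eventually)
        fix z :: "real^'n"
        obtain i where i: "norm z \<le> real i" using real_arch_simple by blast
        show "\<forall>\<^sub>F j in sequentially. indicator (- cball 0 (real j)) z * ?W z = 0"
          using eventually_ge_at_top[of i] by eventually_elim (use i in auto)
      qed
    qed (use W in \<open>auto simp: indicator_def\<close>)
    then have "(\<lambda>j::nat. \<integral>z. indicator (- cball 0 (real j)) z * ?W z \<partial>lborel) \<longlonglongrightarrow> 0" by simp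
    then have "\<forall>\<^sub>F j in sequentially. (\<integral>z. indicator (- cball 0 (real j)) z * ?W z \<partial>lborel) < \<eta>"
      using \<eta> by (rule order_tendstoD)
    then obtain j :: nat where j: "(\<integral>z. indicator (- cball 0 (real j)) z * ?W z \<partial>lborel) < \<eta>"
      by (auto simp: eventually_sequentially)
    let ?L = "real j" let ?vol = "measure lborel (cball (0::real^'n) ?L)"
    \<comment> \<open>The permitted oscillation is divided by the volume of the ball; adding 1 keeps
      the divisor positive even for radius 0.\<close>
    define \<epsilon> where "\<epsilon> = \<eta> / (?vol + 1)"
    have \<epsilon>: "0 < \<epsilon>" "\<epsilon> * ?vol \<le> \<eta>" using \<eta> by (auto simp: \<epsilon>_def field_simps add_pos_nonneg)
    obtain d where d: "0 < d" "\<And>z z'. \<lbrakk>z \<in> cball 0 ?L; z' \<in> cball 0 ?L; dist z z' < d\<rbrakk> \<Longrightarrow>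
       deriv_bound m (\<lambda>x. \<epsilon> * wt (- real k) x) (\<lambda>x. H z x - H z' x)"
      using schwartz_family_uniformly_continuous[OF H \<epsilon>(1)] by blast
    have cover: "cball (0::real^'n) ?L \<subseteq> (\<Union>p\<in>cball 0 ?L. ball p d)" using d(1) by force
    obtain P where P: "finite P" "P \<subseteq> cball (0::real^'n) ?L" "cball 0 ?L \<subseteq> (\<Union>p\<in>P. ball p d)"
      using compactE_image[OF compact_cball open_ball cover] by metis
    obtain A where A: "\<And>p. p \<in> P \<Longrightarrow> A p \<in> sets borel" "\<And>p. p \<in> P \<Longrightarrow> A p \<subseteq> ball p d \<inter> cball 0 ?L"
      "disjoint_family_on A P" "(\<Union>p\<in>P. A p) = (\<Union>p\<in>P. ball p d \<inter> cball 0 ?L)"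
      using finite_disjoint_refinement[OF P(1), of "\<lambda>p. ball p d \<inter> cball 0 ?L" borel] by auto
    have U: "(\<Union>p\<in>P. A p) = cball 0 ?L" unfolding A(4) using P(3) by blast
    have close: "deriv_bound m (\<lambda>x. \<epsilon> * wt (- real k) x) (\<lambda>x. H z x - H p x)" if "p \<in> P" "z \<in> A p" for p z
      using A(2)[OF that(1)] that P(2) by (intro d(2)) (auto simp: dist_commute)
    let ?S = "\<lambda>x. \<Sum>p\<in>P. measure lborel (A p) *\<^sub>R H p x"
    have SS: "?S \<in> schwartz" by (rule sum_schwartz_family(1)[OF P(1) HS])
    have tail: "(\<integral>z. indicator (- cball 0 ?L) z * (c * ?W z) \<partial>lborel) \<le> c * \<eta>" if "0 \<le> c" for c
    proof -
      have "(\<integral>z. indicator (- cball 0 ?L) z * (c * ?W z) \<partial>lborel) = c * (\<integral>z. indicator (- cball 0 ?L) z * ?W z \<partial>lborel)"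
        by (subst integral_mult_right_zero[symmetric]) (simp add: mult_ac)
      then show ?thesis using j that by (simp add: mult_left_mono)
    qed
    have "cmod ((\<integral>z. u (H z) \<partial>lborel) - (\<Sum>p\<in>P. measure lborel (A p) *\<^sub>R u (H p))) \<le>
        (C0 * \<epsilon>) * ?vol + (\<integral>z. indicator (- cball 0 ?L) z * (C0 * C * ?W z) \<partial>lborel)"
      by (rule step_approximation[OF P(1) A(1,3) U int WC ub]) (use diff close \<epsilon> C0 in auto)
    also have "\<dots> \<le> C0 * \<eta> + C0 * C * \<eta>"
      using tail[of "C0 * C"] \<epsilon>(2) C0(1) C(1) by (intro add_mono) (auto simp: mult.assoc intro!: mult_left_mono)
    finally have 1: "cmod ((\<integral>z. u (H z) \<partial>lborel) - u ?S) \<le> C0 * \<eta> + C0 * C * \<eta>"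
      by (simp only: sum_schwartz_family(2)[OF P(1) HS u])
    \<comment> \<open>Convergence of the Riemann sums as test functions: the scalar estimate is
      applied to every derivative at every x, with the weight of x carried as a factor of the
      constants.\<close>
    have "deriv_bound m (\<lambda>x. ((1 + C) * \<eta>) * wt (- real k) x) (\<lambda>x. ?I x - ?S x)"
      unfolding deriv_bound_def iter_deriv_diff[OF schwartz_smooth[OF IS] schwartz_smooth[OF SS]]
    proof (intro allI impI conjI)
      fix \<alpha> :: "'n list" and x assume \<alpha>: "length \<alpha> \<le> m"
      show "(\<lambda>x. iter_deriv \<alpha> ?I x - iter_deriv \<alpha> ?S x) differentiable at x"
        by (intro differentiable_diff smooth_differentiable schwartz_smooth IS SS)
      have b: "integrable lborel (\<lambda>z. (C * wt (- real k) x) * ?W z)" using W by simp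
      have "cmod ((\<integral>z. iter_deriv \<alpha> (H z) x \<partial>lborel) - (\<Sum>p\<in>P. measure lborel (A p) *\<^sub>R iter_deriv \<alpha> (H p) x)) \<le>
          (\<epsilon> * wt (- real k) x) * ?vol + (\<integral>z. indicator (- cball 0 ?L) z * ((C * wt (- real k) x) * ?W z) \<partial>lborel)"
      proof (rule step_approximation[OF P(1) A(1,3) U dom_family_integrable[OF dom] b])
        show "cmod (iter_deriv \<alpha> (H z) x) \<le> C * wt (- real k) x * ?W z" for z
          using deriv_boundD(2)[OF C(2) \<alpha>, of z x] by (simp add: mult_ac)
        show "cmod (iter_deriv \<alpha> (H z) x - iter_deriv \<alpha> (H p) x) \<le> \<epsilon> * wt (- real k) x" if "p \<in> P" "z \<in> A p" for p z
          using deriv_boundD(2)[OF close[OF that] \<alpha>, of x]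
          by (simp add: iter_deriv_diff[OF schwartz_smooth[OF HS] schwartz_smooth[OF HS]])
      qed
      also have "\<dots> \<le> \<eta> * wt (- real k) x + C * wt (- real k) x * \<eta>"
      proof (rule add_mono)
        have "\<epsilon> * wt (- real k) x * ?vol = (\<epsilon> * ?vol) * wt (- real k) x" by simp
        also have "\<dots> \<le> \<eta> * wt (- real k) x" using \<epsilon>(2) by (intro mult_right_mono) auto
        finally show "\<epsilon> * wt (- real k) x * ?vol \<le> \<eta> * wt (- real k) x" .
      qed (use tail C in auto)
      also have "\<dots> = ((1 + C) * \<eta>) * wt (- real k) x" by (simp add: algebra_simps)
      finally show "cmod (iter_deriv \<alpha> ?I x - iter_deriv \<alpha> ?S x) \<le> ((1 + C) * \<eta>) * wt (- real k) x"
        by (simp only: iter_deriv_dom_family(2)[OF dom] sum_schwartz_family(3)[OF P(1) HS])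
    qed
    from C0(2)[OF schwartz_diff[OF IS SS] _ this] have 2: "cmod (u ?I - u ?S) \<le> C0 * ((1 + C) * \<eta>)"
      using C(1) \<eta> by (simp add: tempered_diff[OF u IS SS])
    have "cmod (u ?I - (\<integral>z. u (H z) \<partial>lborel)) \<le> cmod (u ?I - u ?S) + cmod ((\<integral>z. u (H z) \<partial>lborel) - u ?S)"
      using norm_triangle_ineq4[of "u ?I - u ?S" "(\<integral>z. u (H z) \<partial>lborel) - u ?S"] by simp
    also have "\<dots> \<le> 2 * C0 * (1 + C) * \<eta>" using 1 2 by (simp add: algebra_simps)
    finally show ?thesis .
  qed
  have "cmod (u ?I - (\<integral>z. u (H z) \<partial>lborel)) \<le> 0"
  proof (rule field_le_epsilon)
    fix e :: real assume e: "0 < e"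
    have K: "0 < 2 * C0 * (1 + C) + 1" using C0(1) C(1) by (simp add: add_nonneg_pos)
    have "2 * C0 * (1 + C) * (e / (2 * C0 * (1 + C) + 1)) \<le> e"
      using K e by (simp add: field_simps)
    with main[of "e / (2 * C0 * (1 + C) + 1)"] show "cmod (u ?I - (\<integral>z. u (H z) \<partial>lborel)) \<le> 0 + e"
      using K e by simp
  qed
  then show "u ?I = (\<integral>z. u (H z) \<partial>lborel)" by simp
qed

section \<open>Bochner-Riesz kernels\<close>

text \<open>Energy estimate for v'' = -(1 - \<kappa>/r^2) v. The energy E satisfies E' = 2\<kappa>
  v^2 / r^3 \<le> 4\<kappa> E / r^3 once the potential is at least 1/2. As -4\<kappa>/r^3 is the
  derivative of 2\<kappa>/r^2, the product \<Phi> of E with the exponential is nonincreasing, and it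
  dominates v^2 up to a factor 2.\<close>

lemma bounded_of_oscillation_ode:
  fixes v v' :: "real \<Rightarrow> real"
  assumes \<kappa>: "0 \<le> \<kappa>"
    and v: "\<And>r. 0 < r \<Longrightarrow> (v has_real_derivative v' r) (at r)"
    and v': "\<And>r. 0 < r \<Longrightarrow> (v' has_real_derivative - (1 - \<kappa> / r\<^sup>2) * v r) (at r)"
  obtains C where "\<And>r. 1 \<le> r \<Longrightarrow> \<bar>v r\<bar> \<le> C"
proof -
  \<comment> \<open>From sqrt(2 \<kappa>) on, the potential 1 - \<kappa>/r^2 is at least 1/2; the
    maximum with 1 keeps r0 positive and leaves the compact interval from 1 to r0, where continuity
    suffices.\<close>
  define r0 where "r0 = max 1 (sqrt (2 * \<kappa>))"
  define E where "E r = (v' r)\<^sup>2 + (1 - \<kappa> / r\<^sup>2) * (v r)\<^sup>2" for r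
  define \<Phi> where "\<Phi> r = E r * exp (2 * \<kappa> / r\<^sup>2)" for r
  have half: "1 / 2 \<le> 1 - \<kappa> / r\<^sup>2" if "r0 \<le> r" for r
  proof -
    have "sqrt (2 * \<kappa>) \<le> r" "1 \<le> r" using that by (auto simp: r0_def)
    then have "2 * \<kappa> \<le> r\<^sup>2" "0 < r" using \<kappa> by (auto simp: sqrt_le_D)
    then show ?thesis by (simp add: field_simps)
  qed
  have E: "(v r)\<^sup>2 \<le> 2 * E r" if "r0 \<le> r" for r
  proof -
    have *: "x \<le> 2 * y" if "(1 / 2) * x \<le> y" for x y :: real using that by simp
    have "(1 / 2) * (v r)\<^sup>2 \<le> (1 - \<kappa> / r\<^sup>2) * (v r)\<^sup>2" by (intro mult_right_mono half that) auto
    then have "(v r)\<^sup>2 \<le> 2 * ((1 - \<kappa> / r\<^sup>2) * (v r)\<^sup>2)" by (rule *)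
    also have "\<dots> \<le> 2 * E r" unfolding E_def by simp
    finally show ?thesis .
  qed
  have r_pos: "0 < r" if "r0 \<le> r" for r using that by (auto simp: r0_def)
  have dE: "(E has_real_derivative 2 * \<kappa> / r ^ 3 * (v r)\<^sup>2) (at r)" if "0 < r" for r
    unfolding E_def
    by (rule derivative_eq_intros v v' that refl | (use that in force))+
       (use that in \<open>simp add: field_simps power2_eq_square power3_eq_cube\<close>)
  have d\<Phi>: "(\<Phi> has_real_derivative (2 * \<kappa> / r ^ 3 * (v r)\<^sup>2 - 4 * \<kappa> / r ^ 3 * E r) * exp (2 * \<kappa> / r\<^sup>2)) (at r)" if "0 < r" for r
    unfolding \<Phi>_def
    by (rule derivative_eq_intros dE that refl | (use that in force))+
       (use that in \<open>simp add: field_simps power2_eq_square power3_eq_cube\<close>)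
  have \<Phi>: "\<Phi> r \<le> \<Phi> r0" if r: "r0 \<le> r" for r
  proof (rule DERIV_nonpos_imp_nonincreasing[OF r])
    fix s assume s: "r0 \<le> s" "s \<le> r"
    have "2 * \<kappa> / s ^ 3 * (v s)\<^sup>2 \<le> 2 * \<kappa> / s ^ 3 * (2 * E s)"
      using r_pos[OF s(1)] \<kappa> by (intro mult_left_mono E s) auto
    then have "(2 * \<kappa> / s ^ 3 * (v s)\<^sup>2 - 4 * \<kappa> / s ^ 3 * E s) * exp (2 * \<kappa> / s\<^sup>2) \<le> 0"
      by (intro mult_nonpos_nonneg) auto
    then show "\<exists>y. (\<Phi> has_real_derivative y) (at s) \<and> y \<le> 0" using d\<Phi>[OF r_pos[OF s(1)]] by blast
  qed
  have large: "\<bar>v r\<bar> \<le> sqrt (2 * \<Phi> r0)" if r: "r0 \<le> r" for r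
  proof -
    have "0 \<le> E r" using E[OF r] zero_le_power2[of "v r"] by linarith
    then have "E r * 1 \<le> \<Phi> r" unfolding \<Phi>_def using \<kappa> by (intro mult_left_mono) auto
    then have "(v r)\<^sup>2 \<le> 2 * \<Phi> r0" using E[OF r] \<Phi>[OF r] by linarith
    then show ?thesis by (metis real_sqrt_abs real_sqrt_le_mono)
  qed
  have "continuous_on {1..r0} v"
    by (intro continuous_at_imp_continuous_on ballI DERIV_isCont[OF v]) auto
  then have "bounded (v ` {1..r0})" by (intro compact_imp_bounded compact_continuous_image) auto
  then obtain D where "\<forall>x\<in>v ` {1..r0}. norm x \<le> D" unfolding bounded_iff by blast
  then have D: "\<bar>v r\<bar> \<le> D" if "1 \<le> r" "r \<le> r0" for r using that by auto
  show ?thesis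
  proof
    fix r :: real assume "1 \<le> r"
    then show "\<bar>v r\<bar> \<le> max D (sqrt (2 * \<Phi> r0))"
      using large[of r] D[of r] by (cases "r \<le> r0") auto
  qed
qed

text \<open>Poisson's integral: up to a constant factor this is r^(-\<nu>) J_\<nu>(r) with \<nu> =
  \<mu> + 1/2.\<close>

definition osc_int :: "real \<Rightarrow> real \<Rightarrow> real" where
  "osc_int \<mu> r = integral {-1..1} (\<lambda>s. (1 - s\<^sup>2) powr \<mu> * cos (r * s))"

context
  fixes \<mu> :: real
  assumes \<mu>: "0 < \<mu>"
begin

lemma cont_powr_one_minus_sq: "continuous_on {-1..1} (\<lambda>s. (1 - s\<^sup>2) powr \<mu> :: real)"
  using \<mu> by (intro continuous_on_powr' continuous_intros) (auto simp: abs_square_le_1)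

lemma cont_powr_one_minus_sq': "continuous_on (cbox (-1) 1) (\<lambda>s. (1 - s\<^sup>2) powr \<mu> :: real)"
  using cont_powr_one_minus_sq by simp

lemma has_field_derivative_osc_int:
  "(osc_int \<mu> has_real_derivative - integral {-1..1} (\<lambda>s. s * (1 - s\<^sup>2) powr \<mu> * sin (r * s))) (at r)"
proof -
  have "((\<lambda>r. integral (cbox (-1) 1) (\<lambda>s. (1 - s\<^sup>2) powr \<mu> * cos (r * s))) has_real_derivative
      integral (cbox (-1) 1) (\<lambda>s. (1 - s\<^sup>2) powr \<mu> * (- (s * sin (r * s))))) (at r within UNIV)"
  proof (rule leibniz_rule_field_derivative)
    fix x t :: real
    show "((\<lambda>x. (1 - t\<^sup>2) powr \<mu> * cos (x * t)) has_real_derivative (1 - t\<^sup>2) powr \<mu> * - (t * sin (x * t))) (at x)"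
      by (auto intro!: derivative_eq_intros)
  next
    fix x :: real
    show "(\<lambda>s. (1 - s\<^sup>2) powr \<mu> * cos (x * s)) integrable_on cbox (-1) 1"
      by (rule integrable_continuous) (rule cont_powr_one_minus_sq' continuous_intros)+
  next
    have "continuous_on (UNIV \<times> cbox (-1) (1::real)) (\<lambda>z. (1 - (snd z)\<^sup>2) powr \<mu> :: real)"
      by (rule continuous_on_compose2[OF cont_powr_one_minus_sq]) (auto intro!: continuous_intros)
    note c2 = this
    show "continuous_on (UNIV \<times> cbox (-1) 1) (\<lambda>(x, s). (1 - s\<^sup>2) powr \<mu> * - (s * sin (x * s)))"
      unfolding case_prod_unfold by (rule c2 continuous_on_mult continuous_on_minus continuous_on_sin continuous_on_cos continuous_on_fst continuous_on_snd continuous_on_id)+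
  qed auto
  moreover have "(1 - s\<^sup>2) powr \<mu> * - (s * sin (r * s)) = - (s * (1 - s\<^sup>2) powr \<mu> * sin (r * s))" for s :: real
    by simp
  ultimately show ?thesis unfolding osc_int_def[abs_def] by (simp only: box_real integral_neg)
qed

text \<open>Integration by parts: (1 - s^2)^(\<mu>+1) sin(r s) vanishes at both endpoints, so the
  integral of its derivative is 0.\<close>

lemma integral_sin_eq_osc_int:
  "integral {-1..1} (\<lambda>s. s * (1 - s\<^sup>2) powr \<mu> * sin (r * s)) = r / (2 * (\<mu> + 1)) * osc_int (\<mu> + 1) r"
proof -
  have c1: "continuous_on {-1..1} (\<lambda>s. (1 - s\<^sup>2) powr (\<mu> + 1) :: real)"
    using \<mu> by (intro continuous_on_powr' continuous_intros) (auto simp: abs_square_le_1)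
  have "((\<lambda>s. r * ((1 - s\<^sup>2) powr (\<mu> + 1) * cos (r * s)) - 2 * (\<mu> + 1) * (s * (1 - s\<^sup>2) powr \<mu> * sin (r * s)))
      has_integral ((1 - 1\<^sup>2) powr (\<mu> + 1) * sin (r * 1) - (1 - (-1)\<^sup>2) powr (\<mu> + 1) * sin (r * (-1)))) {-1..1}"
  proof (rule fundamental_theorem_of_calculus_interior)
    fix s :: real assume s: "s \<in> {-1<..<1}"
    then have s1: "0 < 1 - s\<^sup>2" by (auto simp: abs_square_less_1)
    show "((\<lambda>s. (1 - s\<^sup>2) powr (\<mu> + 1) * sin (r * s)) has_vector_derivative
      r * ((1 - s\<^sup>2) powr (\<mu> + 1) * cos (r * s)) - 2 * (\<mu> + 1) * (s * (1 - s\<^sup>2) powr \<mu> * sin (r * s))) (at s)"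
      unfolding has_real_derivative_iff_has_vector_derivative[symmetric]
      using s1 by (auto intro!: derivative_eq_intros simp: algebra_simps)
  qed (auto intro!: continuous_intros c1)
  then have 0: "integral {-1..1} (\<lambda>s. r * ((1 - s\<^sup>2) powr (\<mu> + 1) * cos (r * s)) -
      2 * (\<mu> + 1) * (s * (1 - s\<^sup>2) powr \<mu> * sin (r * s))) = 0"
    using \<mu> by (simp add: integral_unique)
  have "integral {-1..1} (\<lambda>s. r * ((1 - s\<^sup>2) powr (\<mu> + 1) * cos (r * s)) -
      2 * (\<mu> + 1) * (s * (1 - s\<^sup>2) powr \<mu> * sin (r * s))) =
    r * osc_int (\<mu> + 1) r - 2 * (\<mu> + 1) * integral {-1..1} (\<lambda>s. s * (1 - s\<^sup>2) powr \<mu> * sin (r * s))"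
    unfolding osc_int_def
    by (subst integral_diff) (auto intro!: integrable_continuous_real continuous_intros c1 cont_powr_one_minus_sq)
  with 0 show ?thesis using \<mu> by (simp add: field_simps)
qed

lemma has_field_derivative_osc_int':
  "(osc_int \<mu> has_real_derivative - r / (2 * (\<mu> + 1)) * osc_int (\<mu> + 1) r) (at r)"
  using has_field_derivative_osc_int[of r] by (simp add: integral_sin_eq_osc_int)

text \<open>Differentiation in r brings down a second factor s, and s^2 = 1 - (1 - s^2) splits the
  integrand into the exponents \<mu> and \<mu> + 1.\<close>

lemma has_field_derivative_integral_sin:
  "((\<lambda>r. integral {-1..1} (\<lambda>s. s * (1 - s\<^sup>2) powr \<mu> * sin (r * s))) has_real_derivative
     osc_int \<mu> r - osc_int (\<mu> + 1) r) (at r)"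
proof -
  have "((\<lambda>r. integral (cbox (-1) 1) (\<lambda>s. s * (1 - s\<^sup>2) powr \<mu> * sin (r * s))) has_real_derivative
      integral (cbox (-1) 1) (\<lambda>s. s * (1 - s\<^sup>2) powr \<mu> * (s * cos (r * s)))) (at r within UNIV)"
  proof (rule leibniz_rule_field_derivative)
    fix x t :: real
    show "((\<lambda>x. t * (1 - t\<^sup>2) powr \<mu> * sin (x * t)) has_real_derivative t * (1 - t\<^sup>2) powr \<mu> * (t * cos (x * t))) (at x)"
      by (auto intro!: derivative_eq_intros)
  next
    fix x :: real
    show "(\<lambda>s. s * (1 - s\<^sup>2) powr \<mu> * sin (x * s)) integrable_on cbox (-1) 1"
      by (rule integrable_continuous) (rule cont_powr_one_minus_sq' continuous_intros)+
  next
    have "continuous_on (UNIV \<times> cbox (-1) (1::real)) (\<lambda>z. (1 - (snd z)\<^sup>2) powr \<mu> :: real)"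
      by (rule continuous_on_compose2[OF cont_powr_one_minus_sq]) (auto intro!: continuous_intros)
    note c2 = this
    show "continuous_on (UNIV \<times> cbox (-1) 1) (\<lambda>(x, s). s * (1 - s\<^sup>2) powr \<mu> * (s * cos (x * s)))"
      unfolding case_prod_unfold by (rule c2 continuous_on_mult continuous_on_minus continuous_on_sin continuous_on_cos continuous_on_fst continuous_on_snd continuous_on_id)+
  qed auto
  moreover have "integral {-1..1} (\<lambda>s. s * (1 - s\<^sup>2) powr \<mu> * (s * cos (r * s))) = osc_int \<mu> r - osc_int (\<mu> + 1) r"
  proof -
    have c1: "continuous_on {-1..1} (\<lambda>s. (1 - s\<^sup>2) powr (\<mu> + 1) :: real)"
      using \<mu> by (intro continuous_on_powr' continuous_intros) (auto simp: abs_square_le_1)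
    have "s * (1 - s\<^sup>2) powr \<mu> * (s * cos (r * s)) =
        (1 - s\<^sup>2) powr \<mu> * cos (r * s) - (1 - s\<^sup>2) powr (\<mu> + 1) * cos (r * s)" if "s \<in> {-1..1}" for s :: real
    proof -
      have "0 \<le> 1 - s\<^sup>2" using that by (auto simp: abs_square_le_1)
      then have "(1 - s\<^sup>2) powr (\<mu> + 1) = (1 - s\<^sup>2) * (1 - s\<^sup>2) powr \<mu>" by (simp only: powr_add powr_one mult.commute)
      then show ?thesis by (simp only: left_diff_distrib mult_1 power2_eq_square) (simp add: mult_ac)
    qed
    then have "integral {-1..1} (\<lambda>s. s * (1 - s\<^sup>2) powr \<mu> * (s * cos (r * s))) =
      integral {-1..1} (\<lambda>s. (1 - s\<^sup>2) powr \<mu> * cos (r * s) - (1 - s\<^sup>2) powr (\<mu> + 1) * cos (r * s))"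
      by (rule integral_cong)
    also have "\<dots> = osc_int \<mu> r - osc_int (\<mu> + 1) r"
      unfolding osc_int_def
      by (subst integral_diff) (auto intro!: integrable_continuous_real continuous_intros c1 cont_powr_one_minus_sq)
    finally show ?thesis .
  qed
  ultimately show ?thesis by simp
qed

lemma osc_int_le_2: "\<bar>osc_int \<mu> r\<bar> \<le> 2"
proof -
  have i: "(\<lambda>s. (1 - s\<^sup>2) powr \<mu> * cos (r * s)) integrable_on {-1..1}"
    by (rule integrable_continuous_real) (rule cont_powr_one_minus_sq continuous_intros)+
  have "norm (integral {-1..1} (\<lambda>s. (1 - s\<^sup>2) powr \<mu> * cos (r * s))) \<le> integral {-1..1} (\<lambda>s::real. 1::real)"
  proof (rule integral_norm_bound_integral[OF i])
    fix s :: real assume "s \<in> {-1..1}"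
    then have "0 \<le> 1 - s\<^sup>2" "1 - s\<^sup>2 \<le> 1" by (auto simp: abs_square_le_1)
    then have "(1 - s\<^sup>2) powr \<mu> \<le> 1 powr \<mu>" using \<mu> by (intro powr_mono2) simp_all
    then have "(1 - s\<^sup>2) powr \<mu> * \<bar>cos (r * s)\<bar> \<le> 1 * 1" by (intro mult_mono) simp_all
    then show "norm ((1 - s\<^sup>2) powr \<mu> * cos (r * s)) \<le> 1" by (simp add: abs_mult)
  qed (rule integrable_const_ivl)
  also have "integral {-1..1} (\<lambda>s::real. 1::real) = 2" by simp
  finally show ?thesis by (simp only: osc_int_def real_norm_def)
qed

text \<open>Write F for \<open>osc_int \<mu>\<close> and G for the sine integral. Then F' = -G and
  G' = F - 2(\<mu>+1) G/r, which is Bessel's equation F'' + 2(\<mu>+1) F'/r + F = 0. The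
  substitution v = r^(\<mu>+1) F removes the first-order term and leaves the oscillation equation
  with \<kappa> = \<mu>(\<mu>+1); boundedness of v is the decay of F.\<close>

lemma osc_int_decay:
  obtains C where "0 \<le> C" "\<And>r. 1 \<le> r \<Longrightarrow> \<bar>osc_int \<mu> r\<bar> \<le> C * r powr - (\<mu> + 1)"
proof -
  let ?G = "\<lambda>r. integral {-1..1} (\<lambda>s. s * (1 - s\<^sup>2) powr \<mu> * sin (r * s))"
  have dG: "(?G has_real_derivative osc_int \<mu> r - 2 * (\<mu> + 1) * ?G r / r) (at r)" if "0 < r" for r
    using has_field_derivative_integral_sin[of r] that \<mu> by (simp add: integral_sin_eq_osc_int)
  obtain C where C: "\<And>r. 1 \<le> r \<Longrightarrow> \<bar>r powr (\<mu> + 1) * osc_int \<mu> r\<bar> \<le> C"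
  proof (rule bounded_of_oscillation_ode[of "\<mu> * (\<mu> + 1)" "\<lambda>r. r powr (\<mu> + 1) * osc_int \<mu> r"
        "\<lambda>r. r powr (\<mu> + 1) * ((\<mu> + 1) * osc_int \<mu> r / r - ?G r)"])
    fix r :: real assume r: "0 < r"
    have rp: "r powr \<mu> = r powr (\<mu> + 1) / r" using r by (simp add: powr_add)
    show "((\<lambda>r. r powr (\<mu> + 1) * osc_int \<mu> r) has_real_derivative r powr (\<mu> + 1) * ((\<mu> + 1) * osc_int \<mu> r / r - ?G r)) (at r)"
      by (rule derivative_eq_intros has_field_derivative_osc_int r refl)+
         (use r in \<open>simp add: rp algebra_simps\<close>)
    show "((\<lambda>r. r powr (\<mu> + 1) * ((\<mu> + 1) * osc_int \<mu> r / r - ?G r)) has_real_derivative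
        - (1 - \<mu> * (\<mu> + 1) / r\<^sup>2) * (r powr (\<mu> + 1) * osc_int \<mu> r)) (at r)"
      by (rule derivative_eq_intros has_field_derivative_osc_int dG r refl | (use r in force))+
         (use r in \<open>simp add: rp field_simps power2_eq_square\<close>)
  qed (use \<mu> in auto)
  show ?thesis
  proof
    show "0 \<le> C" using C[of 1] by auto
    fix r :: real assume r: "1 \<le> r"
    then show "\<bar>osc_int \<mu> r\<bar> \<le> C * r powr - (\<mu> + 1)"
    proof -
      have "r powr (\<mu> + 1) * \<bar>osc_int \<mu> r\<bar> \<le> C" using C[OF r] by (simp add: abs_mult)
      then have "\<bar>osc_int \<mu> r\<bar> \<le> C / r powr (\<mu> + 1)"
        using r by (simp only: pos_le_divide_eq powr_gt_zero mult.commute)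
      then show ?thesis unfolding powr_minus by (simp only: divide_inverse)
    qed
  qed
qed

end

section \<open>The radial kernel and its derivatives\<close>

definition osc_kernel :: "real \<Rightarrow> real^'n::finite \<Rightarrow> complex" where
  "osc_kernel \<mu> x = of_real (osc_int \<mu> (2 * pi * norm x))"

lemma osc_kernel_decay:
  assumes "0 < \<mu>"
  obtains C where "0 \<le> C" "\<And>x. cmod (osc_kernel \<mu> x) \<le> C * wt (- (\<mu> + 1)) x"
proof -
  obtain C where C: "0 \<le> C" "\<And>r. 1 \<le> r \<Longrightarrow> \<bar>osc_int \<mu> r\<bar> \<le> C * r powr - (\<mu> + 1)"
    using osc_int_decay[OF assms] by metis
  \<comment> \<open>The first entry serves r \<ge> 1, where 1 + |x| \<le> 2 r; the second serves r <
    1, where the integral is at most 2 and 1 + |x| \<le> 2.\<close>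
  define D where "D = max (C * 2 powr (\<mu> + 1)) (2 * 2 powr (\<mu> + 1))"
  show ?thesis
  proof
    have "0 \<le> 2 * 2 powr (\<mu> + 1)" by simp
    then show "0 \<le> D" unfolding D_def by (rule max.coboundedI2)
    fix x :: "real^'a"
    define r where "r = 2 * pi * norm x"
    have pi: "norm x \<le> r" using pi_gt3 by (simp add: r_def mult_left_le_one_le mult_le_cancel_right1)
    show "cmod (osc_kernel \<mu> x) \<le> D * wt (- (\<mu> + 1)) x"
    proof (cases "1 \<le> r")
      case True
      have "r powr - (\<mu> + 1) = (2 * r) powr - (\<mu> + 1) * 2 powr (\<mu> + 1)"
        using True by (subst powr_mult) (auto simp: powr_add[symmetric])
      also have "\<dots> \<le> (1 + norm x) powr - (\<mu> + 1) * 2 powr (\<mu> + 1)"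
        using True pi assms by (intro mult_right_mono powr_mono2') (auto simp: add_pos_nonneg)
      finally have "C * r powr - (\<mu> + 1) \<le> C * (wt (- (\<mu> + 1)) x * 2 powr (\<mu> + 1))"
        using C by (intro mult_left_mono) (auto simp: wt_def)
      also have "\<dots> \<le> D * wt (- (\<mu> + 1)) x"
        by (simp add: D_def mult_ac mult_le_cancel_left_pos[OF wt_pos])
      finally show ?thesis using C(2)[OF True] by (simp add: osc_kernel_def r_def)
    next
      case False
      then have "2 powr - (\<mu> + 1) \<le> wt (- (\<mu> + 1)) x"
        unfolding wt_def using pi assms by (intro powr_mono2') (auto simp: add_pos_nonneg)
      then have "2 powr (\<mu> + 1) * 2 powr - (\<mu> + 1) \<le> 2 powr (\<mu> + 1) * wt (- (\<mu> + 1)) x"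
        by (intro mult_left_mono) auto
      then have "1 \<le> 2 powr (\<mu> + 1) * wt (- (\<mu> + 1)) x"
        by (simp only: powr_add[symmetric]) simp
      then have "2 * 1 \<le> 2 * (2 powr (\<mu> + 1) * wt (- (\<mu> + 1)) x)" by simp
      also have "\<dots> \<le> D * wt (- (\<mu> + 1)) x"
        by (simp add: D_def mult_ac mult_le_cancel_left_pos[OF wt_pos])
      finally show ?thesis using osc_int_le_2[OF assms, of r] by (simp add: osc_kernel_def r_def)
    qed
  qed
qed

text \<open>The derivative of \<open>osc_int \<mu>\<close> contains a factor r, which cancels the
  1/|x| from differentiating the norm and leaves a smooth expression with \<mu> raised by 1. At the
  origin, where the norm is not differentiable, the formula still holds because
  \<open>osc_int \<mu>\<close> has derivative 0 there.\<close>

lemma has_derivative_osc_kernel: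
  assumes \<mu>: "0 < \<mu>"
  shows "(osc_kernel \<mu> has_derivative
    (\<lambda>h. of_real (- (2 * pi\<^sup>2) / (\<mu> + 1)) * (of_real (x \<bullet> h) * osc_kernel (\<mu> + 1) x))) (at x)"
proof -
  let ?d = "- (2 * pi\<^sup>2) / (\<mu> + 1)"
  have "((\<lambda>x. osc_int \<mu> (2 * pi * norm x)) has_derivative (\<lambda>h. ?d * ((x \<bullet> h) * osc_int (\<mu> + 1) (2 * pi * norm x)))) (at x)"
  proof (cases "x = 0")
    case False
    have n: "((\<lambda>x. 2 * pi * norm x) has_derivative (\<lambda>h. 2 * pi * ((x \<bullet> h) / norm x))) (at x)"
    proof (rule has_derivative_mult_right)
      have "(\<lambda>h. h \<bullet> sgn x) = (\<lambda>h. (x \<bullet> h) / norm x)"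
        by (rule ext) (simp add: sgn_div_norm inner_commute[of _ x] divide_inverse)
      with has_derivative_norm[OF False] show "(norm has_derivative (\<lambda>h. (x \<bullet> h) / norm x)) (at x)" by simp
    qed
    have "((\<lambda>x. osc_int \<mu> (2 * pi * norm x)) has_derivative
        (\<lambda>h. - (2 * pi * norm x) / (2 * (\<mu> + 1)) * osc_int (\<mu> + 1) (2 * pi * norm x) * (2 * pi * ((x \<bullet> h) / norm x)))) (at x)"
      by (rule has_derivative_compose[OF n has_field_derivative_imp_has_derivative[OF has_field_derivative_osc_int'[OF \<mu>]]])
    moreover have "(\<lambda>h. - (2 * pi * norm x) / (2 * (\<mu> + 1)) * osc_int (\<mu> + 1) (2 * pi * norm x) * (2 * pi * ((x \<bullet> h) / norm x))) =
        (\<lambda>h. ?d * ((x \<bullet> h) * osc_int (\<mu> + 1) (2 * pi * norm x)))"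
      using False \<mu> by (auto simp: fun_eq_iff field_simps power2_eq_square)
    ultimately show ?thesis by simp
  next
    case True
    have "(osc_int \<mu> has_real_derivative 0) (at 0)"
      using has_field_derivative_osc_int'[OF \<mu>, of 0] by simp
    then have "((\<lambda>h. (osc_int \<mu> h - osc_int \<mu> 0) / h) \<longlongrightarrow> 0) (at 0)"
      by (simp add: DERIV_def)
    moreover have "filterlim (\<lambda>h. 2 * pi * norm (h::real^'a)) (at 0) (at 0)"
      unfolding filterlim_at by (auto intro!: tendsto_eq_intros simp: eventually_at_filter)
    ultimately have "((\<lambda>h. (osc_int \<mu> (2 * pi * norm (h::real^'a)) - osc_int \<mu> 0) / (2 * pi * norm h)) \<longlongrightarrow> 0) (at 0)"
      by (rule filterlim_compose)
    from tendsto_mult_left[OF this, of "2 * pi"]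
    have "((\<lambda>h. (osc_int \<mu> (2 * pi * norm (h::real^'a)) - osc_int \<mu> 0) / norm h) \<longlongrightarrow> 0) (at 0)"
      by simp
    from tendsto_norm[OF this] show ?thesis unfolding True has_derivative_at by (simp add: norm_divide)
  qed
  from bounded_linear.has_derivative[OF bounded_linear_of_real[where 'a=complex] this]
  show ?thesis unfolding osc_kernel_def[abs_def] by simp
qed

text \<open>Differentiation multiplies by x_i and raises \<mu> by 1; the growth of the one is
  compensated by the decay of the other, so all derivatives keep the rate \<mu> + 1.\<close>

lemma deriv_bound_osc_kernel:
  "0 < \<mu> \<Longrightarrow> \<exists>C\<ge>0. deriv_bound m (\<lambda>x. C * wt (- (\<mu> + 1)) x) (osc_kernel \<mu> :: real^'n::finite \<Rightarrow> complex)"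
proof (induction m arbitrary: \<mu>)
  case 0
  then show ?case using has_derivative_osc_kernel[OF 0] osc_kernel_decay[OF 0, where 'a='n]
    unfolding deriv_bound_0 differentiable_def by metis
next
  case (Suc m)
  obtain C where C: "0 \<le> C" "\<And>x::real^'n. cmod (osc_kernel \<mu> x) \<le> C * wt (- (\<mu> + 1)) x"
    using osc_kernel_decay[OF Suc.prems] by metis
  obtain D where D: "0 \<le> D" "deriv_bound m (\<lambda>x. D * wt (- (\<mu> + 2)) x) (osc_kernel (\<mu> + 1) :: real^'n \<Rightarrow> complex)"
    using Suc.IH[of "\<mu> + 1"] Suc.prems by (auto simp: add.assoc)
  let ?d = "complex_of_real (- (2 * pi\<^sup>2) / (\<mu> + 1))"
  define M where "M = C + cmod ?d * 2 ^ m * D"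
  have p: "partial_deriv i (osc_kernel \<mu>) = (\<lambda>x::real^'n. ?d * (of_real (x $ i) * osc_kernel (\<mu> + 1) x))" for i
    by (rule ext, subst partial_deriv_eqI[OF has_derivative_osc_kernel[OF Suc.prems]]) (simp add: inner_axis)
  have "deriv_bound m (\<lambda>x. M * wt (- (\<mu> + 1)) x) (partial_deriv i (osc_kernel \<mu> :: real^'n \<Rightarrow> complex))" for i
    unfolding p
  proof (rule deriv_bound_mono[OF deriv_bound_cmult[OF deriv_bound_mult[OF deriv_bound_coord D(2)]]])
    fix x :: "real^'n"
    have "cmod ?d * (2 ^ m * (wt 1 x * (D * wt (- (\<mu> + 2)) x))) = cmod ?d * 2 ^ m * D * wt (1 + - (\<mu> + 2)) x"
      unfolding wt_add by (simp only: mult_ac)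
    also have "1 + - (\<mu> + 2) = - (\<mu> + 1)" by simp
    also have "cmod ?d * 2 ^ m * D * wt (- (\<mu> + 1)) x \<le> M * wt (- (\<mu> + 1)) x"
      by (intro mult_right_mono) (use C in \<open>auto simp: M_def\<close>)
    finally show "cmod ?d * (2 ^ m * (wt 1 x * (D * wt (- (\<mu> + 2)) x))) \<le> M * wt (- (\<mu> + 1)) x" .
  qed auto
  moreover have "cmod (osc_kernel \<mu> x) \<le> M * wt (- (\<mu> + 1)) x" for x :: "real^'n"
    using C(2)[of x] D(1) by (auto simp: M_def intro!: order_trans[OF C(2)] mult_right_mono)
  ultimately show ?case using has_derivative_osc_kernel[OF Suc.prems] C D
    by (intro exI[of _ M]) (auto simp: deriv_bound_Suc differentiable_def M_def)
qed

section \<open>Slicing the multiplier\<close>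

lemma nn_integral_slice_real:
  fixes \<nu> :: real
  assumes "0 < \<nu>"
  obtains c where "0 \<le> c"
    "\<And>t. (\<integral>\<^sup>+y. ennreal (max 0 (t - y\<^sup>2) powr \<nu>) \<partial>lborel) = ennreal (c * max 0 t powr (\<nu> + 1 / 2))"
proof -
  define I where "I = (\<integral>\<^sup>+y. ennreal (max 0 (1 - y\<^sup>2) powr \<nu>) \<partial>lborel)"
  have "I \<le> (\<integral>\<^sup>+y. indicator {-1..1::real} y \<partial>lborel)"
    unfolding I_def
  proof (intro nn_integral_mono)
    fix y :: real
    show "ennreal (max 0 (1 - y\<^sup>2) powr \<nu>) \<le> indicator {-1..1} y"
    proof (cases "y \<in> {-1..1}")
      case True
      then have "max 0 (1 - y\<^sup>2) powr \<nu> \<le> 1 powr \<nu>"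
        using assms by (intro powr_mono2) auto
      then show ?thesis using True by simp
    next
      case False
      then have "\<not> y\<^sup>2 \<le> 1" by (auto simp: abs_square_le_1)
      then show ?thesis by simp
    qed
  qed
  then have "I < \<infinity>" by (rule le_less_trans) simp
  then obtain c where c: "0 \<le> c" "I = ennreal c" by (cases I) auto
  show ?thesis
  proof (rule that[OF c(1)])
    fix t :: real
    show "(\<integral>\<^sup>+y. ennreal (max 0 (t - y\<^sup>2) powr \<nu>) \<partial>lborel) = ennreal (c * max 0 t powr (\<nu> + 1 / 2))"
    proof (cases "0 < t")
      case False
      then have "max 0 (t - y\<^sup>2) = 0" for y using zero_le_power2[of y] by linarith
      then show ?thesis using False by simp
    next
      case True
      \<comment> \<open>The substitution y = sqrt t * y' extracts t^\<nu> from the integrand and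
        t^(1/2) from the measure.\<close>
      have "(\<integral>\<^sup>+y. ennreal (max 0 (t - y\<^sup>2) powr \<nu>) \<partial>lborel) =
          ennreal (sqrt t) * (\<integral>\<^sup>+y. ennreal (max 0 (t - (0 + sqrt t * y)\<^sup>2) powr \<nu>) \<partial>lborel)"
        using True by (subst nn_integral_real_affine[of _ "sqrt t" 0]) auto
      also have "(\<lambda>y. ennreal (max 0 (t - (0 + sqrt t * y)\<^sup>2) powr \<nu>)) =
          (\<lambda>y. ennreal (t powr \<nu>) * ennreal (max 0 (1 - y\<^sup>2) powr \<nu>))"
      proof
        fix y
        have "max 0 (t - (0 + sqrt t * y)\<^sup>2) = t * max 0 (1 - y\<^sup>2)"
          using True by (auto simp: power_mult_distrib max_def algebra_simps mult_le_cancel_left1)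
        then show "ennreal (max 0 (t - (0 + sqrt t * y)\<^sup>2) powr \<nu>) =
            ennreal (t powr \<nu>) * ennreal (max 0 (1 - y\<^sup>2) powr \<nu>)"
          using True by (simp add: powr_mult ennreal_mult)
      qed
      also have "(\<integral>\<^sup>+y. ennreal (t powr \<nu>) * ennreal (max 0 (1 - y\<^sup>2) powr \<nu>) \<partial>lborel) = ennreal (t powr \<nu>) * ennreal c"
        by (subst nn_integral_cmult) (auto simp: I_def[symmetric] c)
      also have "ennreal (sqrt t) * (ennreal (t powr \<nu>) * ennreal c) = ennreal (c * max 0 t powr (\<nu> + 1 / 2))"
        using True c by (simp add: ennreal_mult[symmetric] powr_add powr_half_sqrt mult_ac)
      finally show ?thesis .
    qed
  qed
qed

text \<open>Tonelli, one coordinate at a time: integrating out a coordinate shifts t by its square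
  and raises the exponent by 1/2. Keeping t general is what makes the induction go through.\<close>

lemma nn_integral_slice_PiM:
  fixes \<delta> :: real and A :: "'i set"
  assumes "finite A" "0 < \<delta>"
  shows "\<exists>c\<ge>0. \<forall>t. (\<integral>\<^sup>+f. ennreal (max 0 (t - (\<Sum>i\<in>A. (f i)\<^sup>2)) powr \<delta>) \<partial>(\<Pi>\<^sub>M i\<in>A. lborel)) =
    ennreal (c * max 0 t powr (\<delta> + card A / 2))"
  using assms(1)
proof (induction rule: finite_induct)
  case empty
  interpret product_sigma_finite "\<lambda>_. lborel" by standard
  show ?case by (intro exI[of _ 1]) (simp add: PiM_empty)
next
  case (insert i A)
  interpret product_sigma_finite "\<lambda>_. lborel" by standard
  obtain c where c: "0 \<le> c" "\<And>t. (\<integral>\<^sup>+f. ennreal (max 0 (t - (\<Sum>i\<in>A. (f i)\<^sup>2)) powr \<delta>) \<partial>(\<Pi>\<^sub>M i\<in>A. lborel)) =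
    ennreal (c * max 0 t powr (\<delta> + card A / 2))" using insert.IH by blast
  obtain d where d: "0 \<le> d" "\<And>t. (\<integral>\<^sup>+y. ennreal (max 0 (t - y\<^sup>2) powr (\<delta> + card A / 2)) \<partial>lborel) =
      ennreal (d * max 0 t powr (\<delta> + card A / 2 + 1 / 2))"
    using nn_integral_slice_real[of "\<delta> + card A / 2"] assms(2) by (metis add_pos_nonneg divide_nonneg_nonneg of_nat_0_le_iff zero_le_numeral)
  have "(\<integral>\<^sup>+f. ennreal (max 0 (t - (\<Sum>i\<in>insert i A. (f i)\<^sup>2)) powr \<delta>) \<partial>(\<Pi>\<^sub>M i\<in>insert i A. lborel)) =
      ennreal (c * d * max 0 t powr (\<delta> + card (insert i A) / 2))" for t
  proof -
    have "(\<integral>\<^sup>+f. ennreal (max 0 (t - (\<Sum>i\<in>insert i A. (f i)\<^sup>2)) powr \<delta>) \<partial>(\<Pi>\<^sub>M i\<in>insert i A. lborel)) =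
      (\<integral>\<^sup>+y. \<integral>\<^sup>+f. ennreal (max 0 (t - (\<Sum>j\<in>insert i A. ((f(i := y)) j)\<^sup>2)) powr \<delta>) \<partial>(\<Pi>\<^sub>M i\<in>A. lborel) \<partial>lborel)"
      using insert.hyps by (subst product_nn_integral_insert_rev) auto
    also have "\<dots> = (\<integral>\<^sup>+y. \<integral>\<^sup>+f. ennreal (max 0 ((t - y\<^sup>2) - (\<Sum>j\<in>A. (f j)\<^sup>2)) powr \<delta>) \<partial>(\<Pi>\<^sub>M i\<in>A. lborel) \<partial>lborel)"
    proof -
      have "(\<Sum>j\<in>insert i A. ((f(i := y)) j)\<^sup>2) = y\<^sup>2 + (\<Sum>j\<in>A. (f j)\<^sup>2)" for f and y :: real
      proof -
        have "(\<Sum>j\<in>A. ((f(i := y)) j)\<^sup>2) = (\<Sum>j\<in>A. (f j)\<^sup>2)"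
          using insert.hyps by (intro sum.cong) auto
        then show ?thesis using insert.hyps by simp
      qed
      then show ?thesis by (simp add: algebra_simps)
    qed
    also have "\<dots> = (\<integral>\<^sup>+y. ennreal c * ennreal (max 0 (t - y\<^sup>2) powr (\<delta> + card A / 2)) \<partial>lborel)"
      using c by (simp add: ennreal_mult)
    also have "\<dots> = ennreal c * ennreal (d * max 0 t powr (\<delta> + card A / 2 + 1 / 2))"
      by (subst nn_integral_cmult) (auto simp: d)
    also have "\<dots> = ennreal (c * d * max 0 t powr (\<delta> + card (insert i A) / 2))"
      using insert.hyps c d by (simp add: ennreal_mult[symmetric] add_divide_distrib add_ac mult_ac)
    finally show ?thesis .
  qed
  then show ?case using c(1) d(1) by (intro exI[of _ "c * d"]) auto
qed

text \<open>Splitting off the coordinate along b and slicing the others adds (n - 1)/2 to the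
  exponent. The result is phrased as an identity of measures so that complex integrands depending
  only on \<xi> \<bullet> b can be transferred by \<open>integral_distr\<close>.\<close>

lemma distr_bochner_riesz_multiplier:
  fixes b :: "'a::euclidean_space"
  assumes b: "b \<in> Basis" and \<delta>: "0 < \<delta>"
  obtains c where "0 \<le> c"
    "distr (density lborel (\<lambda>\<xi>::'a. ennreal (max 0 (1 - (norm \<xi>)\<^sup>2) powr \<delta>))) borel (\<lambda>\<xi>. \<xi> \<bullet> b) =
     density lborel (\<lambda>s. ennreal (c * max 0 (1 - s\<^sup>2) powr (\<delta> + (real DIM('a) - 1) / 2)))"
proof -
  interpret product_sigma_finite "\<lambda>_. lborel" by standard
  let ?A = "Basis - {b}" and ?\<mu> = "\<delta> + (real DIM('a) - 1) / 2"
  have cA: "real (card ?A) = real DIM('a) - 1" using b DIM_positive[where 'a='a] by (simp add: of_nat_diff)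
  obtain c where c: "0 \<le> c" "\<And>t. (\<integral>\<^sup>+f. ennreal (max 0 (t - (\<Sum>i\<in>?A. (f i)\<^sup>2)) powr \<delta>) \<partial>(\<Pi>\<^sub>M i\<in>?A. lborel)) =
    ennreal (c * max 0 t powr ?\<mu>)" using nn_integral_slice_PiM[of ?A, OF _ \<delta>] cA by auto
  let ?m = "\<lambda>\<xi>::'a. ennreal (max 0 (1 - (norm \<xi>)\<^sup>2) powr \<delta>)"
  show ?thesis
  proof (rule that[OF c(1)], rule measure_eqI)
    fix S assume "S \<in> sets (distr (density lborel ?m) borel (\<lambda>\<xi>. \<xi> \<bullet> b))"
    then have [measurable]: "S \<in> sets borel" by simp
    have "emeasure (distr (density lborel ?m) borel (\<lambda>\<xi>. \<xi> \<bullet> b)) S =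
        (\<integral>\<^sup>+\<xi>. ?m \<xi> * indicator S (\<xi> \<bullet> b) \<partial>lborel)"
    proof -
      have "(\<lambda>\<xi>::'a. \<xi> \<bullet> b) \<in> borel \<rightarrow>\<^sub>M borel" by simp
      from measurable_sets[OF this, of S] have "(\<lambda>\<xi>::'a. \<xi> \<bullet> b) -` S \<in> sets borel" by simp
      then show ?thesis
        by (subst emeasure_distr, simp, simp, subst emeasure_density)
           (auto intro!: nn_integral_cong simp: indicator_def)
    qed
    also have "\<dots> = (\<integral>\<^sup>+f. ennreal (max 0 (1 - (\<Sum>i\<in>Basis. (f i)\<^sup>2)) powr \<delta>) * indicator S (f b) \<partial>(\<Pi>\<^sub>M i\<in>Basis. lborel))"
    proof (subst lborel_eq, subst nn_integral_distr, goal_cases)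
      case 3
      have "(norm (\<Sum>i\<in>Basis. f i *\<^sub>R i :: 'a))\<^sup>2 = (\<Sum>i\<in>Basis. (f i)\<^sup>2)" for f
        unfolding power2_norm_eq_inner by (subst euclidean_inner) (simp add: power2_eq_square)
      then show ?case using b by simp
    qed (use b in measurable)
    also have "\<dots> = (\<integral>\<^sup>+f. ennreal (max 0 (1 - (\<Sum>i\<in>insert b ?A. (f i)\<^sup>2)) powr \<delta>) * indicator S (f b) \<partial>(\<Pi>\<^sub>M i\<in>insert b ?A. lborel))"
      using b by (simp add: insert_absorb)
    also have "\<dots> = (\<integral>\<^sup>+y. \<integral>\<^sup>+f. ennreal (max 0 (1 - (\<Sum>i\<in>insert b ?A. ((f(b := y)) i)\<^sup>2)) powr \<delta>) * indicator S ((f(b := y)) b)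
        \<partial>(\<Pi>\<^sub>M i\<in>?A. lborel) \<partial>lborel)"
      by (subst product_nn_integral_insert_rev) auto
    also have "\<dots> = (\<integral>\<^sup>+y. \<integral>\<^sup>+f. ennreal (max 0 ((1 - y\<^sup>2) - (\<Sum>i\<in>?A. (f i)\<^sup>2)) powr \<delta>) * indicator S y
        \<partial>(\<Pi>\<^sub>M i\<in>?A. lborel) \<partial>lborel)"
    proof -
      have "(\<Sum>i\<in>insert b ?A. ((f(b := y)) i)\<^sup>2) = y\<^sup>2 + (\<Sum>i\<in>?A. (f i)\<^sup>2)" for f and y :: real
      proof -
        have "(\<Sum>i\<in>?A. ((f(b := y)) i)\<^sup>2) = (\<Sum>i\<in>?A. (f i)\<^sup>2)" by (intro sum.cong) auto
        then show ?thesis by (subst sum.insert) auto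
      qed
      then show ?thesis by (simp add: diff_diff_eq)
    qed
    also have "\<dots> = (\<integral>\<^sup>+y. ennreal (c * max 0 (1 - y\<^sup>2) powr ?\<mu>) * indicator S y \<partial>lborel)"
      by (subst nn_integral_multc) (auto simp: c)
    also have "\<dots> = emeasure (density lborel (\<lambda>s. ennreal (c * max 0 (1 - s\<^sup>2) powr ?\<mu>))) S"
      by (simp add: emeasure_density)
    finally show "emeasure (distr (density lborel ?m) borel (\<lambda>\<xi>. \<xi> \<bullet> b)) S =
        emeasure (density lborel (\<lambda>s. ennreal (c * max 0 (1 - s\<^sup>2) powr ?\<mu>))) S" .
  qed simp
qed

lemma integral_even_cis:
  fixes \<mu> r :: real
  assumes "0 < \<mu>"
  shows "(\<integral>s. max 0 (1 - s\<^sup>2) powr \<mu> *\<^sub>R cis (- (r * s)) \<partial>lborel) = complex_of_real (osc_int \<mu> r)"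
    and "integrable lborel (\<lambda>s. max 0 (1 - s\<^sup>2) powr \<mu>)"
proof -
  have m: "max 0 (1 - s\<^sup>2) powr \<mu> = indicator {-1..1} s * (1 - s\<^sup>2) powr \<mu>" for s :: real
  proof (cases "s \<in> {-1..1}")
    case True
    then have "0 \<le> 1 - s\<^sup>2" by (auto simp: abs_square_le_1)
    then show ?thesis using True by (simp only: max_absorb2 indicator_simps mult_1)
  next
    case False
    then have "1 - s\<^sup>2 \<le> 0" using abs_square_le_1[of s] by auto
    then show ?thesis using False by simp
  qed
  have int: "set_integrable lborel {-1..1} (\<lambda>s. (1 - s\<^sup>2) powr \<mu> * h (r * s))" if "continuous_on UNIV h" for h :: "real \<Rightarrow> real"
  proof (rule borel_integrable_atLeastAtMost')
    have "continuous_on {-1..1} (\<lambda>s. h (r * s))"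
      by (rule continuous_on_compose2[OF that]) (auto intro!: continuous_intros)
    then show "continuous_on {-1..1} (\<lambda>s. (1 - s\<^sup>2) powr \<mu> * h (r * s))"
      using cont_powr_one_minus_sq[OF assms] by (rule continuous_on_mult[rotated])
  qed
  have int': "integrable lborel (\<lambda>s. max 0 (1 - s\<^sup>2) powr \<mu> * h (r * s))" if "continuous_on UNIV h" for h :: "real \<Rightarrow> real"
    using int[OF that] by (simp add: set_integrable_def m mult.assoc)
  show "integrable lborel (\<lambda>s. max 0 (1 - s\<^sup>2) powr \<mu>)" using int'[of "\<lambda>_. 1"] by simp
  have c: "(\<integral>s. max 0 (1 - s\<^sup>2) powr \<mu> * cos (r * s) \<partial>lborel) = osc_int \<mu> r"
  proof -
    have cc: "continuous_on UNIV (cos :: real \<Rightarrow> real)" by (intro continuous_intros)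
    show ?thesis using set_borel_integral_eq_integral(2)[OF int[OF cc]]
      by (simp add: osc_int_def set_lebesgue_integral_def m mult.assoc)
  qed
  \<comment> \<open>Reflection s \<mapsto> -s shows that this integral equals its own
    negative.\<close>
  have s: "(\<integral>s. max 0 (1 - s\<^sup>2) powr \<mu> * sin (r * s) \<partial>lborel) = 0"
    using lborel_integral_real_affine[of "-1" "\<lambda>s. max 0 (1 - s\<^sup>2) powr \<mu> * sin (r * s)" 0] by simp
  have cn: "continuous_on UNIV (cos :: real \<Rightarrow> real)" "continuous_on UNIV (sin :: real \<Rightarrow> real)" by (intro continuous_intros)+
  have e: "max 0 (1 - s\<^sup>2) powr \<mu> *\<^sub>R cis (- (r * s)) =
      complex_of_real (max 0 (1 - s\<^sup>2) powr \<mu> * cos (r * s)) - \<i> * complex_of_real (max 0 (1 - s\<^sup>2) powr \<mu> * sin (r * s))" for s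
    by (simp add: complex_eq_iff)
  show "(\<integral>s. max 0 (1 - s\<^sup>2) powr \<mu> *\<^sub>R cis (- (r * s)) \<partial>lborel) = complex_of_real (osc_int \<mu> r)"
    unfolding e
    by (subst Bochner_Integration.integral_diff)
       (auto intro!: integrable_mult_right integrable_of_real int' cn simp: c s simp del: of_real_mult)
qed

section \<open>Rotation invariance and the kernel as a one-dimensional integral\<close>

lemma nn_integral_lborel_translate:
  fixes c :: "'a::euclidean_space"
  assumes [measurable]: "f \<in> borel_measurable borel"
  shows "(\<integral>\<^sup>+x. f (c + x) \<partial>lborel) = (\<integral>\<^sup>+x. f x \<partial>lborel)"
proof -
  have "(\<integral>\<^sup>+x. f x \<partial>lborel) = (\<integral>\<^sup>+x. f x \<partial>distr lborel borel ((+) c))"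
    by (simp only: lborel_distr_plus)
  also have "\<dots> = (\<integral>\<^sup>+x. f (c + x) \<partial>lborel)" by (rule nn_integral_distr) simp_all
  finally show ?thesis ..
qed

text \<open>Uniqueness of translation-invariant measures: both sides are compared with the measure of
  the unit ball, which is invariant under isometries.\<close>

lemma distr_lborel_orthogonal:
  fixes T :: "'a::euclidean_space \<Rightarrow> 'a"
  assumes T: "orthogonal_transformation T"
  shows "distr lborel borel T = lborel"
proof (rule measure_eqI)
  define S where "S = inv T"
  have S: "orthogonal_transformation S" unfolding S_def by (rule orthogonal_transformation_inv[OF T])
  have TS [simp]: "T (S y) = y" for y
    unfolding S_def using orthogonal_transformation_surj[OF T] by (rule surj_f_inv_f)
  have lin: "linear T" and lS: "linear S" using T S by (auto simp: orthogonal_transformation_linear)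
  have [measurable]: "T \<in> borel_measurable borel" "S \<in> borel_measurable borel"
    using lin lS by (auto intro!: borel_measurable_continuous_onI linear_continuous_on linear_conv_bounded_linear[THEN iffD1])
  let ?B = "cball 0 1 :: 'a set"
  fix A assume "A \<in> sets (distr lborel borel T)"
  then have [measurable]: "A \<in> sets borel" by simp
  let ?I = "indicator :: 'a set \<Rightarrow> 'a \<Rightarrow> ennreal"
  have mB [measurable]: "?B \<in> sets borel" by simp
  have "emeasure (distr lborel borel T) A * emeasure lborel ?B = (\<integral>\<^sup>+x. ?I A (T x) \<partial>lborel) * (\<integral>\<^sup>+y. ?I ?B y \<partial>lborel)"
  proof -
    have "(\<integral>\<^sup>+x. ?I A (T x) \<partial>lborel) = (\<integral>\<^sup>+x. ?I A x \<partial>distr lborel borel T)"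
      by (rule nn_integral_distr[symmetric]) simp_all
    then show ?thesis by simp
  qed
  also have "\<dots> = (\<integral>\<^sup>+y. \<integral>\<^sup>+x. ?I A (T x) * ?I ?B y \<partial>lborel \<partial>lborel)"
    by (simp add: nn_integral_cmult nn_integral_multc)
  \<comment> \<open>Translating x by S y turns T x into y + T x. After an exchange of the integrals,
    y can be translated by T x, which frees A of T and moves T into the ball.\<close>
  also have "\<dots> = (\<integral>\<^sup>+y. \<integral>\<^sup>+x. ?I A (y + T x) * ?I ?B y \<partial>lborel \<partial>lborel)"
  proof (rule nn_integral_cong)
    fix y
    show "(\<integral>\<^sup>+x. ?I A (T x) * ?I ?B y \<partial>lborel) = (\<integral>\<^sup>+x. ?I A (y + T x) * ?I ?B y \<partial>lborel)"
      using nn_integral_lborel_translate[of "\<lambda>x. ?I A (T x) * ?I ?B y" "S y"]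
      by (simp add: linear_add[OF lin])
  qed
  also have "\<dots> = (\<integral>\<^sup>+x. \<integral>\<^sup>+y. ?I A (y + T x) * ?I ?B y \<partial>lborel \<partial>lborel)"
    by (rule lborel_pair.Fubini') measurable
  also have "\<dots> = (\<integral>\<^sup>+x. \<integral>\<^sup>+y. ?I A y * ?I ?B (y - T x) \<partial>lborel \<partial>lborel)"
  proof (rule nn_integral_cong)
    fix x
    show "(\<integral>\<^sup>+y. ?I A (y + T x) * ?I ?B y \<partial>lborel) = (\<integral>\<^sup>+y. ?I A y * ?I ?B (y - T x) \<partial>lborel)"
      using nn_integral_lborel_translate[of "\<lambda>y. ?I A y * ?I ?B (y - T x)" "T x"]
      by (simp add: add.commute)
  qed
  also have "\<dots> = (\<integral>\<^sup>+y. \<integral>\<^sup>+x. ?I A y * ?I ?B (y - T x) \<partial>lborel \<partial>lborel)"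
    by (rule lborel_pair.Fubini'[symmetric]) measurable
  also have "\<dots> = (\<integral>\<^sup>+y. ?I A y * emeasure lborel ?B \<partial>lborel)"
  proof (rule nn_integral_cong)
    fix y
    \<comment> \<open>The isometry T carries the unit ball about S y to the one about y, so the
      inner integral is the volume of a unit ball.\<close>
    have "norm (y - T x) = dist (S y) x" for x
      using orthogonal_transformation_norm[OF T, of "S y - x"] by (simp add: linear_diff[OF lin] dist_norm)
    then have "?I ?B (y - T x) = ?I (cball (S y) 1) x" for x
      by (simp add: indicator_def)
    then have "(\<integral>\<^sup>+x. ?I A y * ?I ?B (y - T x) \<partial>lborel) = (\<integral>\<^sup>+x. ?I A y * ?I (cball (S y) 1) x \<partial>lborel)"
      by (simp only:)
    also have "\<dots> = ?I A y * emeasure lborel (cball (S y) 1)"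
      by (rule nn_integral_cmult_indicator) simp
    finally have "(\<integral>\<^sup>+x. ?I A y * ?I ?B (y - T x) \<partial>lborel) = ?I A y * emeasure lborel (cball (S y) 1)" .
    then show "(\<integral>\<^sup>+x. ?I A y * ?I ?B (y - T x) \<partial>lborel) = ?I A y * emeasure lborel ?B"
      by (simp add: emeasure_cball)
  qed
  also have "\<dots> = emeasure lborel A * emeasure lborel ?B" by (simp add: nn_integral_multc)
  finally have eq: "emeasure (distr lborel borel T) A * emeasure lborel ?B = emeasure lborel A * emeasure lborel ?B" .
  show "emeasure (distr lborel borel T) A = emeasure lborel A"
  proof -
    have "emeasure lborel ?B \<noteq> 0" "emeasure lborel ?B \<noteq> top"
      by (simp_all add: emeasure_cball less_imp_neq[OF unit_ball_vol_pos, symmetric])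
    then show ?thesis using eq
      by (metis ennreal_mult_le_mult_iff mult.commute order_antisym order_refl)
  qed
qed simp

text \<open>The multiplier is radial, so a rotation taking a multiple of the unit vector b to x
  makes the phase depend on \<xi> \<bullet> b alone. The factor c is the slicing constant; its
  explicit value is irrelevant for decay.\<close>

lemma br_kernel_eq_osc_kernel:
  assumes \<delta>: "0 < \<delta>"
  obtains c where "(br_kernel \<delta> :: real^'n::finite \<Rightarrow> complex) = (\<lambda>x. of_real c * osc_kernel (\<delta> + (real CARD('n) - 1) / 2) x)"
proof -
  let ?\<mu> = "\<delta> + (real CARD('n) - 1) / 2" and ?m = "\<lambda>\<xi>::real^'n. max 0 (1 - (norm \<xi>)\<^sup>2) powr \<delta>"
  define b where "b = (axis undefined 1 :: real^'n)"
  have b: "b \<in> Basis" by (simp add: b_def)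
  have \<mu>: "0 < ?\<mu>" using \<delta> one_le_card_finite[where 'a='n] by (simp add: add_pos_nonneg)
  obtain c where c: "0 \<le> c" "distr (density lborel (\<lambda>\<xi>. ennreal (?m \<xi>))) borel (\<lambda>\<xi>. \<xi> \<bullet> b) =
     density lborel (\<lambda>s. ennreal (c * max 0 (1 - s\<^sup>2) powr ?\<mu>))"
    using distr_bochner_riesz_multiplier[OF b \<delta>] by auto
  have axis: "(\<integral>\<xi>. ?m \<xi> *\<^sub>R cis (- (r * (\<xi> \<bullet> b))) \<partial>lborel) = of_real (c * osc_int ?\<mu> r)" for r
  proof -
    have "(\<integral>\<xi>. ?m \<xi> *\<^sub>R cis (- (r * (\<xi> \<bullet> b))) \<partial>lborel) = (\<integral>\<xi>. cis (- (r * (\<xi> \<bullet> b))) \<partial>(density lborel (\<lambda>\<xi>. ennreal (?m \<xi>))))"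
      by (rule integral_density[symmetric]) (auto intro!: borel_measurable_continuous_onI continuous_intros)
    also have "\<dots> = (\<integral>s. cis (- (r * s)) \<partial>distr (density lborel (\<lambda>\<xi>. ennreal (?m \<xi>))) borel (\<lambda>\<xi>. \<xi> \<bullet> b))"
      by (rule integral_distr[symmetric]) (auto intro!: borel_measurable_continuous_onI continuous_intros)
    also have "\<dots> = (\<integral>s. (c * max 0 (1 - s\<^sup>2) powr ?\<mu>) *\<^sub>R cis (- (r * s)) \<partial>lborel)"
      unfolding c(2) using c(1)
      by (intro integral_density) (auto intro!: borel_measurable_continuous_onI continuous_intros)
    also have "\<dots> = of_real (c * osc_int ?\<mu> r)"
      unfolding scaleR_scaleR[symmetric] integral_scaleR_right integral_even_cis(1)[OF \<mu>]
      by (simp add: scaleR_conv_of_real)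
    finally show ?thesis .
  qed
  have "br_kernel \<delta> x = of_real c * osc_kernel ?\<mu> x" for x :: "real^'n"
  proof -
    have "norm (norm x *\<^sub>R b) = norm x" using b by simp
    then obtain T where T: "orthogonal_transformation T" "T (norm x *\<^sub>R b) = x"
      using orthogonal_transformation_exists by metis
    have [measurable]: "T \<in> borel_measurable borel"
      using T(1) by (auto simp: orthogonal_transformation_linear intro!: borel_measurable_continuous_onI linear_continuous_on linear_conv_bounded_linear[THEN iffD1])
    let ?h = "\<lambda>\<xi>. of_real (?m \<xi>) * cis (- 2 * pi * (\<xi> \<bullet> x))"
    have mh: "?h \<in> borel_measurable borel"
      by (intro borel_measurable_times borel_measurable_of_real) (auto intro!: borel_measurable_continuous_onI continuous_intros)
    have "br_kernel \<delta> x = (\<integral>\<xi>. ?h \<xi> \<partial>lborel)"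
      unfolding br_kernel_def fourier_def by (rule integral_completion) (use mh in simp)
    also have "\<dots> = (\<integral>\<xi>. ?h \<xi> \<partial>distr lborel borel T)" by (simp add: distr_lborel_orthogonal[OF T(1)])
    also have "\<dots> = (\<integral>\<xi>. ?h (T \<xi>) \<partial>lborel)" by (rule integral_distr) (use mh in simp_all)
    also have "\<dots> = (\<integral>\<xi>. ?m \<xi> *\<^sub>R cis (- ((2 * pi * norm x) * (\<xi> \<bullet> b))) \<partial>lborel)"
    proof (rule Bochner_Integration.integral_cong[OF refl])
      fix \<xi>
      have "T \<xi> \<bullet> x = norm x * (\<xi> \<bullet> b)"
      proof -
        have "T \<xi> \<bullet> x = T \<xi> \<bullet> T (norm x *\<^sub>R b)" by (simp only: T(2))
        also have "\<dots> = \<xi> \<bullet> (norm x *\<^sub>R b)" using T(1) by (simp add: orthogonal_transformation_def)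
        finally show ?thesis by simp
      qed
      then show "?h (T \<xi>) = ?m \<xi> *\<^sub>R cis (- ((2 * pi * norm x) * (\<xi> \<bullet> b)))"
        using orthogonal_transformation_norm[OF T(1)] by (simp add: scaleR_conv_of_real mult.assoc)
    qed
    also have "\<dots> = of_real c * osc_kernel ?\<mu> x" unfolding axis by (simp add: osc_kernel_def)
    finally show ?thesis .
  qed
  then show ?thesis by (intro that[of c] ext)
qed

lemma deriv_bound_br_kernel:
  assumes \<delta>: "0 < \<delta>"
  obtains C where "0 \<le> C"
    "deriv_bound m (\<lambda>x. C * wt (- (\<delta> + (real CARD('n) + 1) / 2)) x) (br_kernel \<delta> :: real^'n::finite \<Rightarrow> complex)"
proof -
  let ?\<mu> = "\<delta> + (real CARD('n) - 1) / 2"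
  obtain c where c: "(br_kernel \<delta> :: real^'n \<Rightarrow> complex) = (\<lambda>x. of_real c * osc_kernel ?\<mu> x)"
    using br_kernel_eq_osc_kernel[OF \<delta>] by metis
  have \<mu>: "0 < ?\<mu>" using \<delta> one_le_card_finite[where 'a='n] by (simp add: add_pos_nonneg)
  obtain C where C: "0 \<le> C" "deriv_bound m (\<lambda>x. C * wt (- (?\<mu> + 1)) x) (osc_kernel ?\<mu> :: real^'n \<Rightarrow> complex)"
    using deriv_bound_osc_kernel[OF \<mu>] by blast
  have e: "?\<mu> + 1 = \<delta> + (real CARD('n) + 1) / 2" by (simp add: field_simps)
  show ?thesis
    using deriv_bound_cmult[OF C(2), of "of_real c"] C(1)
    by (intro that[of "\<bar>c\<bar> * C"]) (simp_all add: c e mult.assoc)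
qed

section \<open>The maximal function with an A1 weight\<close>

abbreviation weighted :: "(real^'n::finite \<Rightarrow> real) \<Rightarrow> (real^'n) measure" where
  "weighted w \<equiv> density lebesgue (\<lambda>x. ennreal (w x))"

text \<open>Up to normalisation by r^n instead of the volume, the superlevel set of the uncentred
  Hardy-Littlewood maximal function of g. As a union of open balls it is open, hence measurable,
  while the closed balls in the condition suit the Vitali covering. Outside it, in particular, all
  centred averages are at most l.\<close>

definition super_balls :: "(real^'n::finite \<Rightarrow> ennreal) \<Rightarrow> real \<Rightarrow> (real^'n) set" where
  "super_balls g l = (\<Union>(a, r)\<in>{(a, r). 0 < r \<and> ennreal (l * r ^ CARD('n)) < (\<integral>\<^sup>+x\<in>cball a r. g x \<partial>lebesgue)}. ball a r)"

lemma weight_measurable: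
  assumes "weight w" shows "w \<in> borel_measurable lebesgue"
proof (rule borel_measurable_LIMSEQ_real)
  fix k :: nat
  show "(\<lambda>x. indicator (cball 0 (real k)) x *\<^sub>R w x) \<in> borel_measurable lebesgue"
    using assms unfolding weight_def set_integrable_def by (meson borel_measurable_integrable compact_cball)
next
  fix x :: "real^'a"
  obtain m where m: "norm x \<le> real m" using real_arch_simple by blast
  show "(\<lambda>k. indicator (cball 0 (real k)) x *\<^sub>R w x) \<longlonglongrightarrow> w x"
  proof (rule tendsto_eventually)
    show "\<forall>\<^sub>F k in sequentially. indicator (cball 0 (real k)) x *\<^sub>R w x = w x"
      using eventually_ge_at_top[of m] by eventually_elim (use m in auto)
  qed
qed

lemma weighted_measure_eq_emeasure:
  assumes "weight w" "E \<in> sets lebesgue"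
  shows "weighted_measure w E = emeasure (weighted w) E"
  unfolding weighted_measure_def using assms weight_measurable[OF assms(1)]
  by (subst emeasure_density) auto

lemma weighted_measure_mono: "E \<subseteq> F \<Longrightarrow> weighted_measure w E \<le> weighted_measure w F"
  unfolding weighted_measure_def by (intro nn_integral_mono) (auto simp: indicator_def)

lemma ess_inf_mult_nn_integral_le:
  assumes [measurable]: "g \<in> borel_measurable lebesgue" "B \<in> sets lebesgue" and B: "B \<subseteq> Q"
  shows "ess_inf Q W * (\<integral>\<^sup>+x\<in>B. g x \<partial>lebesgue) \<le> (\<integral>\<^sup>+x\<in>B. g x * W x \<partial>lebesgue)"
proof -
  have "c * (\<integral>\<^sup>+x\<in>B. g x \<partial>lebesgue) \<le> (\<integral>\<^sup>+x\<in>B. g x * W x \<partial>lebesgue)"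
    if c: "AE x in lebesgue. x \<in> Q \<longrightarrow> c \<le> W x" for c
  proof -
    have "c * (\<integral>\<^sup>+x\<in>B. g x \<partial>lebesgue) = (\<integral>\<^sup>+x. c * (g x * indicator B x) \<partial>lebesgue)"
      by (rule nn_integral_cmult[symmetric]) measurable
    also have "\<dots> \<le> (\<integral>\<^sup>+x\<in>B. g x * W x \<partial>lebesgue)"
    proof (rule nn_integral_mono_AE)
      show "AE x in lebesgue. c * (g x * indicator B x) \<le> g x * W x * indicator B x"
        using c by eventually_elim (use B in \<open>auto simp: indicator_def mult.commute[of "g _"] intro: mult_right_mono\<close>)
    qed
    finally show ?thesis .
  qed
  moreover have "ess_inf Q W = (SUP c\<in>{c. AE x in lebesgue. x \<in> Q \<longrightarrow> c \<le> W x}. c)"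
    by (simp add: ess_inf_def)
  ultimately show ?thesis by (simp only: SUP_mult_right_ennreal) (auto intro!: SUP_least)
qed

lemma emeasure_lebesgue_cube:
  assumes "0 \<le> l"
  shows "emeasure lebesgue (cbox (a::real^'n::finite) (a + (\<chi> i. l))) = ennreal (l ^ CARD('n))"
proof -
  have "emeasure lebesgue (cbox a (a + (\<chi> i. l))) = ennreal (measure lborel (cbox a (a + (\<chi> i. l))))"
    by (simp, subst emeasure_eq_ennreal_measure) (auto simp: emeasure_lborel_cbox_eq)
  also have "measure lborel (cbox a (a + (\<chi> i. l))) = l ^ CARD('n)"
    using assms by (subst content_cbox_cart) (auto simp: interval_eq_empty_cart)
  finally show ?thesis .
qed

lemma cball_subset_cube:
  assumes "0 \<le> r"
  shows "cball (a::real^'n::finite) r \<subseteq> cbox (a - (\<chi> i. r)) ((a - (\<chi> i. r)) + (\<chi> i. 2 * r))"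
proof
  fix x assume x: "x \<in> cball a r"
  have "\<bar>x $ i - a $ i\<bar> \<le> r" for i
    using x component_le_norm_cart[of "x - a" i] by (simp add: dist_norm norm_minus_commute)
  then show "x \<in> cbox (a - (\<chi> i. r)) ((a - (\<chi> i. r)) + (\<chi> i. 2 * r))"
    by (simp add: mem_box_cart abs_le_iff algebra_simps)
qed

lemma emeasure_lebesgue_cball_le:
  assumes "0 \<le> r"
  shows "emeasure lebesgue (cball (a::real^'n::finite) r) \<le> ennreal ((2 * r) ^ CARD('n))"
proof -
  have "emeasure lebesgue (cball a r) \<le> emeasure lebesgue (cbox (a - (\<chi> i. r)) ((a - (\<chi> i. r)) + (\<chi> i. 2 * r)))"
    by (intro emeasure_mono cball_subset_cube assms) simp
  also have "\<dots> = ennreal ((2 * r) ^ CARD('n))" using assms by (intro emeasure_lebesgue_cube) simp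
  finally show ?thesis .
qed

text \<open>The ball enlarged five times, as the Vitali lemma requires, lies in a cube Q of side 10
  r. The A1 condition bounds w(Q) by |Q| times the essential infimum of w on Q, and this infimum
  times the integral of g over the small ball is at most the integral of g w there. Both sides carry
  a factor r^n that is cancelled only at the end, since division is delicate in
  \<open>ennreal\<close>.\<close>

lemma A1_ball_estimate:
  fixes w :: "real^'n::finite \<Rightarrow> real"
  assumes w: "w \<in> A1_weights"
  obtains C where "0 \<le> C"
    "\<And>g a r l. \<lbrakk>g \<in> borel_measurable lebesgue; 0 < r; 0 \<le> l;
       ennreal (l * r ^ CARD('n)) \<le> (\<integral>\<^sup>+x\<in>cball a r. g x \<partial>lebesgue)\<rbrakk> \<Longrightarrow>
     ennreal l * weighted_measure w (cball a (5 * r)) \<le> ennreal C * (\<integral>\<^sup>+x\<in>cball a r. g x * ennreal (w x) \<partial>lebesgue)"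
proof -
  obtain C0 :: real where C0: "\<And>Q. Q \<in> cubes \<Longrightarrow> average Q (\<lambda>x. ennreal (w x)) \<le> ennreal C0 * ess_inf Q (\<lambda>x. ennreal (w x))"
    using w by (auto simp: A1_weights_def)
  show ?thesis
  proof (rule that[of "max 0 C0 * 10 ^ CARD('n)"])
    fix g :: "real^'n \<Rightarrow> ennreal" and a :: "real^'n" and r l :: real
    assume g: "g \<in> borel_measurable lebesgue" and r: "0 < r" and l: "0 \<le> l"
      and le: "ennreal (l * r ^ CARD('n)) \<le> (\<integral>\<^sup>+x\<in>cball a r. g x \<partial>lebesgue)"
    define Q where "Q = cbox (a - (\<chi> i. 5 * r)) ((a - (\<chi> i. 5 * r)) + (\<chi> i. 2 * (5 * r)))"
    have Q: "Q \<in> cubes" using r unfolding Q_def cubes_def by (intro CollectI exI[of _ "a - (\<chi> i. 5 * r)"] exI[of _ "2 * (5 * r)"]) simp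
    have sub: "cball a (5 * r) \<subseteq> Q" unfolding Q_def using r by (intro cball_subset_cube) auto
    have sub': "cball a r \<subseteq> Q" using sub r by (meson dual_order.trans order_less_imp_le subset_cball mult_le_cancel_right1 order.asym one_le_numeral)
    let ?e = "ess_inf Q (\<lambda>x. ennreal (w x))" and ?G = "\<integral>\<^sup>+x\<in>cball a r. g x \<partial>lebesgue"
    have eQ: "emeasure lebesgue Q = ennreal ((10 * r) ^ CARD('n))"
      unfolding Q_def using r by (subst emeasure_lebesgue_cube) auto
    have eQ0: "emeasure lebesgue Q \<noteq> 0" "emeasure lebesgue Q \<noteq> \<infinity>" unfolding eQ using r by auto
    have "weighted_measure w (cball a (5 * r)) \<le> weighted_measure w Q" by (rule weighted_measure_mono[OF sub])
    also have "\<dots> = average Q (\<lambda>x. ennreal (w x)) * emeasure lebesgue Q"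
    proof -
      have "I / e * e = I" if "e \<noteq> 0" "e \<noteq> top" for I e :: ennreal
        using that by (metis ennreal_times_divide mult.commute mult_divide_eq_ennreal)
      then show ?thesis using eQ0 unfolding average_def weighted_measure_def by simp
    qed
    also have "\<dots> \<le> (ennreal (max 0 C0) * ?e) * ennreal ((10 * r) ^ CARD('n))"
      unfolding eQ by (intro mult_right_mono order_trans[OF C0[OF Q]]) (auto intro!: mult_right_mono ennreal_leI)
    finally have 1: "weighted_measure w (cball a (5 * r)) \<le> (ennreal (max 0 C0) * ?e) * ennreal ((10 * r) ^ CARD('n))" .
    have "ennreal (r ^ CARD('n)) * (ennreal l * weighted_measure w (cball a (5 * r))) =
        ennreal (l * r ^ CARD('n)) * weighted_measure w (cball a (5 * r))"
      using l r by (simp add: ennreal_mult mult_ac)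
    also have "\<dots> \<le> ?G * ((ennreal (max 0 C0) * ?e) * ennreal ((10 * r) ^ CARD('n)))"
      by (intro mult_mono le 1) auto
    also have "\<dots> = ennreal (max 0 C0) * ennreal ((10 * r) ^ CARD('n)) * (?e * ?G)" by (simp add: mult_ac)
    also have "\<dots> \<le> ennreal (max 0 C0) * ennreal ((10 * r) ^ CARD('n)) * (\<integral>\<^sup>+x\<in>cball a r. g x * ennreal (w x) \<partial>lebesgue)"
      by (intro mult_left_mono ess_inf_mult_nn_integral_le[OF g _ sub']) auto
    also have "\<dots> = ennreal (r ^ CARD('n)) * (ennreal (max 0 C0 * 10 ^ CARD('n)) * (\<integral>\<^sup>+x\<in>cball a r. g x * ennreal (w x) \<partial>lebesgue))"
      using r by (simp add: power_mult_distrib ennreal_mult mult_ac)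
    finally show "ennreal l * weighted_measure w (cball a (5 * r)) \<le>
        ennreal (max 0 C0 * 10 ^ CARD('n)) * (\<integral>\<^sup>+x\<in>cball a r. g x * ennreal (w x) \<partial>lebesgue)"
      using r by (subst (asm) ennreal_mult_le_mult_iff) auto
  qed auto
qed

text \<open>Weak type (1,1) by Vitali: disjoint balls are selected whose fivefold enlargements
  cover, the ball estimate is summed over them, and disjointness bounds the sum by one integral.
  Vitali needs bounded radii, so the radii are capped by k and the sets exhausted as k
  grows.\<close>

lemma super_balls_weak_1:
  fixes w :: "real^'n::finite \<Rightarrow> real"
  assumes w: "w \<in> A1_weights"
  obtains C where "0 \<le> C"
    "\<And>g l. \<lbrakk>g \<in> borel_measurable lebesgue; 0 < l\<rbrakk> \<Longrightarrow>
     ennreal l * weighted_measure w (super_balls g l) \<le> ennreal C * (\<integral>\<^sup>+x. g x * ennreal (w x) \<partial>lebesgue)"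
proof -
  obtain C where C: "0 \<le> C"
    "\<And>g a r l. \<lbrakk>g \<in> borel_measurable lebesgue; 0 < r; 0 \<le> l;
       ennreal (l * r ^ CARD('n)) \<le> (\<integral>\<^sup>+x\<in>cball a r. g x \<partial>lebesgue)\<rbrakk> \<Longrightarrow>
     ennreal l * weighted_measure w (cball a (5 * r)) \<le> ennreal C * (\<integral>\<^sup>+x\<in>cball a r. g x * ennreal (w x) \<partial>lebesgue)"
    by (rule A1_ball_estimate[OF w]) (rule that)
  have wt: "weight w" using w by (simp add: A1_weights_def)
  note [measurable] = weight_measurable[OF wt]
  show ?thesis
  proof (rule that[OF C(1)])
    fix g :: "real^'n \<Rightarrow> ennreal" and l :: real
    assume g [measurable]: "g \<in> borel_measurable lebesgue" and l: "0 < l"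
    let ?G = "\<integral>\<^sup>+x. g x * ennreal (w x) \<partial>lebesgue"
    define K where "K k = {(a, r). 0 < r \<and> r \<le> real k \<and> ennreal (l * r ^ CARD('n)) < (\<integral>\<^sup>+x\<in>cball a r. g x \<partial>lebesgue)}" for k
    define S where "S k = (\<Union>(a, r)\<in>K k. ball a r)" for k
    have oS: "open (S k)" for k unfolding S_def by (rule open_UN) (simp add: case_prod_unfold)
    have SU: "super_balls g l = (\<Union>k. S k)"
    proof -
      have "{(a, r). 0 < r \<and> ennreal (l * r ^ CARD('n)) < (\<integral>\<^sup>+x\<in>cball a r. g x \<partial>lebesgue)} = (\<Union>k. K k)"
      proof (rule set_eqI)
        fix z :: "(real^'n) \<times> real"
        obtain k where "snd z \<le> real k" using real_arch_simple by blast
        then show "z \<in> {(a, r). 0 < r \<and> ennreal (l * r ^ CARD('n)) < (\<integral>\<^sup>+x\<in>cball a r. g x \<partial>lebesgue)} \<longleftrightarrow> z \<in> (\<Union>k. K k)"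
          unfolding K_def by (cases z) auto
      qed
      then show ?thesis unfolding super_balls_def S_def by (simp only: UN_UN_flatten)
    qed
    have inc: "incseq S" unfolding incseq_def
    proof (intro allI impI)
      fix m n :: nat assume "m \<le> n"
      then have "real m \<le> real n" by simp
      then have "K m \<subseteq> K n" unfolding K_def by (intro Collect_mono) auto
      then show "S m \<subseteq> S n" unfolding S_def by (rule UN_mono) simp
    qed
    have bound: "ennreal l * emeasure (weighted w) (S k) \<le> ennreal C * ?G" for k
    proof -
      have "S k \<subseteq> (\<Union>i\<in>K k. cball (fst i) (snd i))" unfolding S_def
        by (rule UN_mono[OF order_refl]) (simp add: case_prod_unfold ball_subset_cball)
      then obtain D where D: "countable D" "D \<subseteq> K k"
        "pairwise (\<lambda>i j. disjnt (cball (fst i) (snd i)) (cball (fst j) (snd j))) D"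
        "S k \<subseteq> (\<Union>i\<in>D. cball (fst i) (5 * snd i))"
      proof (rule Vitali_covering_lemma_cballs)
        show "0 < snd i \<and> snd i \<le> real k" if "i \<in> K k" for i
          using that unfolding K_def by (cases i) simp
      qed (rule that)
      have "emeasure (weighted w) (S k) = (\<integral>\<^sup>+x. ennreal (w x) * indicator (S k) x \<partial>lebesgue)"
        using oS[of k] by (intro emeasure_density) auto
      \<comment> \<open>The sum over the countable family is written as an integral over a counting
        measure, so that it can be exchanged with the integral in x.\<close>
      also have "\<dots> \<le> (\<integral>\<^sup>+x. \<integral>\<^sup>+i. ennreal (w x) * indicator (cball (fst i) (5 * snd i)) x \<partial>count_space D \<partial>lebesgue)"
      proof (rule nn_integral_mono)
        fix x
        show "ennreal (w x) * indicator (S k) x \<le> (\<integral>\<^sup>+i. ennreal (w x) * indicator (cball (fst i) (5 * snd i)) x \<partial>count_space D)"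
        proof (cases "x \<in> S k")
          case True
          then obtain i where i: "i \<in> D" "x \<in> cball (fst i) (5 * snd i)" using D(4) by blast
          then show ?thesis
            using nn_integral_ge_point[OF i(1), of "\<lambda>i. ennreal (w x) * indicator (cball (fst i) (5 * snd i)) x"] True by simp
        qed simp
      qed
      also have "\<dots> = (\<integral>\<^sup>+i. \<integral>\<^sup>+x. ennreal (w x) * indicator (cball (fst i) (5 * snd i)) x \<partial>lebesgue \<partial>count_space D)"
      proof (rule nn_integral_count_space_nn_integral[OF D(1)])
        fix i :: "(real^'n) \<times> real"
        have [measurable]: "cball (fst i) (5 * snd i) \<in> sets lebesgue" by simp
        show "(\<lambda>x. ennreal (w x) * indicator (cball (fst i) (5 * snd i)) x) \<in> borel_measurable lebesgue" by measurable
      qed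
      finally have "ennreal l * emeasure (weighted w) (S k) \<le>
          ennreal l * (\<integral>\<^sup>+i. weighted_measure w (cball (fst i) (5 * snd i)) \<partial>count_space D)"
        unfolding weighted_measure_def by (rule mult_left_mono) simp
      also have "\<dots> = (\<integral>\<^sup>+i. ennreal l * weighted_measure w (cball (fst i) (5 * snd i)) \<partial>count_space D)"
        by (rule nn_integral_cmult[symmetric]) simp
      also have "\<dots> \<le> (\<integral>\<^sup>+i. ennreal C * emeasure (density lebesgue (\<lambda>x. g x * ennreal (w x))) (cball (fst i) (snd i)) \<partial>count_space D)"
      proof (rule nn_integral_mono)
        fix i assume "i \<in> space (count_space D)"
        then have "i \<in> K k" using D(2) by auto
        then have "0 < snd i" "ennreal (l * snd i ^ CARD('n)) \<le> (\<integral>\<^sup>+x\<in>cball (fst i) (snd i). g x \<partial>lebesgue)"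
          by (auto simp: K_def)
        from C(2)[OF g this(1) _ this(2)] l
        show "ennreal l * weighted_measure w (cball (fst i) (5 * snd i)) \<le>
            ennreal C * emeasure (density lebesgue (\<lambda>x. g x * ennreal (w x))) (cball (fst i) (snd i))"
          by (subst emeasure_density) auto
      qed
      also have "\<dots> = ennreal C * (\<integral>\<^sup>+i. emeasure (density lebesgue (\<lambda>x. g x * ennreal (w x))) (cball (fst i) (snd i)) \<partial>count_space D)"
        by (rule nn_integral_cmult) simp
      also have "(\<integral>\<^sup>+i. emeasure (density lebesgue (\<lambda>x. g x * ennreal (w x))) (cball (fst i) (snd i)) \<partial>count_space D) =
          emeasure (density lebesgue (\<lambda>x. g x * ennreal (w x))) (\<Union>i\<in>D. cball (fst i) (snd i))"
        using D(1,3) by (intro emeasure_UN_countable[symmetric]) (auto simp: disjoint_family_on_def pairwise_def disjnt_def)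
      also have "\<dots> \<le> emeasure (density lebesgue (\<lambda>x. g x * ennreal (w x))) (space lebesgue)"
        by (rule emeasure_mono) auto
      also have "\<dots> = ?G" by (subst emeasure_density) auto
      finally show ?thesis by (simp add: mult_left_mono)
    qed
    have "ennreal l * weighted_measure w (super_balls g l) = ennreal l * emeasure (weighted w) (\<Union>k. S k)"
    proof -
      have "open (\<Union>k. S k)" using oS by blast
      then have "(\<Union>k. S k) \<in> sets lebesgue" by auto
      then show ?thesis unfolding SU by (simp only: weighted_measure_eq_emeasure[OF wt])
    qed
    also have "\<dots> = ennreal l * (SUP k. emeasure (weighted w) (S k))"
    proof -
      have "range S \<subseteq> sets (weighted w)" using oS by auto
      then show ?thesis using inc by (simp only: SUP_emeasure_incseq)
    qed
    also have "\<dots> = (SUP k. ennreal l * emeasure (weighted w) (S k))"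
      by (rule SUP_mult_left_ennreal)
    also have "\<dots> \<le> ennreal C * ?G" by (rule SUP_least) (rule bound)
    finally show "ennreal l * weighted_measure w (super_balls g l) \<le> ennreal C * ?G" .
  qed
qed

text \<open>Decompose into levels where g lies between 2^k l and 2^(k+1) l. The tail bound makes the
  k-th contribution a multiple of (2^(1-q))^k, which is summable because q > 1.\<close>

lemma nn_integral_truncation:
  fixes g :: "'a \<Rightarrow> ennreal"
  assumes [measurable]: "g \<in> borel_measurable M" and q: "1 < q" and A: "0 \<le> A" and l: "0 < l"
    and tail: "\<And>s. 0 < s \<Longrightarrow> emeasure M {x\<in>space M. g x > ennreal s} \<le> ennreal (A * s powr - q)"
  shows "(\<integral>\<^sup>+x. g x * indicator {x. g x > ennreal l} x \<partial>M) \<le> ennreal (2 / (1 - 2 powr (1 - q)) * A * l powr (1 - q))"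
proof -
  \<comment> \<open>The dyadic levels do not see the points where g is infinite; letting s tend to
    infinity in the tail bound shows that they form a null set.\<close>
  have AEfin: "AE x in M. g x \<noteq> \<infinity>"
  proof -
    let ?N = "{x\<in>space M. g x = \<infinity>}"
    have "emeasure M ?N \<le> ennreal (A * s powr - q)" if "0 < s" for s
      by (rule order_trans[OF emeasure_mono tail[OF that]]) (auto simp: less_top)
    moreover have "((\<lambda>s::real. ennreal (A * s powr - q)) \<longlongrightarrow> ennreal (A * 0)) at_top"
      using q by (intro tendsto_intros tendsto_ennrealI tendsto_neg_powr filterlim_ident) auto
    ultimately have "emeasure M ?N \<le> ennreal (A * 0)"
      by (intro tendsto_lowerbound[of _ _ at_top]) (auto intro: eventually_mono[OF eventually_gt_at_top[of 0]])
    then have "?N \<in> null_sets M" by (intro null_setsI) auto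
    then show ?thesis by (rule AE_I') auto
  qed
  have "(\<integral>\<^sup>+x. g x * indicator {x. g x > ennreal l} x \<partial>M) \<le>
      (\<integral>\<^sup>+x. (\<Sum>k. ennreal (2 ^ Suc k * l) * indicator {x\<in>space M. g x > ennreal (2 ^ k * l)} x) \<partial>M)"
  proof (rule nn_integral_mono_AE)
    show "AE x in M. g x * indicator {x. g x > ennreal l} x \<le>
        (\<Sum>k. ennreal (2 ^ Suc k * l) * indicator {x\<in>space M. g x > ennreal (2 ^ k * l)} x)"
      using AEfin AE_space
    proof eventually_elim
      case (elim x)
      show ?case
      proof (cases "g x > ennreal l")
        case True
        obtain t where t: "0 \<le> t" "g x = ennreal t" using elim by (cases "g x") auto
        have lt: "l < t" using True t l by (simp add: ennreal_less_iff)
        obtain m where "t / l < 2 ^ m" using real_arch_pow[of 2 "t / l"] by auto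
        then have ex: "\<exists>m. t \<le> 2 ^ m * l" using l by (auto simp: field_simps intro: less_imp_le)
        define k where "k = (LEAST m. t \<le> 2 ^ m * l)"
        have k: "t \<le> 2 ^ k * l" unfolding k_def by (rule LeastI_ex[OF ex])
        have "k \<noteq> 0" using k lt by (intro notI) simp
        then obtain j where j: "k = Suc j" by (cases k) auto
        have jt: "2 ^ j * l < t" using not_less_Least[of j "\<lambda>m. t \<le> 2 ^ m * l"] j by (simp add: k_def)
        have "g x * indicator {x. g x > ennreal l} x \<le> ennreal (2 ^ Suc j * l)"
          using True k t by (simp add: j ennreal_leI)
        also have "\<dots> = ennreal (2 ^ Suc j * l) * indicator {x\<in>space M. g x > ennreal (2 ^ j * l)} x"
          using jt t l elim by (simp add: ennreal_less_iff)
        also have "\<dots> \<le> (\<Sum>k. ennreal (2 ^ Suc k * l) * indicator {x\<in>space M. g x > ennreal (2 ^ k * l)} x)"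
        proof -
          have "F j \<le> suminf F" for F :: "nat \<Rightarrow> ennreal"
            using sum_le_suminf[OF summableI, of "{j}" F] by simp
          then show ?thesis .
        qed
        finally show ?thesis .
      qed simp
    qed
  qed
  also have "\<dots> = (\<Sum>k. ennreal (2 ^ Suc k * l) * emeasure M {x\<in>space M. g x > ennreal (2 ^ k * l)})"
    by (subst nn_integral_suminf) (simp_all add: nn_integral_cmult_indicator)
  also have "\<dots> \<le> (\<Sum>k. ennreal (2 * A * l powr (1 - q) * (2 powr (1 - q)) ^ k))"
  proof (rule suminf_le)
    fix k
    have "ennreal (2 ^ Suc k * l) * emeasure M {x\<in>space M. g x > ennreal (2 ^ k * l)} \<le>
        ennreal (2 ^ Suc k * l) * ennreal (A * (2 ^ k * l) powr - q)"
      using l by (intro mult_left_mono tail) auto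
    also have "\<dots> = ennreal (2 * A * l powr (1 - q) * (2 powr (1 - q)) ^ k)"
    proof -
      have "2 ^ Suc k * l * (A * (2 ^ k * l) powr - q) = 2 * A * ((2 ^ k * l) powr 1 * (2 ^ k * l) powr - q)"
        using l by simp
      also have "\<dots> = 2 * A * (2 ^ k * l) powr (1 - q)" by (subst powr_add[symmetric]) simp
      also have "(2 ^ k * l) powr (1 - q) = (2 powr (1 - q)) ^ k * l powr (1 - q)"
        using l by (simp add: powr_mult powr_powr powr_realpow[symmetric] mult.commute)
      finally show ?thesis using l A by (simp add: ennreal_mult[symmetric] mult_ac)
    qed
    finally show "ennreal (2 ^ Suc k * l) * emeasure M {x\<in>space M. g x > ennreal (2 ^ k * l)} \<le>
        ennreal (2 * A * l powr (1 - q) * (2 powr (1 - q)) ^ k)" .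
  qed (auto intro: summableI)
  also have "\<dots> = ennreal (2 * A * l powr (1 - q) * (1 / (1 - 2 powr (1 - q))))"
  proof -
    have "2 powr (1 - q) < 2 powr 0" using q by (intro powr_less_mono) auto
    then have "(\<lambda>k. (2 powr (1 - q)) ^ k) sums (1 / (1 - 2 powr (1 - q)))" by (intro geometric_sums) auto
    then have "(\<lambda>k. 2 * A * l powr (1 - q) * (2 powr (1 - q)) ^ k) sums (2 * A * l powr (1 - q) * (1 / (1 - 2 powr (1 - q))))"
      by (rule sums_mult)
    then show ?thesis using A by (intro suminf_ennreal_eq) auto
  qed
  finally show ?thesis by (simp add: mult_ac)
qed

text \<open>Marcinkiewicz truncation: values of g below a small multiple l' of l contribute at most
  half of l r^n on any ball. So a ball counted for g at level l is counted for the truncated g at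
  level l/2, to which weak type (1,1) applies.\<close>

lemma super_balls_weak:
  fixes w :: "real^'n::finite \<Rightarrow> real"
  assumes w: "w \<in> A1_weights" and q: "1 < q"
  obtains C where "0 \<le> C"
    "\<And>g A l. \<lbrakk>g \<in> borel_measurable lebesgue; 0 \<le> A; 0 < l;
       \<And>s. 0 < s \<Longrightarrow> weighted_measure w {x. g x > ennreal s} \<le> ennreal (A * s powr - q)\<rbrakk> \<Longrightarrow>
     weighted_measure w (super_balls g l) \<le> ennreal (C * A * l powr - q)"
proof -
  obtain C where C: "0 \<le> C"
    "\<And>g l. \<lbrakk>g \<in> borel_measurable lebesgue; 0 < l\<rbrakk> \<Longrightarrow>
     ennreal l * weighted_measure w (super_balls g l) \<le> ennreal C * (\<integral>\<^sup>+x. g x * ennreal (w x) \<partial>lebesgue)"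
    by (rule super_balls_weak_1[OF w]) (rule that)
  have wt: "weight w" using w by (simp add: A1_weights_def)
  note [measurable] = weight_measurable[OF wt]
  define T where "T = 2 / (1 - 2 powr (1 - q))"
  have T: "0 \<le> T"
  proof -
    have "2 powr (1 - q) \<le> 2 powr 0" using q by (intro powr_mono) auto
    then show ?thesis by (simp add: T_def)
  qed
  define D where "D = 2 * C * T * (2 * 2 ^ CARD('n)) powr (q - 1)"
  show ?thesis
  proof (rule that[of D])
    show "0 \<le> D" using C(1) T by (simp add: D_def)
    fix g :: "real^'n \<Rightarrow> ennreal" and A l :: real
    assume g [measurable]: "g \<in> borel_measurable lebesgue" and A: "0 \<le> A" and l: "0 < l"
      and tail: "\<And>s. 0 < s \<Longrightarrow> weighted_measure w {x. g x > ennreal s} \<le> ennreal (A * s powr - q)"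
    \<comment> \<open>Since a ball of radius r has volume at most (2 r)^n, the part of g below l'
      integrates to at most l' (2 r)^n = (l/2) r^n.\<close>
    define l' where "l' = l / (2 * 2 ^ CARD('n))"
    have l': "0 < l'" using l by (simp add: l'_def)
    let ?g = "\<lambda>x. g x * indicator {x. g x > ennreal l'} x"
    have "{x\<in>space lebesgue. ennreal l' < g x} \<in> sets lebesgue" by measurable
    then have [measurable]: "{x. ennreal l' < g x} \<in> sets lebesgue" by simp
    have sub: "super_balls g l \<subseteq> super_balls ?g (l / 2)"
    proof -
      have "ennreal (l / 2 * r ^ CARD('n)) < (\<integral>\<^sup>+x\<in>cball a r. ?g x \<partial>lebesgue)"
        if r: "0 < r" and a: "ennreal (l * r ^ CARD('n)) < (\<integral>\<^sup>+x\<in>cball a r. g x \<partial>lebesgue)" for a r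
      proof (rule ccontr)
        assume "\<not> ?thesis"
        then have le: "(\<integral>\<^sup>+x\<in>cball a r. ?g x \<partial>lebesgue) \<le> ennreal (l / 2 * r ^ CARD('n))" by simp
        have "(\<integral>\<^sup>+x\<in>cball a r. g x \<partial>lebesgue) \<le> (\<integral>\<^sup>+x. ?g x * indicator (cball a r) x + ennreal l' * indicator (cball a r) x \<partial>lebesgue)"
          by (rule nn_integral_mono) (auto simp: indicator_def not_less)
        also have "\<dots> = (\<integral>\<^sup>+x\<in>cball a r. ?g x \<partial>lebesgue) + ennreal l' * emeasure lebesgue (cball a r)"
        proof -
          have [measurable]: "cball a r \<in> sets lebesgue" by simp
          have "(\<integral>\<^sup>+x. ?g x * indicator (cball a r) x + ennreal l' * indicator (cball a r) x \<partial>lebesgue) =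
              (\<integral>\<^sup>+x\<in>cball a r. ?g x \<partial>lebesgue) + (\<integral>\<^sup>+x. ennreal l' * indicator (cball a r) x \<partial>lebesgue)"
            by (rule nn_integral_add) measurable
          then show ?thesis by (simp add: nn_integral_cmult_indicator)
        qed
        also have "\<dots> \<le> ennreal (l / 2 * r ^ CARD('n)) + ennreal l' * ennreal ((2 * r) ^ CARD('n))"
          using r by (intro add_mono le mult_left_mono emeasure_lebesgue_cball_le) auto
        also have "\<dots> = ennreal (l * r ^ CARD('n))"
          using l r by (simp add: ennreal_mult[symmetric] ennreal_plus[symmetric] l'_def power_mult_distrib del: ennreal_plus)
        finally show False using a by simp
      qed
      then show ?thesis unfolding super_balls_def by fast
    qed
    have "ennreal (l / 2) * weighted_measure w (super_balls g l) \<le> ennreal (l / 2) * weighted_measure w (super_balls ?g (l / 2))"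
      by (intro mult_left_mono weighted_measure_mono sub) auto
    also have "\<dots> \<le> ennreal C * (\<integral>\<^sup>+x. ?g x * ennreal (w x) \<partial>lebesgue)"
      using l by (intro C(2)) auto
    also have "(\<integral>\<^sup>+x. ?g x * ennreal (w x) \<partial>lebesgue) = (\<integral>\<^sup>+x. ?g x \<partial>weighted w)"
      by (subst nn_integral_density) (auto simp: mult.commute)
    also have "\<dots> \<le> ennreal (2 / (1 - 2 powr (1 - q)) * A * l' powr (1 - q))"
    proof (rule nn_integral_truncation[OF _ q A l'])
      fix s :: real assume "0 < s"
      show "emeasure (weighted w) {x\<in>space (weighted w). ennreal s < g x} \<le> ennreal (A * s powr - q)"
      proof -
        have "{x\<in>space lebesgue. ennreal s < g x} \<in> sets lebesgue" by measurable
        then have "{x. ennreal s < g x} \<in> sets lebesgue" by simp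
        from weighted_measure_eq_emeasure[OF wt this] tail[OF \<open>0 < s\<close>] show ?thesis by simp
      qed
    qed simp
    finally have "ennreal (l / 2) * weighted_measure w (super_balls g l) \<le> ennreal C * ennreal (T * A * l' powr (1 - q))"
      unfolding T_def by (simp add: mult_left_mono)
    also have "\<dots> = ennreal (l / 2) * ennreal (D * A * l powr - q)"
    proof -
      have "l' powr (1 - q) = l powr (1 - q) * (2 * 2 ^ CARD('n)) powr (q - 1)"
        unfolding l'_def using l powr_minus_divide[of "2 * 2 ^ CARD('n)" "1 - q"] by (simp add: powr_divide)
      moreover have "l powr (1 - q) = l * l powr - q" using l powr_add[of l 1 "- q"] by simp
      ultimately show ?thesis using l C(1) T A
        by (simp add: ennreal_mult[symmetric] D_def)
    qed
    finally show "weighted_measure w (super_balls g l) \<le> ennreal (D * A * l powr - q)"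
      using l by (subst (asm) ennreal_mult_le_mult_iff) auto
  qed
qed

section \<open>The kernel estimate at unit scale\<close>

lemma deriv_bound_translate:
  fixes f :: "real^'n::finite \<Rightarrow> complex"
  assumes "deriv_bound m b f" shows "deriv_bound m (\<lambda>x. b (x - v)) (\<lambda>x. f (x - v))"
  using deriv_bound_affine[OF assms, of 1 "- v"] by simp

lemma schwartz_translate: "f \<in> schwartz \<Longrightarrow> (\<lambda>x. f (x - v)) \<in> schwartz"
  using schwartz_affine[of f 1 "- v"] by simp

text \<open>The family whose integral over v is the convolution of g and \<psi>. Decay in v comes
  from g, with surplus t = |s| to pay for the translation in \<psi>.\<close>

lemma schwartz_family_convolution:
  fixes g \<psi> :: "real^'n::finite \<Rightarrow> complex"
  assumes g: "g \<in> schwartz" and \<psi>: "\<psi> \<in> schwartz"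
  shows "schwartz_family (\<lambda>v s. g v * \<psi> (s - v))"
  unfolding schwartz_family_def
proof (intro conjI allI)
  show "jointly_continuous (\<lambda>v s. g v * \<psi> (s - v))"
    using smooth_continuous[OF schwartz_smooth[OF g], of UNIV "[]"]
    by (intro jointly_continuous_mult jointly_continuous_scalar jointly_continuous_translate schwartz_smooth \<psi>) simp
  fix m and s :: real
  define t where "t = \<bar>s\<bar>"
  obtain C1 where C1: "0 \<le> C1" "deriv_bound m (\<lambda>x. C1 * wt (- t) x) \<psi>" using \<psi> by (rule schwartzE)
  obtain C2 where C2: "0 \<le> C2" "deriv_bound 0 (\<lambda>x. C2 * wt (- (real CARD('n) + 1 + t)) x) g" using g by (rule schwartzE)
  have "deriv_bound m (\<lambda>x. C2 * C1 * wt (- (real CARD('n) + 1)) z * wt (- s) x) (\<lambda>x. g z * \<psi> (x - z))" for z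
  proof (rule deriv_bound_mono[OF deriv_bound_cmult[OF deriv_bound_translate[OF C1(2)]]])
    fix x
    have "wt (- t) (x - z) \<le> wt (- t) x * wt t z"
      using wt_peetre_minus[of t x "- z"] by (simp add: t_def)
    also have "\<dots> \<le> wt (- s) x * wt t z" by (intro mult_right_mono wt_mono) (auto simp: t_def)
    finally have 1: "wt (- t) (x - z) \<le> wt (- s) x * wt t z" .
    have "cmod (g z) * (C1 * wt (- t) (x - z)) \<le> (C2 * wt (- (real CARD('n) + 1 + t)) z) * (C1 * (wt (- s) x * wt t z))"
      using deriv_bound_zero(2)[OF C2(2), of z] C1(1) C2(1) 1 by (intro mult_mono) auto
    also have "- (real CARD('n) + 1 + t) = - (real CARD('n) + 1) + - t" by simp
    also have "(C2 * wt (- (real CARD('n) + 1) + - t) z) * (C1 * (wt (- s) x * wt t z)) =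
        C2 * C1 * wt (- (real CARD('n) + 1)) z * wt (- s) x"
      unfolding wt_add[of "- (real CARD('n) + 1)"] wt_minus[of t] by simp
    finally show "cmod (g z) * (C1 * wt (- t) (x - z)) \<le> C2 * C1 * wt (- (real CARD('n) + 1)) z * wt (- s) x" .
  qed auto
  then show "\<exists>C\<ge>0. \<forall>z. deriv_bound m (\<lambda>x. C * wt (- (real CARD('n) + 1)) z * wt (- s) x) (\<lambda>x. g z * \<psi> (x - z))"
    using C1(1) C2(1) by (intro exI[of _ "C2 * C1"]) simp
qed

text \<open>Here the decay in z has to come from \<gamma>, through the symmetric form of Peetre's
  inequality; the polynomial in x that this costs is absorbed by \<Phi>.\<close>

lemma schwartz_family_localization:
  fixes \<Phi> \<gamma> :: "real^'n::finite \<Rightarrow> complex"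
  assumes \<Phi>: "\<Phi> \<in> schwartz" and \<gamma>: "\<gamma> \<in> schwartz"
  shows "schwartz_family (\<lambda>z x. \<Phi> x * \<gamma> (x - z))"
  unfolding schwartz_family_def
proof (intro conjI allI)
  show "jointly_continuous (\<lambda>z x. \<Phi> x * \<gamma> (x - z))"
    by (intro jointly_continuous_mult jointly_continuous_const jointly_continuous_translate schwartz_smooth \<Phi> \<gamma>)
  fix m and s :: real
  let ?t = "real CARD('n) + 1"
  obtain C1 where C1: "0 \<le> C1" "deriv_bound m (\<lambda>x. C1 * wt (- ?t) x) \<gamma>" using \<gamma> by (rule schwartzE)
  obtain C2 where C2: "0 \<le> C2" "deriv_bound m (\<lambda>x. C2 * wt (- (s + ?t)) x) \<Phi>" using \<Phi> by (rule schwartzE)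
  have "deriv_bound m (\<lambda>x. 2 ^ m * C2 * C1 * wt (- ?t) z * wt (- s) x) (\<lambda>x. \<Phi> x * \<gamma> (x - z))" for z
  proof (rule deriv_bound_mono[OF deriv_bound_mult[OF C2(2) deriv_bound_translate[OF C1(2)]]])
    fix x
    have "wt (- ?t) (x - z) = wt (- ?t) (z - x)" by (rule wt_norm_cong) (rule norm_minus_commute)
    also have "\<dots> \<le> wt (- ?t) z * wt ?t x" using wt_peetre_minus[of ?t z "- x"] by simp
    finally have 1: "wt (- ?t) (x - z) \<le> wt (- ?t) z * wt ?t x" .
    have "2 ^ m * (C2 * wt (- (s + ?t)) x * (C1 * wt (- ?t) (x - z))) \<le>
        2 ^ m * (C2 * wt (- (s + ?t)) x * (C1 * (wt (- ?t) z * wt ?t x)))"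
      using C1(1) C2(1) 1 by (intro mult_left_mono) auto
    also have "\<dots> = 2 ^ m * C2 * C1 * wt (- ?t) z * wt (- s) x"
    proof -
      have "wt (- (s + ?t)) x * wt ?t x = wt (- s) x" by (simp add: wt_add[symmetric])
      then have "2 ^ m * C2 * C1 * wt (- ?t) z * (wt (- (s + ?t)) x * wt ?t x) = 2 ^ m * C2 * C1 * wt (- ?t) z * wt (- s) x"
        by (simp only:)
      then show ?thesis by (simp only: mult_ac)
    qed
    finally show "2 ^ m * (C2 * wt (- (s + ?t)) x * (C1 * wt (- ?t) (x - z))) \<le> 2 ^ m * C2 * C1 * wt (- ?t) z * wt (- s) x" .
  qed auto
  then show "\<exists>C\<ge>0. \<forall>z. deriv_bound m (\<lambda>x. C * wt (- (real CARD('n) + 1)) z * wt (- s) x) (\<lambda>x. \<Phi> x * \<gamma> (x - z))"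
    using C1(1) C2(1) by (intro exI[of _ "2 ^ m * C2 * C1"]) simp
qed

lemma schwartz_integrable_wt:
  fixes f :: "real^'n::finite \<Rightarrow> complex"
  assumes "f \<in> schwartz" shows "integrable lborel (\<lambda>x. wt s x *\<^sub>R f x)"
proof -
  obtain C where C: "0 \<le> C" "deriv_bound 0 (\<lambda>x. C * wt (- (s + (real CARD('n) + 1))) x) f" using assms by (rule schwartzE)
  have i: "integrable lborel (\<lambda>x::real^'n. C * wt (- (real CARD('n) + 1)) x)"
    by (intro integrable_mult_right integrable_wt) simp
  show ?thesis
  proof (rule Bochner_Integration.integrable_bound[OF i])
    have "continuous_on UNIV f" using smooth_continuous[OF schwartz_smooth[OF assms], of UNIV "[]"] by simp
    then show "(\<lambda>x. wt s x *\<^sub>R f x) \<in> borel_measurable lborel"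
      by (auto intro!: borel_measurable_continuous_onI continuous_intros)
    show "AE x in lborel. norm (wt s x *\<^sub>R f x) \<le> norm (C * wt (- (real CARD('n) + 1)) x)"
    proof (rule AE_I2)
      fix x :: "real^'n"
      have "norm (wt s x *\<^sub>R f x) \<le> wt s x * (C * wt (- (s + (real CARD('n) + 1))) x)"
        using deriv_bound_zero(2)[OF C(2), of x] by (simp add: mult_left_mono)
      also have "\<dots> = C * wt (- (real CARD('n) + 1)) x"
        by (simp add: wt_add[symmetric] mult.left_commute[of _ C])
      finally show "norm (wt s x *\<^sub>R f x) \<le> norm (C * wt (- (real CARD('n) + 1)) x)" using C(1) by simp
    qed
  qed
qed

lemma schwartz_integrable: "f \<in> schwartz \<Longrightarrow> integrable lborel f"
  using schwartz_integrable_wt[of f 0] by simp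

text \<open>Meant for g built from the kernel, with bounded derivatives but insufficient decay;
  integrability in v rests on \<psi>.\<close>

lemma dom_family_convolution:
  fixes g \<psi> :: "real^'n::finite \<Rightarrow> complex"
  assumes \<psi>: "\<psi> \<in> schwartz" and g: "\<And>m. \<exists>B. deriv_bound m (\<lambda>_. B) g"
  shows "dom_family (\<lambda>v s. \<psi> v * g (s - v))"
  unfolding dom_family_def
proof (intro conjI allI)
  fix m
  obtain B where B: "deriv_bound m (\<lambda>_. B) g" using g by blast
  have "integrable lborel (\<lambda>v. cmod (\<psi> v) * B)" using schwartz_integrable[OF \<psi>] by simp
  moreover have "deriv_bound m (\<lambda>_. cmod (\<psi> v) * B) (\<lambda>s. \<psi> v * g (s - v))" for v
    by (rule deriv_bound_cmult[OF deriv_bound_translate[OF B]])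
  ultimately show "\<exists>b. integrable lborel b \<and> (\<forall>z. deriv_bound m (\<lambda>_. b z) (\<lambda>s. \<psi> z * g (s - z)))" by blast
next
  fix \<alpha> x
  have "smooth g" using g unfolding smooth_iff by blast
  then show "(\<lambda>z. iter_deriv \<alpha> (\<lambda>s. \<psi> z * g (s - z)) x) \<in> borel_measurable borel"
    using smooth_continuous[OF schwartz_smooth[OF \<psi>], of UNIV "[]"]
    by (intro jointly_continuous_measurable jointly_continuous_mult jointly_continuous_scalar jointly_continuous_translate) simp_all
qed

text \<open>By Peetre's inequality the decay of g survives averaging over translates, the price
  being a weighted L^1 norm of \<psi>. This keeps the regularisation error at the same decay
  rate.\<close>

lemma deriv_bound_convolution:
  fixes g \<psi> :: "real^'n::finite \<Rightarrow> complex"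
  assumes \<psi>: "\<psi> \<in> schwartz" and g: "\<And>m. \<exists>B. deriv_bound m (\<lambda>_. B) g"
    and gB: "deriv_bound m (\<lambda>x. B * wt (- a) x) g" and a: "0 \<le> a"
  shows "deriv_bound m (\<lambda>x. (\<integral>v. wt a v * cmod (\<psi> v) \<partial>lborel) * B * wt (- a) x) (\<lambda>s. \<integral>v. \<psi> v * g (s - v) \<partial>lborel)"
  unfolding deriv_bound_def
proof (intro allI impI conjI)
  note dom = dom_family_convolution[OF \<psi> g]
  have sg: "smooth g" using g unfolding smooth_iff by blast
  fix \<alpha> :: "'n list" and x assume \<alpha>: "length \<alpha> \<le> m"
  show "iter_deriv \<alpha> (\<lambda>s. \<integral>v. \<psi> v * g (s - v) \<partial>lborel) differentiable at x"
    by (rule smooth_differentiable[OF iter_deriv_dom_family(1)[OF dom]])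
  have B0: "0 \<le> B"
  proof -
    have "0 \<le> B * wt (- a) (0::real^'n)" using deriv_bound_zero(2)[OF gB, of 0] norm_ge_zero[of "g 0"] by linarith
    then show ?thesis by (metis wt_pos mult_neg_pos not_le)
  qed
  have i: "integrable lborel (\<lambda>v. wt a v * cmod (\<psi> v))"
    using integrable_norm[OF schwartz_integrable_wt[OF \<psi>, of a]] by simp
  have e: "iter_deriv \<alpha> (\<lambda>s. \<psi> v * g (s - v)) x = \<psi> v * iter_deriv \<alpha> g (x - v)" for v
    using iter_deriv_cmult[OF smooth_affine[OF sg, of 1 "- v"], of \<alpha> "\<psi> v"] iter_deriv_affine[OF sg, of \<alpha> 1 "- v"] by simp
  have "norm (\<integral>v. iter_deriv \<alpha> (\<lambda>s. \<psi> v * g (s - v)) x \<partial>lborel) \<le> (\<integral>v. (wt a v * cmod (\<psi> v)) * (B * wt (- a) x) \<partial>lborel)"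
  proof (rule integral_norm_le[OF dom_family_integrable[OF dom]])
    show "integrable lborel (\<lambda>v. (wt a v * cmod (\<psi> v)) * (B * wt (- a) x))" using i by (rule integrable_mult_left)
    fix v
    have "cmod (iter_deriv \<alpha> g (x - v)) \<le> B * wt (- a) (x - v)" by (rule deriv_boundD(2)[OF gB \<alpha>])
    also have "\<dots> \<le> B * (wt (- a) x * wt a v)"
      using wt_peetre_minus[OF a, of x "- v"] B0 by (intro mult_left_mono) auto
    finally have "cmod (\<psi> v) * cmod (iter_deriv \<alpha> g (x - v)) \<le> cmod (\<psi> v) * (B * (wt (- a) x * wt a v))"
      by (rule mult_left_mono) simp
    then show "norm (iter_deriv \<alpha> (\<lambda>s. \<psi> v * g (s - v)) x) \<le> (wt a v * cmod (\<psi> v)) * (B * wt (- a) x)"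
      unfolding e norm_mult by (simp add: mult_ac)
  qed
  also have "\<dots> = (\<integral>v. wt a v * cmod (\<psi> v) \<partial>lborel) * (B * wt (- a) x)" by (rule integral_mult_left_zero)
  finally show "cmod (iter_deriv \<alpha> (\<lambda>s. \<integral>v. \<psi> v * g (s - v) \<partial>lborel) x) \<le> (\<integral>v. wt a v * cmod (\<psi> v) \<partial>lborel) * B * wt (- a) x"
    by (simp add: iter_deriv_dom_family(2)[OF dom] mult.assoc)
qed

lemma distr_lborel_reflect: "distr lborel borel (\<lambda>v. s - v) = (lborel :: 'a::euclidean_space measure)"
proof -
  have "(lborel :: 'a measure) = density (distr lborel borel (\<lambda>x. s + (-1) *\<^sub>R x)) (\<lambda>_. ennreal (\<bar>-1\<bar> ^ DIM('a)))"
    by (rule lborel_affine) simp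
  then show ?thesis by (simp add: density_1)
qed

lemma integral_lborel_reflect:
  fixes f :: "'a::euclidean_space \<Rightarrow> complex"
  assumes "f \<in> borel_measurable borel"
  shows "(\<integral>v. f (s - v) \<partial>lborel) = (\<integral>v. f v \<partial>lborel)"
  using integral_distr[of "\<lambda>v. s - v" lborel borel f] assms by (simp add: distr_lborel_reflect)

text \<open>A Gaussian of integral 1: its translates form a continuous partition of unity. Rapid
  decay replaces compact support as the means of localisation.\<close>

definition bump :: "real^'n::finite \<Rightarrow> complex" where
  "bump x = (1 / (\<integral>z. gauss (z :: real^'n) \<partial>lborel)) * gauss x"

lemma schwartz_bump: "bump \<in> schwartz"
  unfolding bump_def[abs_def] by (intro schwartz_cmult schwartz_gauss)

lemma integral_gauss_neq_0: "(\<integral>z. gauss (z :: real^'n::finite) \<partial>lborel) \<noteq> 0"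
proof
  assume 0: "(\<integral>z. gauss (z :: real^'n) \<partial>lborel) = 0"
  have i: "integrable lborel (gauss :: real^'n \<Rightarrow> complex)" by (rule schwartz_integrable[OF schwartz_gauss])
  have "(\<integral>z. exp (- (norm (z :: real^'n))\<^sup>2) \<partial>lborel) = 0"
    using 0 unfolding gauss_def integral_complex_of_real by simp
  moreover have "integrable lborel (\<lambda>z::real^'n. exp (- (norm z)\<^sup>2))"
    using integrable_norm[OF i] by (simp add: gauss_def)
  ultimately have "AE z::real^'n in lborel. exp (- (norm z)\<^sup>2) = 0"
    by (subst (asm) integral_nonneg_eq_0_iff_AE) auto
  then have "AE z::real^'n in lborel. False" by simp
  then show False by (simp add: eventually_False ae_filter_eq_bot_iff)
qed

lemma integral_bump:
  fixes x :: "real^'n::finite"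
  shows "(\<integral>z. bump (x - z) \<partial>lborel) = 1"
proof -
  have "continuous_on UNIV (bump :: real^'n \<Rightarrow> complex)" using smooth_continuous[OF schwartz_smooth[OF schwartz_bump], of UNIV "[]"] by simp
  then have "(\<integral>z. bump (x - z) \<partial>lborel) = (\<integral>z. bump (z :: real^'n) \<partial>lborel)"
    by (rule integral_lborel_reflect[OF borel_measurable_continuous_onI])
  also have "\<dots> = 1" unfolding bump_def using integral_gauss_neq_0[where 'n='n] by simp
  finally show ?thesis .
qed

section \<open>The bound for controlled distributions\<close>

lemma epowr_mono: "ennreal x \<le> g \<Longrightarrow> 0 \<le> x \<Longrightarrow> 0 \<le> a \<Longrightarrow> ennreal (x powr a) \<le> epowr g a"
  unfolding epowr_def by (cases g) (auto intro!: ennreal_leI powr_mono2)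

lemma borel_measurable_epowr:
  assumes [measurable]: "g \<in> borel_measurable M" shows "(\<lambda>x. epowr (g x) a) \<in> borel_measurable M"
  unfolding epowr_def by measurable

text \<open>The condition under which a tempered distribution is controlled at the origin and at unit
  scale: \<^term>\<open>G\<close> plays the role of the grand maximal function and \<^term>\<open>\<mu>\<close> bounds the centred
  averages of its power \<^term>\<open>r\<close>.\<close>

definition controlled ::
  "nat \<Rightarrow> real \<Rightarrow> ((real^'n::finite \<Rightarrow> complex) \<Rightarrow> complex) \<Rightarrow> (real^'n \<Rightarrow> ennreal) \<Rightarrow> real \<Rightarrow> bool" where
  "controlled N r u G \<mu> \<longleftrightarrow> tempered u \<and> G \<in> borel_measurable lebesgue \<and> 0 < \<mu> \<and>
     (\<forall>\<Psi>\<in>test_class N. \<forall>z v. dist v z < 1 \<longrightarrow> ennreal (cmod (u (\<lambda>x. \<Psi> (x - z)))) \<le> G v) \<and>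
     (\<forall>\<rho>>0. (\<integral>\<^sup>+v\<in>cball 0 \<rho>. epowr (G v) r \<partial>lebesgue) \<le> ennreal (\<mu> * \<rho> ^ CARD('n)))"

text \<open>Decompose \<Phi> as the integral of the pieces \<Phi>(x) bump(x - z). Translated by -z
  and divided by a constant of size B (1 + |z|)^(-a), each piece is a test function, so its pairing
  with u is controlled by G near z. Splitting the normalised size as k^r k^(1-r) then reduces the
  sum of all pieces to a weighted integral of G^r, which the averages control.\<close>

lemma controlled_bound:
  assumes r: "0 < r" "r \<le> 1" and a: "real CARD('n) / r < a"
  obtains C where "0 \<le> C"
    "\<And>u (G :: real^'n::finite \<Rightarrow> ennreal) \<mu> B \<Phi>. \<lbrakk>controlled N r u G \<mu>; \<Phi> \<in> schwartz; 0 < B;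
       deriv_bound (N + 1) (\<lambda>x. B * wt (- a) x) \<Phi>\<rbrakk> \<Longrightarrow> cmod (u \<Phi>) \<le> C * B * \<mu> powr (1 / r)"
proof -
  let ?n = "real CARD('n)"
  \<comment> \<open>The decay left after k^(1-r) has been paid for; b > n is equivalent to a >
    n/r.\<close>
  define b where "b = a - ?n / r + ?n"
  have b: "?n < b" using a by (simp add: b_def)
  have a0: "0 \<le> a" using a r by (meson divide_nonneg_pos less_le_trans less_imp_le of_nat_0_le_iff order_trans)
  obtain C2 where C2: "0 \<le> C2"
    "\<And>(g :: real^'n \<Rightarrow> ennreal) \<mu>. \<lbrakk>g \<in> borel_measurable lebesgue; 0 \<le> \<mu>;
       \<And>\<rho>. 0 < \<rho> \<Longrightarrow> (\<integral>\<^sup>+z\<in>cball 0 \<rho>. g z \<partial>lebesgue) \<le> ennreal (\<mu> * \<rho> ^ CARD('n))\<rbrakk> \<Longrightarrow>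
     (\<integral>\<^sup>+z. ennreal (wt (- b) z) * g z \<partial>lebesgue) \<le> ennreal (C2 * \<mu>)"
    using nn_integral_wt_le[OF b] by blast
  \<comment> \<open>Of this decay, N + n + 1 is demanded by the test class, and a pays for replacing
    the decay of \<Phi> at x + z by decay at z.\<close>
  obtain C\<gamma> where C\<gamma>: "0 \<le> C\<gamma>" "deriv_bound (N + 1) (\<lambda>x. C\<gamma> * wt (- (real (N + CARD('n) + 1) + a)) x) (bump :: real^'n \<Rightarrow> complex)"
    using schwartz_bump by (rule schwartzE)
  define C1 where "C1 = 2 ^ (N + 1) * C\<gamma> + 1"
  have C1: "0 < C1" using C\<gamma>(1) by (simp add: C1_def add_nonneg_pos)
  define V where "V = unit_ball_vol ?n"
  have V: "0 < V" by (simp add: V_def)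
  define q where "q = (1 - r) / r"
  have q: "0 \<le> q" using r by (simp add: q_def)
  define D where "D = (1 / V) powr q"
  show ?thesis
  proof (rule that[of "C1 * D * C2"])
    show "0 \<le> C1 * D * C2" using C1 C2(1) by (simp add: D_def)
    fix u and G :: "real^'n \<Rightarrow> ennreal" and \<mu> B and \<Phi> :: "real^'n \<Rightarrow> complex"
    assume ctl: "controlled N r u G \<mu>" and \<Phi>: "\<Phi> \<in> schwartz" and B: "0 < B"
      and \<Phi>B: "deriv_bound (N + 1) (\<lambda>x. B * wt (- a) x) \<Phi>"
    have u: "tempered u" and G [measurable]: "G \<in> borel_measurable lebesgue" and \<mu>: "0 < \<mu>"
      and tst: "\<And>\<Psi> z v. \<Psi> \<in> test_class N \<Longrightarrow> dist v z < 1 \<Longrightarrow> ennreal (cmod (u (\<lambda>x. \<Psi> (x - z)))) \<le> G v"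
      and avg: "\<And>\<rho>. 0 < \<rho> \<Longrightarrow> (\<integral>\<^sup>+v\<in>cball 0 \<rho>. epowr (G v) r \<partial>lebesgue) \<le> ennreal (\<mu> * \<rho> ^ CARD('n))"
      using ctl by (auto simp: controlled_def)
    have Gr [measurable]: "(\<lambda>v. epowr (G v) r) \<in> borel_measurable lebesgue" by (rule borel_measurable_epowr[OF G])
    let ?H = "\<lambda>z x. \<Phi> x * bump (x - z)"
    have H: "schwartz_family ?H" by (rule schwartz_family_localization[OF \<Phi> schwartz_bump])
    note HS = schwartz_family_schwartz[OF H]
    define c where "c z = C1 * B * wt (- a) z" for z :: "real^'n"
    have c: "0 < c z" for z using C1 B by (simp add: c_def)
    define k where "k z = cmod (u (?H z)) / c z" for z
    have k0: "0 \<le> k z" for z using c[of z] by (simp add: k_def)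
    have kG: "ennreal (k z) \<le> G v" if "dist v z < 1" for v z
    proof -
      \<comment> \<open>The piece at z moved to the origin and normalised by its expected size c
        z.\<close>
      let ?\<Psi> = "\<lambda>x. of_real (1 / c z) * (\<Phi> (x + z) * bump x)"
      have S: "?\<Psi> \<in> schwartz"
      proof -
        have "(\<lambda>x. \<Phi> (x - (- z)) * bump (x - 0)) \<in> schwartz"
        proof (rule schwartz_mult_moderate[OF schwartz_translate[OF \<Phi>]])
          fix m
          obtain C where "0 \<le> C" "deriv_bound m (\<lambda>x. C * wt (- 0) x) (bump :: real^'n \<Rightarrow> complex)"
            using schwartz_bump by (rule schwartzE)
          then show "\<exists>C s. 0 \<le> C \<and> deriv_bound m (\<lambda>x. C * wt s x) (\<lambda>x. bump (x - 0 :: real^'n))" by (intro exI[of _ C] exI[of _ 0]) simp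
        qed
        then show ?thesis by (intro schwartz_cmult) simp
      qed
      have "deriv_bound (N + 1) (\<lambda>x. 1 * wt (- real (N + CARD('n) + 1)) x) ?\<Psi>"
      proof (rule deriv_bound_mono[OF deriv_bound_cmult[OF deriv_bound_mult[OF _ C\<gamma>(2)]]])
        show "deriv_bound (N + 1) (\<lambda>x. B * wt (- a) (x + z)) (\<lambda>x. \<Phi> (x + z))"
          using deriv_bound_translate[OF \<Phi>B, of "- z"] by simp
        fix x :: "real^'n"
        let ?M = "real (N + CARD('n) + 1)"
        have "wt (- a) (x + z) \<le> wt (- a) z * wt a x" using wt_peetre_minus[OF a0, of z x] by (simp add: add.commute)
        then have "2 ^ (N + 1) * (B * wt (- a) (x + z) * (C\<gamma> * wt (- (?M + a)) x)) \<le>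
            2 ^ (N + 1) * (B * (wt (- a) z * wt a x) * (C\<gamma> * wt (- (?M + a)) x))"
          using B C\<gamma>(1) by (intro mult_left_mono mult_right_mono) auto
        also have "\<dots> = (2 ^ (N + 1) * C\<gamma>) * (B * wt (- a) z * (wt (- (?M + a)) x * wt a x))"
          by (simp only: mult_ac)
        also have "wt (- (?M + a)) x * wt a x = wt (- ?M) x" by (simp add: wt_add[symmetric])
        also have "(2 ^ (N + 1) * C\<gamma>) * (B * wt (- a) z * wt (- ?M) x) \<le> C1 * (B * wt (- a) z * wt (- ?M) x)"
          using B by (intro mult_right_mono) (auto simp: C1_def)
        also have "\<dots> = c z * wt (- ?M) x" by (simp add: c_def)
        finally have le: "2 ^ (N + 1) * (B * wt (- a) (x + z) * (C\<gamma> * wt (- (?M + a)) x)) \<le> c z * wt (- ?M) x" .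
        show "cmod (of_real (1 / c z)) * (2 ^ (N + 1) * (B * wt (- a) (x + z) * (C\<gamma> * wt (- (?M + a)) x))) \<le> 1 * wt (- ?M) x"
        proof -
          have "p \<le> q * w \<Longrightarrow> 0 < q \<Longrightarrow> cmod (of_real (1 / q)) * p \<le> 1 * w" for p q w :: real
            by (simp only: norm_of_real) (simp add: field_simps)
          then show ?thesis using c[of z] le by blast
        qed
      qed simp
      then have "schwartz_seminorm (N + CARD('n) + 1) (N + 1) ?\<Psi> \<le> ennreal 1" by (rule schwartz_seminorm_le) simp
      then have T: "?\<Psi> \<in> test_class N" using S by (simp add: test_class_def)
      have "u (\<lambda>x. ?\<Psi> (x - z)) = of_real (1 / c z) * u (?H z)"
        using tempered_cmult[OF u HS, of "of_real (1 / c z)" z] by simp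
      then have "cmod (u (\<lambda>x. ?\<Psi> (x - z))) = k z" using c[of z] by (simp add: k_def norm_mult norm_divide)
      then show ?thesis using tst[OF T that] by simp
    qed
    \<comment> \<open>The bound k z \<le> G v holds for all v in a unit ball. Averaging its power r
      over that ball, which lies in the ball of radius 1 + |z| about the origin, turns it into a
      bound by \<mu>.\<close>
    have kr: "k z powr r \<le> (1 / V) * \<mu> * wt ?n z" for z
    proof -
      have mb [measurable]: "ball z 1 \<in> sets lebesgue" by simp
      have "ennreal (k z powr r * V) = (\<integral>\<^sup>+v. ennreal (k z powr r) * indicator (ball z 1) v \<partial>lebesgue)"
        using V by (simp add: nn_integral_cmult_indicator emeasure_ball V_def ennreal_mult)
      also have "\<dots> \<le> (\<integral>\<^sup>+v\<in>cball 0 (1 + norm z). epowr (G v) r \<partial>lebesgue)"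
      proof (rule nn_integral_mono)
        fix v
        show "ennreal (k z powr r) * indicator (ball z 1) v \<le> epowr (G v) r * indicator (cball 0 (1 + norm z)) v"
        proof (cases "v \<in> ball z 1")
          case True
          then have "v \<in> cball 0 (1 + norm z)" using norm_triangle_ineq2[of v z] by (simp add: dist_norm norm_minus_commute)
          moreover have "ennreal (k z powr r) \<le> epowr (G v) r"
            using True r k0 by (intro epowr_mono kG) (auto simp: dist_commute)
          ultimately show ?thesis using True by simp
        qed simp
      qed
      also have "\<dots> \<le> ennreal (\<mu> * (1 + norm z) ^ CARD('n))" by (rule avg) (simp add: add_pos_nonneg)
      finally have "k z powr r * V \<le> \<mu> * wt ?n z"
        using \<mu> by (subst (asm) ennreal_le_iff) (auto simp: wt_of_nat)
      then show ?thesis using V by (simp add: field_simps)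
    qed
    have pw: "cmod (u (?H z)) \<le> C1 * B * D * \<mu> powr q * (wt (- b) z * k z powr r)" for z
    proof -
      \<comment> \<open>Hence k = k^r (k^r)^q; the pointwise bound is spent on the second factor
        only, and the first is kept for integration.\<close>
      have rq: "r + r * q = 1" using r by (simp add: q_def)
      have "k z = k z powr (r + r * q)" unfolding rq using k0 by simp
      also have "\<dots> = k z powr r * (k z powr r) powr q" by (simp add: powr_add powr_powr)
      also have "\<dots> \<le> k z powr r * ((1 / V) * \<mu> * wt ?n z) powr q"
        using kr[of z] q by (intro mult_left_mono powr_mono2) auto
      also have "((1 / V) * \<mu> * wt ?n z) powr q = D * \<mu> powr q * wt (?n * q) z"
        using V \<mu> by (simp add: D_def powr_mult wt_def powr_powr powr_divide)
      finally have "wt (- a) z * k z \<le> wt (- a) z * (k z powr r * (D * \<mu> powr q * wt (?n * q) z))"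
        by (intro mult_left_mono) auto
      also have "\<dots> = D * \<mu> powr q * (wt (- a + ?n * q) z * k z powr r)" by (simp only: wt_add mult_ac)
      also have "- a + ?n * q = - b" using r by (simp add: q_def b_def field_simps)
      finally have "wt (- a) z * k z \<le> D * \<mu> powr q * (wt (- b) z * k z powr r)" .
      then have "C1 * B * (wt (- a) z * k z) \<le> C1 * B * (D * \<mu> powr q * (wt (- b) z * k z powr r))"
        using C1 B by (intro mult_left_mono) auto
      moreover have "cmod (u (?H z)) = C1 * B * (wt (- a) z * k z)"
        using C1 B by (simp add: k_def c_def)
      ultimately show ?thesis by (simp add: mult_ac)
    qed
    let ?K = "C1 * B * D * \<mu> powr q"
    have K: "0 \<le> ?K" using C1 B by (simp add: D_def)
    have "\<Phi> = (\<lambda>x. \<integral>z. ?H z x \<partial>lborel)" by (rule ext) (simp add: integral_bump)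
    then have "u \<Phi> = (\<integral>z. u (?H z) \<partial>lborel)" using tempered_integral_family(3)[OF u H] by simp
    then have "ennreal (cmod (u \<Phi>)) \<le> (\<integral>\<^sup>+z. ennreal (cmod (u (?H z))) \<partial>lborel)"
      using integral_norm_bound_ennreal[OF tempered_integral_family(2)[OF u H]] by simp
    also have "\<dots> = (\<integral>\<^sup>+z. ennreal (cmod (u (?H z))) \<partial>lebesgue)" by (simp add: nn_integral_completion)
    also have "\<dots> \<le> (\<integral>\<^sup>+z. ennreal ?K * (ennreal (wt (- b) z) * epowr (G z) r) \<partial>lebesgue)"
    proof (rule nn_integral_mono)
      fix z
      have "ennreal (cmod (u (?H z))) \<le> ennreal (?K * (wt (- b) z * k z powr r))" by (rule ennreal_leI[OF pw])
      also have "\<dots> = ennreal ?K * (ennreal (wt (- b) z) * ennreal (k z powr r))" using K by (simp add: ennreal_mult)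
      also have "\<dots> \<le> ennreal ?K * (ennreal (wt (- b) z) * epowr (G z) r)"
        using r k0 by (intro mult_left_mono epowr_mono kG) auto
      finally show "ennreal (cmod (u (?H z))) \<le> ennreal ?K * (ennreal (wt (- b) z) * epowr (G z) r)" .
    qed
    also have "\<dots> = ennreal ?K * (\<integral>\<^sup>+z. ennreal (wt (- b) z) * epowr (G z) r \<partial>lebesgue)"
    proof (rule nn_integral_cmult)
      have "(wt (- b) :: real^'n \<Rightarrow> real) \<in> borel_measurable lborel" by simp
      then have [measurable]: "(wt (- b) :: real^'n \<Rightarrow> real) \<in> borel_measurable lebesgue" by (rule measurable_completion)
      show "(\<lambda>z. ennreal (wt (- b) z) * epowr (G z) r) \<in> borel_measurable lebesgue" by measurable
    qed
    also have "\<dots> \<le> ennreal ?K * ennreal (C2 * \<mu>)"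
      using \<mu> by (intro mult_left_mono C2(2) avg Gr) auto
    finally have "ennreal (cmod (u \<Phi>)) \<le> ennreal (?K * (C2 * \<mu>))"
      using K C2(1) \<mu> by (simp add: ennreal_mult)
    then have "cmod (u \<Phi>) \<le> ?K * (C2 * \<mu>)"
      using K C2(1) \<mu> by (subst (asm) ennreal_le_iff) auto
    also have "\<dots> = C1 * D * C2 * B * (\<mu> powr q * \<mu> powr 1)" using \<mu> by simp
    also have "\<mu> powr q * \<mu> powr 1 = \<mu> powr (1 / r)"
    proof -
      have "q + 1 = 1 / r" using r by (simp add: q_def field_simps)
      then show ?thesis by (simp only: powr_add[symmetric])
    qed
    finally show "cmod (u \<Phi>) \<le> C1 * D * C2 * B * \<mu> powr (1 / r)" .
  qed
qed

section \<open>From Schwartz functions to the Bochner-Riesz kernel\<close>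

lemma br_multiplier_integrable:
  assumes "0 < \<delta>"
  shows "integrable lborel (\<lambda>\<xi>::real^'n::finite. complex_of_real (max 0 (1 - (norm \<xi>)\<^sup>2) powr \<delta>))"
proof (rule Bochner_Integration.integrable_bound)
  show "integrable lborel (indicator (cball (0::real^'n) 1) :: _ \<Rightarrow> real)"
    by (intro integrable_real_indicator emeasure_bounded_finite) auto
  show "AE \<xi>::real^'n in lborel. norm (complex_of_real (max 0 (1 - (norm \<xi>)\<^sup>2) powr \<delta>)) \<le> norm (indicator (cball (0::real^'n) 1) \<xi> :: real)"
  proof (rule AE_I2)
    fix \<xi> :: "real^'n"
    show "norm (complex_of_real (max 0 (1 - (norm \<xi>)\<^sup>2) powr \<delta>)) \<le> norm (indicator (cball (0::real^'n) 1) \<xi> :: real)"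
    proof (cases "norm \<xi> \<le> 1")
      case True
      have "max 0 (1 - (norm \<xi>)\<^sup>2) powr \<delta> \<le> 1 powr \<delta>" using assms by (intro powr_mono2) auto
      then show ?thesis using True by simp
    next
      case False
      then have "1 \<le> (norm \<xi>)\<^sup>2" by (simp add: one_le_power)
      then show ?thesis using False by simp
    qed
  qed
qed simp

text \<open>Since the cutoff has Fourier transform 1 on the support of the multiplier, convolving the
  kernel with it changes nothing; this only needs Fubini's theorem, not Fourier inversion.\<close>

lemma cutoff_convolution_br_kernel:
  fixes \<psi> :: "real^'n::finite \<Rightarrow> complex"
  assumes \<delta>: "0 < \<delta>" and \<psi>: "\<psi> \<in> cutoffs 1"
  shows "(\<integral>v. \<psi> v * br_kernel \<delta> (s - v) \<partial>lborel) = br_kernel \<delta> s"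
proof -
  let ?m = "\<lambda>\<xi>::real^'n. complex_of_real (max 0 (1 - (norm \<xi>)\<^sup>2) powr \<delta>)"
  have S: "\<psi> \<in> schwartz" and one: "\<And>\<xi>. norm \<xi> \<le> 1 \<Longrightarrow> fourier \<psi> \<xi> = 1"
    using \<psi> by (auto simp: cutoffs_def)
  have c\<psi>: "continuous_on UNIV \<psi>" using smooth_continuous[OF schwartz_smooth[OF S], of UNIV "[]"] by simp
  note [measurable] = borel_measurable_continuous_onI[OF c\<psi>]
  have mc [measurable]: "(\<lambda>x. cis (h x)) \<in> borel_measurable M" if "h \<in> borel_measurable M" for h :: "'z \<Rightarrow> real" and M
    using that by (rule measurable_compose) (auto intro!: borel_measurable_continuous_onI continuous_intros)
  have K: "br_kernel \<delta> x = (\<integral>\<xi>. ?m \<xi> * cis (- 2 * pi * (\<xi> \<bullet> x)) \<partial>lborel)" for x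
    unfolding br_kernel_def fourier_def by (rule integral_completion) measurable
  have F: "fourier \<psi> x = (\<integral>v. \<psi> v * cis (- 2 * pi * (v \<bullet> x)) \<partial>lborel)" for x
    unfolding fourier_def by (rule integral_completion) measurable
  let ?f = "\<lambda>v \<xi>. \<psi> v * (?m \<xi> * cis (- 2 * pi * (\<xi> \<bullet> (s - v))))"
  have meas: "(\<lambda>(v, \<xi>). ?f v \<xi>) \<in> borel_measurable (lborel \<Otimes>\<^sub>M lborel)" by measurable
  have mi: "integrable lborel ?m" by (rule br_multiplier_integrable[OF \<delta>])
  have inner: "integrable lborel (\<lambda>\<xi>. ?f v \<xi>)" for v
  proof -
    have "integrable lborel (\<lambda>\<xi>. ?m \<xi> * cis (- 2 * pi * (\<xi> \<bullet> (s - v))))"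
    proof (rule Bochner_Integration.integrable_bound[OF mi])
      show "(\<lambda>\<xi>. ?m \<xi> * cis (- 2 * pi * (\<xi> \<bullet> (s - v)))) \<in> borel_measurable lborel" by measurable
    qed (simp add: norm_mult)
    then show ?thesis by (rule integrable_mult_right)
  qed
  have "integrable (lborel \<Otimes>\<^sub>M lborel) (\<lambda>(v, \<xi>). ?f v \<xi>)"
  proof (rule lborel_pair.Fubini_integrable[OF meas])
    have "(\<integral>\<xi>. norm (case (v, \<xi>) of (v, \<xi>) \<Rightarrow> ?f v \<xi>) \<partial>lborel) = cmod (\<psi> v) * (\<integral>\<xi>. cmod (?m \<xi>) \<partial>lborel)" for v
      by (simp add: norm_mult)
    then show "integrable lborel (\<lambda>v. \<integral>\<xi>. norm (case (v, \<xi>) of (v, \<xi>) \<Rightarrow> ?f v \<xi>) \<partial>lborel)"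
      using integrable_norm[OF schwartz_integrable[OF S]] by simp
  qed (use inner in simp)
  then have fub: "(\<integral>v. (\<integral>\<xi>. ?f v \<xi> \<partial>lborel) \<partial>lborel) = (\<integral>\<xi>. (\<integral>v. ?f v \<xi> \<partial>lborel) \<partial>lborel)"
    by (rule lborel_pair.Fubini_integral[symmetric])
  have "(\<integral>v. \<psi> v * br_kernel \<delta> (s - v) \<partial>lborel) = (\<integral>v. (\<integral>\<xi>. ?f v \<xi> \<partial>lborel) \<partial>lborel)"
    unfolding K by simp
  also have "\<dots> = (\<integral>\<xi>. (\<integral>v. ?f v \<xi> \<partial>lborel) \<partial>lborel)" by (rule fub)
  also have "\<dots> = (\<integral>\<xi>. ?m \<xi> * cis (- 2 * pi * (\<xi> \<bullet> s)) \<partial>lborel)"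
  proof (rule Bochner_Integration.integral_cong[OF refl])
    fix \<xi> :: "real^'n"
    have "?f v \<xi> = (?m \<xi> * cis (- 2 * pi * (\<xi> \<bullet> s))) * (\<psi> v * cis (- 2 * pi * (v \<bullet> - \<xi>)))" for v
    proof -
      have "cis (- 2 * pi * (\<xi> \<bullet> (s - v))) = cis (- 2 * pi * (\<xi> \<bullet> s)) * cis (- 2 * pi * (v \<bullet> - \<xi>))"
        unfolding cis_mult by (simp add: inner_diff_right inner_commute algebra_simps)
      then show ?thesis by simp
    qed
    \<comment> \<open>The inner integral is the Fourier transform of \<psi> at -\<xi>; it equals 1
      on the unit ball, which is symmetric, and outside it the multiplier vanishes.\<close>
    then have "(\<integral>v. ?f v \<xi> \<partial>lborel) = (?m \<xi> * cis (- 2 * pi * (\<xi> \<bullet> s))) * fourier \<psi> (- \<xi>)"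
      unfolding F by (simp only: integral_mult_right_zero)
    also have "\<dots> = ?m \<xi> * cis (- 2 * pi * (\<xi> \<bullet> s))"
    proof (cases "norm \<xi> \<le> 1")
      case True
      then show ?thesis using one[of "- \<xi>"] by simp
    next
      case False
      then have "1 \<le> (norm \<xi>)\<^sup>2" by (simp add: one_le_power)
      then show ?thesis by simp
    qed
    finally show "(\<integral>v. ?f v \<xi> \<partial>lborel) = ?m \<xi> * cis (- 2 * pi * (\<xi> \<bullet> s))" .
  qed
  also have "\<dots> = br_kernel \<delta> s" unfolding K ..
  finally show ?thesis .
qed

text \<open>For \<epsilon> \<le> 1 the chain rule factors are at most 1, which makes the bound
  uniform in \<epsilon>.\<close>

lemma deriv_bound_gauss_scale:
  fixes C \<epsilon> :: real
  assumes g: "deriv_bound m (\<lambda>_. C) (gauss :: real^'n::finite \<Rightarrow> complex)" and \<epsilon>: "0 < \<epsilon>" "\<epsilon> \<le> 1"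
  shows "deriv_bound m (\<lambda>_. C) (\<lambda>x::real^'n. gauss (\<epsilon> *\<^sub>R x))"
  using deriv_bound_affine[OF g, of \<epsilon> 0] \<epsilon> by simp

text \<open>Smallness \<epsilon>^\<tau> is bought with growth of order \<tau>. With t = \<epsilon>
  |x|, the value 1 - exp(-t^2) is at most both 1 and t^2, hence at most t^\<tau>; the derivatives
  carry a factor \<epsilon> \<le> \<epsilon>^\<tau>.\<close>

lemma deriv_bound_one_minus_gauss:
  fixes C \<epsilon> \<tau> :: real
  assumes g: "deriv_bound (Suc m) (\<lambda>_. C) (gauss :: real^'n::finite \<Rightarrow> complex)"
    and \<epsilon>: "0 < \<epsilon>" "\<epsilon> \<le> 1" and \<tau>: "0 < \<tau>" "\<tau> \<le> 1"
  shows "deriv_bound (Suc m) (\<lambda>x. max 1 C * \<epsilon> powr \<tau> * wt \<tau> x) (\<lambda>x::real^'n. 1 - gauss (\<epsilon> *\<^sub>R x))"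
proof -
  have d: "(\<lambda>x::real^'n. gauss (\<epsilon> *\<^sub>R x)) differentiable (at x)"
    and p: "partial_deriv i (\<lambda>x::real^'n. gauss (\<epsilon> *\<^sub>R x)) = (\<lambda>x. of_real \<epsilon> * partial_deriv i gauss (\<epsilon> *\<^sub>R x))" for x i
    using partial_deriv_affine[of "gauss :: real^'n \<Rightarrow> complex", OF gauss_differentiable, where c = \<epsilon> and v = 0] by simp_all
  have d': "(\<lambda>x::real^'n. (-1) * gauss (\<epsilon> *\<^sub>R x)) differentiable (at x)" for x
    by (intro differentiable_mult differentiable_const d)
  have e: "(\<lambda>x::real^'n. 1 - gauss (\<epsilon> *\<^sub>R x)) = (\<lambda>x. 1 + (-1) * gauss (\<epsilon> *\<^sub>R x))" by simp
  have pd: "partial_deriv i (\<lambda>x::real^'n. 1 - gauss (\<epsilon> *\<^sub>R x)) = (\<lambda>x. of_real (- \<epsilon>) * partial_deriv i gauss (\<epsilon> *\<^sub>R x))" for i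
    unfolding e partial_deriv_add[OF differentiable_const d'] partial_deriv_mult[OF differentiable_const d] p
    by (simp add: partial_deriv_const)
  have wt1: "1 \<le> wt \<tau> x" for x :: "real^'n" using \<tau> by (intro wt_ge_1) simp
  have ee: "\<epsilon> \<le> \<epsilon> powr \<tau>" using \<epsilon> \<tau> powr_mono'[of \<tau> 1 \<epsilon>] by simp
  have C0: "0 \<le> C" using deriv_bound_zero(2)[OF g] norm_ge_zero order_trans by blast
  have "deriv_bound m (\<lambda>x. max 1 C * \<epsilon> powr \<tau> * wt \<tau> x) (partial_deriv i (\<lambda>x::real^'n. 1 - gauss (\<epsilon> *\<^sub>R x)))" for i
    unfolding pd
  proof (rule deriv_bound_mono[OF deriv_bound_cmult])
    have "deriv_bound m (\<lambda>_. C) (partial_deriv i (gauss :: real^'n \<Rightarrow> complex))"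
      using g by (simp add: deriv_bound_Suc)
    from deriv_bound_affine[OF this, of \<epsilon> 0] \<epsilon>
    show "deriv_bound m (\<lambda>_. C) (\<lambda>x::real^'n. partial_deriv i gauss (\<epsilon> *\<^sub>R x))" by simp
    fix x :: "real^'n"
    have "cmod (of_real (- \<epsilon>)) * C = C * \<epsilon>" using \<epsilon> by simp
    also have "\<dots> \<le> max 1 C * \<epsilon> powr \<tau>" using ee C0 \<epsilon> by (intro mult_mono) auto
    also have "\<dots> \<le> max 1 C * \<epsilon> powr \<tau> * wt \<tau> x" 
      using mult_left_mono[OF wt1[of x], of "max 1 C * \<epsilon> powr \<tau>"] by (simp add: le_max_iff_disj)
    finally show "cmod (of_real (- \<epsilon>)) * C \<le> max 1 C * \<epsilon> powr \<tau> * wt \<tau> x" .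
  qed simp
  moreover have "cmod (1 - gauss (\<epsilon> *\<^sub>R x)) \<le> max 1 C * \<epsilon> powr \<tau> * wt \<tau> x" for x :: "real^'n"
  proof -
    define t where "t = \<epsilon> * norm x"
    have t: "0 \<le> t" using \<epsilon> by (simp add: t_def)
    have e1: "0 \<le> 1 - exp (- t\<^sup>2)" "1 - exp (- t\<^sup>2) \<le> 1" by simp_all
    have e2: "1 - exp (- t\<^sup>2) \<le> t\<^sup>2" using exp_ge_add_one_self[of "- t\<^sup>2"] by linarith
    have "cmod (1 - gauss (\<epsilon> *\<^sub>R x)) = cmod (of_real (1 - exp (- t\<^sup>2)))"
      using \<epsilon> by (simp add: gauss_def t_def)
    also have "\<dots> = 1 - exp (- t\<^sup>2)" unfolding norm_of_real using e1 by simp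
    also have "\<dots> \<le> t powr \<tau>"
    proof (cases "t \<le> 1")
      case True
      show ?thesis
      proof (cases "t = 0")
        case False
        have "t\<^sup>2 = t powr 2" using t False by simp
        also have "\<dots> \<le> t powr \<tau>" using True t \<tau> by (intro powr_mono') auto
        finally show ?thesis using e2 by simp
      qed simp
    next
      case False
      then have "1 \<le> t powr \<tau>" using \<tau> by (simp add: ge_one_powr_ge_zero)
      then show ?thesis by (rule order_trans[OF e1(2)])
    qed
    also have "\<dots> = \<epsilon> powr \<tau> * norm x powr \<tau>" using \<epsilon> by (simp add: t_def powr_mult)
    also have "\<dots> \<le> 1 * \<epsilon> powr \<tau> * wt \<tau> x"
      using \<tau> by (auto simp: wt_def intro!: mult_left_mono powr_mono2)
    also have "\<dots> \<le> max 1 C * \<epsilon> powr \<tau> * wt \<tau> x" by (intro mult_right_mono) auto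
    finally show ?thesis .
  qed
  moreover have "(\<lambda>x::real^'n. 1 - gauss (\<epsilon> *\<^sub>R x)) differentiable (at x)" for x
    by (intro differentiable_diff differentiable_const d)
  ultimately show ?thesis by (simp add: deriv_bound_Suc)
qed

text \<open>The translates of \<psi> have no decay in v. Multiplying by the nowhere vanishing
  Gaussian makes them a Schwartz family, whose continuity is known; linearity lets the factor be
  divided out again.\<close>

lemma continuous_on_tempered_translate:
  fixes \<psi> :: "real^'n::finite \<Rightarrow> complex"
  assumes u: "tempered u" and \<psi>: "\<psi> \<in> schwartz"
  shows "continuous_on UNIV (\<lambda>v. u (\<lambda>s. \<psi> (s - v)))"
proof -
  have "continuous_on UNIV (\<lambda>v. u (\<lambda>s. gauss v * \<psi> (s - v)))"
    by (rule tempered_integral_family(1)[OF u schwartz_family_convolution[OF schwartz_gauss \<psi>]])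
  moreover have "u (\<lambda>s. gauss v * \<psi> (s - v)) = gauss v * u (\<lambda>s. \<psi> (s - v))" for v
    by (rule tempered_cmult[OF u schwartz_translate[OF \<psi>]])
  ultimately have c: "continuous_on UNIV (\<lambda>v. gauss v * u (\<lambda>s. \<psi> (s - v)))" by simp
  have g0: "gauss v \<noteq> 0" for v :: "real^'n" by (simp add: gauss_def)
  have "continuous_on UNIV (gauss :: real^'n \<Rightarrow> complex)"
    using smooth_continuous[OF schwartz_smooth[OF schwartz_gauss], of UNIV "[]"] by simp
  with c have "continuous_on UNIV (\<lambda>v. gauss v * u (\<lambda>s. \<psi> (s - v)) / gauss v)"
    by (intro continuous_on_divide) (auto simp: g0)
  then show ?thesis by (simp add: g0)
qed

text \<open>With K the kernel and \<theta> a wide Gaussian, K \<theta> is Schwartz, so u may be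
  interchanged with its convolution with \<psi>. As \<psi> reproduces K, that convolution is K
  \<theta> plus an error of size \<epsilon>^\<tau> and decay a. \<open>controlled_bound\<close>
  applies to both terms, and \<epsilon> tends to 0.\<close>

lemma br_kernel_unit_estimate:
  assumes r: "0 < r" "r \<le> 1" and \<delta>: "0 < \<delta>" and a0: "real CARD('n) / r < \<delta> + (real CARD('n) + 1) / 2"
  obtains C where "0 \<le> C"
    "\<And>u (G :: real^'n::finite \<Rightarrow> ennreal) \<mu> \<psi>. \<lbrakk>controlled N r u G \<mu>; \<psi> \<in> cutoffs 1\<rbrakk> \<Longrightarrow>
       cmod (\<integral>v. br_kernel \<delta> v * u (\<lambda>s. \<psi> (s - v)) \<partial>lebesgue) \<le> C * \<mu> powr (1 / r)"
proof -
  define A where "A = \<delta> + (real CARD('n) + 1) / 2"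
  \<comment> \<open>Giving up at most half of the gap between A and n/r keeps a = A - \<tau> above
    n/r; the cap 1 ensures \<epsilon> \<le> \<epsilon>^\<tau>.\<close>
  define \<tau> where "\<tau> = min 1 ((A - real CARD('n) / r) / 2)"
  define a where "a = A - \<tau>"
  let ?K = "br_kernel \<delta> :: real^'n \<Rightarrow> complex"
  have gap: "0 < A - real CARD('n) / r" using a0 by (simp add: A_def)
  have \<tau>: "0 < \<tau>" "\<tau> \<le> 1" using gap by (auto simp: \<tau>_def)
  have "\<tau> \<le> (A - real CARD('n) / r) / 2" unfolding \<tau>_def by (rule min.cobounded2)
  then have a: "real CARD('n) / r < a" using gap unfolding a_def by argo
  have apos: "0 \<le> a" using a r by (meson divide_nonneg_pos less_imp_le of_nat_0_le_iff order_trans)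
  have aA: "a \<le> A" using \<tau> by (simp add: a_def)
  obtain C0 where C0: "0 \<le> C0"
    "\<And>u (G :: real^'n::finite \<Rightarrow> ennreal) \<mu> B \<Phi>. \<lbrakk>controlled N r u G \<mu>; \<Phi> \<in> schwartz; 0 < B;
       deriv_bound (N + 1) (\<lambda>x. B * wt (- a) x) \<Phi>\<rbrakk> \<Longrightarrow> cmod (u \<Phi>) \<le> C0 * B * \<mu> powr (1 / r)"
    using controlled_bound[OF r a, of N] by blast
  have KD: "\<exists>C\<ge>0. deriv_bound m (\<lambda>x. C * wt (- A) x) ?K" for m
    unfolding A_def by (rule deriv_bound_br_kernel[OF \<delta>, of m]) blast
  obtain CK where CK: "0 \<le> CK" "deriv_bound (N + 1) (\<lambda>x. CK * wt (- A) x) ?K" using KD by blast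
  have gD: "\<exists>C\<ge>0. deriv_bound m (\<lambda>_. C) (gauss :: real^'n \<Rightarrow> complex)" for m
  proof -
    obtain C where "0 \<le> C" "deriv_bound m (\<lambda>x. C * wt (- 0) x) (gauss :: real^'n \<Rightarrow> complex)"
      using schwartz_gauss by (rule schwartzE)
    then show ?thesis by auto
  qed
  obtain Cg where Cg: "0 \<le> Cg" "deriv_bound (N + 1) (\<lambda>_. Cg) (gauss :: real^'n \<Rightarrow> complex)" using gD by blast
  define B0 where "B0 = 2 ^ (N + 1) * CK * Cg + 1"
  have B0: "0 < B0" using CK(1) Cg(1) by (simp add: B0_def add_nonneg_pos)
  have KA: "0 < A" using gap r by (metis diff_gt_0_iff_gt divide_nonneg_pos le_less_trans of_nat_0_le_iff)
  have Kbd: "\<exists>B. deriv_bound m (\<lambda>_. B) ?K" for m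
  proof -
    obtain C where C: "0 \<le> C" "deriv_bound m (\<lambda>x. C * wt (- A) x) ?K" using KD by blast
    have "deriv_bound m (\<lambda>_. C) ?K"
      by (rule deriv_bound_mono[OF C(2)]) (use C(1) KA in \<open>auto intro!: mult_left_le wt_le_1\<close>)
    then show ?thesis by blast
  qed
  have Ksm: "smooth ?K" using Kbd unfolding smooth_iff by blast
  have Kc: "continuous_on UNIV ?K" using smooth_continuous[OF Ksm, of UNIV "[]"] by simp
  show ?thesis
  proof (rule that[of "C0 * B0"])
    show "0 \<le> C0 * B0" using C0(1) B0 by simp
    fix u and G :: "real^'n \<Rightarrow> ennreal" and \<mu> and \<psi> :: "real^'n \<Rightarrow> complex"
    assume ctl: "controlled N r u G \<mu>" and \<psi>c: "\<psi> \<in> cutoffs 1"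
    have \<psi>: "\<psi> \<in> schwartz" using \<psi>c by (simp add: cutoffs_def)
    have u: "tempered u" and \<mu>: "0 < \<mu>" using ctl by (simp_all add: controlled_def)
    let ?U = "\<lambda>v. u (\<lambda>s. \<psi> (s - v))"
    have Uc: "continuous_on UNIV ?U" by (rule continuous_on_tempered_translate[OF u \<psi>])
    define \<theta> where "\<theta> \<epsilon> x = gauss (\<epsilon> *\<^sub>R x)" for \<epsilon> :: real and x :: "real^'n"
    define c\<psi> where "c\<psi> = (\<integral>v. wt a v * cmod (\<psi> v) \<partial>lborel)"
    have c\<psi>: "0 \<le> c\<psi>" unfolding c\<psi>_def by (intro Bochner_Integration.integral_nonneg) simp
    define B1 where "B1 = (1 + c\<psi>) * (2 ^ (N + 1) * CK * max 1 Cg) + 1"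
    have B1: "0 < B1" using CK(1) c\<psi> by (simp add: B1_def add_nonneg_pos)
    have reg: "cmod (\<integral>v. ?K v * \<theta> \<epsilon> v * ?U v \<partial>lborel) \<le> C0 * (B0 + B1 * \<epsilon> powr \<tau>) * \<mu> powr (1 / r)"
      if \<epsilon>: "0 < \<epsilon>" "\<epsilon> \<le> 1" for \<epsilon>
    proof -
      have \<theta>S: "\<theta> \<epsilon> \<in> schwartz"
        using schwartz_affine[OF schwartz_gauss, of \<epsilon> 0] \<epsilon> by (simp add: \<theta>_def[abs_def])
      let ?Ke = "\<lambda>x. ?K x * \<theta> \<epsilon> x" and ?g = "\<lambda>x. ?K x * (1 - \<theta> \<epsilon> x)"
      have "(\<lambda>x. \<theta> \<epsilon> x * ?K x) \<in> schwartz"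
        by (rule schwartz_mult_moderate[OF \<theta>S]) (use KD in blast)
      then have KeS: "?Ke \<in> schwartz" by (simp add: mult.commute)
      have Keb: "deriv_bound (N + 1) (\<lambda>x. B0 * wt (- a) x) ?Ke"
      proof (rule deriv_bound_mono[OF deriv_bound_mult[OF CK(2)]])
        show "deriv_bound (N + 1) (\<lambda>_. Cg) (\<theta> \<epsilon>)"
          using deriv_bound_gauss_scale[OF Cg(2) \<epsilon>] by (simp add: \<theta>_def[abs_def])
        fix x :: "real^'n"
        have "2 ^ (N + 1) * (CK * wt (- A) x * Cg) = (2 ^ (N + 1) * CK * Cg) * wt (- A) x" by simp
        also have "\<dots> \<le> B0 * wt (- a) x"
          using CK(1) Cg(1) aA by (intro mult_mono wt_mono) (auto simp: B0_def)
        finally show "2 ^ (N + 1) * (CK * wt (- A) x * Cg) \<le> B0 * wt (- a) x" .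
      qed simp
      define Bg where "Bg = 2 ^ (N + 1) * CK * max 1 Cg * \<epsilon> powr \<tau>"
      have gb: "deriv_bound (N + 1) (\<lambda>x. Bg * wt (- a) x) ?g"
      proof -
        have "deriv_bound (N + 1) (\<lambda>x. max 1 Cg * \<epsilon> powr \<tau> * wt \<tau> x) (\<lambda>x. 1 - \<theta> \<epsilon> x)"
          using deriv_bound_one_minus_gauss[of N Cg \<epsilon> \<tau>] Cg(2) \<epsilon> \<tau> by (simp add: \<theta>_def)
        from deriv_bound_mult[OF CK(2) this]
        have "deriv_bound (N + 1) (\<lambda>x. 2 ^ (N + 1) * (CK * wt (- A) x * (max 1 Cg * \<epsilon> powr \<tau> * wt \<tau> x))) ?g" .
        moreover have "2 ^ (N + 1) * (CK * wt (- A) x * (max 1 Cg * \<epsilon> powr \<tau> * wt \<tau> x)) = Bg * wt (- a) x" for x :: "real^'n"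
        proof -
          have "wt (- a) x = wt (- A) x * wt \<tau> x" by (simp add: wt_add[symmetric] a_def)
          then show ?thesis by (simp only: Bg_def mult_ac)
        qed
        ultimately show ?thesis by (simp only:)
      qed
      have gbd: "\<exists>B. deriv_bound m (\<lambda>_. B) ?g" for m
      proof -
        obtain B where B: "deriv_bound m (\<lambda>_. B) ?K" using Kbd by blast
        obtain D where D: "deriv_bound m (\<lambda>_. D) (gauss :: real^'n \<Rightarrow> complex)" using gD by blast
        have "deriv_bound m (\<lambda>_. cmod 1 + cmod (-1) * D) (\<lambda>x. 1 + (-1) * \<theta> \<epsilon> x)"
          using deriv_bound_gauss_scale[OF D \<epsilon>] unfolding \<theta>_def
          by (intro deriv_bound_add deriv_bound_cmult deriv_bound_const)
        from deriv_bound_mult[OF B this] show ?thesis by auto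
      qed
      let ?I = "\<lambda>s. \<integral>v. ?Ke v * \<psi> (s - v) \<partial>lborel"
      have fam: "schwartz_family (\<lambda>v s. ?Ke v * \<psi> (s - v))" by (rule schwartz_family_convolution[OF KeS \<psi>])
      have IS: "?I \<in> schwartz" by (rule schwartz_family_integral[OF fam])
      have uI: "u ?I = (\<integral>v. ?K v * \<theta> \<epsilon> v * ?U v \<partial>lborel)"
        unfolding tempered_integral_family(3)[OF u fam]
        by (intro Bochner_Integration.integral_cong refl tempered_cmult[OF u schwartz_translate[OF \<psi>]])
      define E where "E s = ?I s - ?Ke s" for s
      have ES: "E \<in> schwartz" unfolding E_def[abs_def] by (rule schwartz_diff[OF IS KeS])
      \<comment> \<open>Put g = K - K \<theta>. Since \<psi> * K = K, the error \<psi> * (K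
        \<theta>) - K \<theta> equals g - \<psi> * g, in which only the small function g
        occurs.\<close>
      have Eeq: "E = (\<lambda>s. ?g s + (-1) * (\<integral>v. \<psi> v * ?g (s - v) \<partial>lborel))"
      proof
        fix s
        have c1: "continuous_on UNIV (\<lambda>v. ?Ke v * \<psi> (s - v))"
        proof (rule continuous_on_mult)
          show "continuous_on UNIV ?Ke" using smooth_continuous[OF schwartz_smooth[OF KeS], of UNIV "[]"] by simp
          show "continuous_on UNIV (\<lambda>v. \<psi> (s - v))"
            by (rule continuous_on_compose2[OF smooth_continuous[OF schwartz_smooth[OF \<psi>], of UNIV "[]", simplified]])
               (auto intro!: continuous_intros)
        qed
        have "?I s = (\<integral>v. ?Ke (s - v) * \<psi> (s - (s - v)) \<partial>lborel)"
          by (rule integral_lborel_reflect[OF borel_measurable_continuous_onI[OF c1], symmetric])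
        also have "\<dots> = (\<integral>v. \<psi> v * ?K (s - v) - \<psi> v * ?g (s - v) \<partial>lborel)"
          by (intro Bochner_Integration.integral_cong refl) (simp add: algebra_simps)
        also have "\<dots> = (\<integral>v. \<psi> v * ?K (s - v) \<partial>lborel) - (\<integral>v. \<psi> v * ?g (s - v) \<partial>lborel)"
          using dom_family_integrable[OF dom_family_convolution[OF \<psi> Kbd], of "[]" s]
            dom_family_integrable[OF dom_family_convolution[OF \<psi> gbd], of "[]" s]
          by (intro Bochner_Integration.integral_diff) simp_all
        also have "(\<integral>v. \<psi> v * ?K (s - v) \<partial>lborel) = ?K s" by (rule cutoff_convolution_br_kernel[OF \<delta> \<psi>c])
        finally show "E s = ?g s + (-1) * (\<integral>v. \<psi> v * ?g (s - v) \<partial>lborel)"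
          by (simp add: E_def algebra_simps)
      qed
      have Eb: "deriv_bound (N + 1) (\<lambda>x. B1 * \<epsilon> powr \<tau> * wt (- a) x) E"
        unfolding Eeq
      proof (rule deriv_bound_mono[OF deriv_bound_add[OF gb deriv_bound_cmult[OF deriv_bound_convolution[OF \<psi> gbd gb apos]]]])
        fix x :: "real^'n"
        have "Bg * wt (- a) x + cmod (-1) * ((\<integral>v. wt a v * cmod (\<psi> v) \<partial>lborel) * Bg * wt (- a) x) =
            (1 + c\<psi>) * (2 ^ (N + 1) * CK * max 1 Cg) * \<epsilon> powr \<tau> * wt (- a) x"
          unfolding c\<psi>_def Bg_def by (simp add: algebra_simps)
        also have "\<dots> \<le> B1 * \<epsilon> powr \<tau> * wt (- a) x" by (intro mult_right_mono) (auto simp: B1_def)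
        finally show "Bg * wt (- a) x + cmod (-1) * ((\<integral>v. wt a v * cmod (\<psi> v) \<partial>lborel) * Bg * wt (- a) x) \<le> B1 * \<epsilon> powr \<tau> * wt (- a) x" .
      qed simp
      have "?I = (\<lambda>s. ?Ke s + E s)" by (simp add: E_def)
      then have "u ?I = u ?Ke + u E" using tempered_add[OF u KeS ES] by simp
      then have "cmod (u ?I) \<le> cmod (u ?Ke) + cmod (u E)" by (simp add: norm_triangle_ineq)
      also have "\<dots> \<le> C0 * B0 * \<mu> powr (1 / r) + C0 * (B1 * \<epsilon> powr \<tau>) * \<mu> powr (1 / r)"
        using B1 \<epsilon> by (intro add_mono C0(2)[OF ctl KeS B0 Keb] C0(2)[OF ctl ES _ Eb]) simp
      finally show ?thesis unfolding uI by (simp add: algebra_simps)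
    qed
    have KUm: "(\<lambda>v. ?K v * ?U v) \<in> borel_measurable borel"
      by (intro borel_measurable_continuous_onI continuous_on_mult Kc Uc)
    have leb: "(\<integral>v. ?K v * ?U v \<partial>lebesgue) = (\<integral>v. ?K v * ?U v \<partial>lborel)"
      by (rule integral_completion) (use KUm in simp)
    show "cmod (\<integral>v. ?K v * ?U v \<partial>lebesgue) \<le> C0 * B0 * \<mu> powr (1 / r)"
    \<comment> \<open>A Bochner integral that does not exist has value 0 by convention, and then the
      bound is trivial.\<close>
    proof (cases "integrable lborel (\<lambda>v. ?K v * ?U v)")
      case False
      then show ?thesis unfolding leb using C0(1) B0 by (simp add: not_integrable_integral_eq)
    next
      case True
      define \<epsilon> where "\<epsilon> j = 1 / (real j + 1)" for j
      have \<epsilon>: "0 < \<epsilon> j" "\<epsilon> j \<le> 1" for j by (auto simp: \<epsilon>_def)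
      have \<epsilon>0: "\<epsilon> \<longlonglongrightarrow> 0" unfolding \<epsilon>_def by real_asymp
      have \<theta>c: "continuous_on UNIV (\<theta> e)" for e
        unfolding \<theta>_def
        by (rule continuous_on_compose2[OF smooth_continuous[OF schwartz_smooth[OF schwartz_gauss], of UNIV "[]", simplified]])
           (auto intro!: continuous_intros)
      \<comment> \<open>As \<theta> has modulus at most 1, the integrand without it is a dominating
        function.\<close>
      have "(\<lambda>j. \<integral>v. ?K v * \<theta> (\<epsilon> j) v * ?U v \<partial>lborel) \<longlonglongrightarrow> (\<integral>v. ?K v * ?U v \<partial>lborel)"
      proof (rule integral_dominated_convergence[where w = "\<lambda>v. cmod (?K v * ?U v)"])
        show "integrable lborel (\<lambda>v. cmod (?K v * ?U v))" using True by (rule integrable_norm)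
        show "(\<lambda>v. ?K v * \<theta> (\<epsilon> j) v * ?U v) \<in> borel_measurable lborel" for j
          using borel_measurable_continuous_onI[OF continuous_on_mult[OF continuous_on_mult[OF Kc \<theta>c] Uc]] by simp
        show "AE v in lborel. (\<lambda>j. ?K v * \<theta> (\<epsilon> j) v * ?U v) \<longlonglongrightarrow> ?K v * ?U v"
        proof (rule AE_I2)
          fix v :: "real^'n"
          have "isCont (gauss :: real^'n \<Rightarrow> complex) 0"
            using gauss_differentiable differentiable_imp_continuous_within by blast
          moreover have "(\<lambda>j. \<epsilon> j *\<^sub>R v) \<longlonglongrightarrow> 0" using tendsto_scaleR[OF \<epsilon>0 tendsto_const[of v]] by simp
          ultimately have "(\<lambda>j. \<theta> (\<epsilon> j) v) \<longlonglongrightarrow> gauss (0::real^'n)" unfolding \<theta>_def by (rule isCont_tendsto_compose)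
          then have "(\<lambda>j. ?K v * \<theta> (\<epsilon> j) v * ?U v) \<longlonglongrightarrow> ?K v * 1 * ?U v"
            by (intro tendsto_mult tendsto_const) simp
          then show "(\<lambda>j. ?K v * \<theta> (\<epsilon> j) v * ?U v) \<longlonglongrightarrow> ?K v * ?U v" by simp
        qed
        show "AE v in lborel. norm (?K v * \<theta> (\<epsilon> j) v * ?U v) \<le> cmod (?K v * ?U v)" for j
        proof (rule AE_I2)
          fix v :: "real^'n"
          have "cmod (\<theta> (\<epsilon> j) v) \<le> 1" by (simp add: \<theta>_def gauss_def)
          then have "cmod (?K v) * cmod (\<theta> (\<epsilon> j) v) * cmod (?U v) \<le> cmod (?K v) * 1 * cmod (?U v)"
            by (intro mult_right_mono mult_left_mono) auto
          then show "norm (?K v * \<theta> (\<epsilon> j) v * ?U v) \<le> cmod (?K v * ?U v)" by (simp add: norm_mult)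
        qed
      qed (use KUm in simp)
      then have lim: "(\<lambda>j. cmod (\<integral>v. ?K v * \<theta> (\<epsilon> j) v * ?U v \<partial>lborel)) \<longlonglongrightarrow> cmod (\<integral>v. ?K v * ?U v \<partial>lborel)"
        by (rule tendsto_norm)
      have "(\<lambda>j. \<epsilon> j powr \<tau>) \<longlonglongrightarrow> 0"
        using tendsto_powr'[OF \<epsilon>0 tendsto_const[of \<tau>]] \<tau> \<epsilon> by (simp add: less_imp_le)
      then have "(\<lambda>j. C0 * (B0 + B1 * \<epsilon> j powr \<tau>) * \<mu> powr (1 / r)) \<longlonglongrightarrow> C0 * (B0 + B1 * 0) * \<mu> powr (1 / r)"
        by (intro tendsto_intros)
      from LIMSEQ_le[OF lim this] reg[OF \<epsilon>] have "cmod (\<integral>v. ?K v * ?U v \<partial>lborel) \<le> C0 * (B0 + B1 * 0) * \<mu> powr (1 / r)"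
        by blast
      then show ?thesis unfolding leb by simp
    qed
  qed
qed

section \<open>Scaling and the theorem\<close>

lemma lebesgue_scale:
  fixes t :: "'a::euclidean_space"
  assumes "c \<noteq> 0"
  shows "lebesgue = density (distr lebesgue lebesgue (\<lambda>x. t + c *\<^sub>R x)) (\<lambda>_. ennreal (\<bar>c\<bar> ^ DIM('a)))"
    and "(\<lambda>x. t + c *\<^sub>R x) \<in> lebesgue \<rightarrow>\<^sub>M lebesgue"
proof -
  have e: "t + (\<Sum>j\<in>Basis. (c * (x \<bullet> j)) *\<^sub>R j) = t + c *\<^sub>R x" for x
    unfolding scaleR_scaleR[symmetric] scaleR_sum_right[symmetric] euclidean_representation ..
  show "lebesgue = density (distr lebesgue lebesgue (\<lambda>x. t + c *\<^sub>R x)) (\<lambda>_. ennreal (\<bar>c\<bar> ^ DIM('a)))"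
    using lebesgue_affine_euclidean[of "\<lambda>_. c" t] assms by (simp add: e)
  show "(\<lambda>x. t + c *\<^sub>R x) \<in> lebesgue \<rightarrow>\<^sub>M lebesgue"
    using lebesgue_affine_measurable[of "\<lambda>_. c" t] assms by (simp add: e)
qed

lemma nn_integral_lebesgue_scale:
  fixes t :: "'a::euclidean_space"
  assumes c: "c \<noteq> 0" and f [measurable]: "f \<in> borel_measurable lebesgue"
  shows "(\<integral>\<^sup>+x. f x \<partial>lebesgue) = ennreal (\<bar>c\<bar> ^ DIM('a)) * (\<integral>\<^sup>+x. f (t + c *\<^sub>R x) \<partial>lebesgue)"
proof -
  note m = lebesgue_scale(2)[OF c, of t]
  have "(\<integral>\<^sup>+x. f x \<partial>lebesgue) = (\<integral>\<^sup>+x. f x \<partial>density (distr lebesgue lebesgue (\<lambda>x. t + c *\<^sub>R x)) (\<lambda>_. ennreal (\<bar>c\<bar> ^ DIM('a))))"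
    using lebesgue_scale(1)[OF c, of t] by (rule arg_cong)
  also have "\<dots> = (\<integral>\<^sup>+x. ennreal (\<bar>c\<bar> ^ DIM('a)) * f x \<partial>distr lebesgue lebesgue (\<lambda>x. t + c *\<^sub>R x))"
    by (subst nn_integral_density) auto
  also have "\<dots> = (\<integral>\<^sup>+x. ennreal (\<bar>c\<bar> ^ DIM('a)) * f (t + c *\<^sub>R x) \<partial>lebesgue)"
    by (rule nn_integral_distr[OF m]) simp
  also have "\<dots> = ennreal (\<bar>c\<bar> ^ DIM('a)) * (\<integral>\<^sup>+x. f (t + c *\<^sub>R x) \<partial>lebesgue)"
    by (rule nn_integral_cmult) (rule measurable_compose[OF m f])
  finally show ?thesis .
qed

lemma integral_lebesgue_scale:
  fixes t :: "'a::euclidean_space" and f :: "'a \<Rightarrow> complex"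
  assumes c: "c \<noteq> 0" and f: "f \<in> borel_measurable lebesgue"
  shows "(\<integral>x. f x \<partial>lebesgue) = (\<integral>x. of_real (\<bar>c\<bar> ^ DIM('a)) * f (t + c *\<^sub>R x) \<partial>lebesgue)"
proof -
  note m = lebesgue_scale(2)[OF c, of t]
  have "(\<integral>x. f x \<partial>lebesgue) = (\<integral>x. f x \<partial>density (distr lebesgue lebesgue (\<lambda>x. t + c *\<^sub>R x)) (\<lambda>_. ennreal (\<bar>c\<bar> ^ DIM('a))))"
    using lebesgue_scale(1)[OF c, of t] by (rule arg_cong)
  also have "\<dots> = (\<integral>x. \<bar>c\<bar> ^ DIM('a) *\<^sub>R f x \<partial>distr lebesgue lebesgue (\<lambda>x. t + c *\<^sub>R x))"
    by (rule integral_density) (use f in auto)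
  also have "\<dots> = (\<integral>x. \<bar>c\<bar> ^ DIM('a) *\<^sub>R f (t + c *\<^sub>R x) \<partial>lebesgue)"
    by (rule integral_distr[OF m]) (use f in simp)
  finally show ?thesis by (simp add: scaleR_conv_of_real)
qed

text \<open>The functional for which x becomes the origin and t the unit of length: by its
  definition it sends \<phi> to \<open>distr_conv (dilate t \<phi>) f x\<close>, and translating
  \<phi> by z amounts to evaluating at x - t z.\<close>

definition rescale ::
  "real \<Rightarrow> real^'n::finite \<Rightarrow> ((real^'n \<Rightarrow> complex) \<Rightarrow> complex) \<Rightarrow> (real^'n \<Rightarrow> complex) \<Rightarrow> complex" where
  "rescale t x f \<phi> = f (\<lambda>y. dilate t \<phi> (x - y))"

lemma dilate_reflect_affine:
  "dilate t \<phi> (x - y) = of_real (1 / t ^ CARD('n)) * \<phi> ((- 1 / t) *\<^sub>R y + (1 / t) *\<^sub>R (x :: real^'n::finite))"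
  by (simp add: dilate_def scaleR_diff_right)

lemma schwartz_dilate_reflect:
  assumes "\<phi> \<in> schwartz" "0 < t" shows "(\<lambda>y. dilate t \<phi> (x - y)) \<in> schwartz"
  unfolding dilate_reflect_affine using assms by (intro schwartz_cmult schwartz_affine) auto

lemma tempered_rescale:
  fixes f :: "(real^'n::finite \<Rightarrow> complex) \<Rightarrow> complex"
  assumes f: "tempered f" and t: "0 < t"
  shows "tempered (rescale t x f)"
proof -
  from tempered_bound[OF f] obtain k m C where C': "0 \<le> C \<and>
    (\<forall>\<phi>\<in>schwartz. \<forall>c\<ge>0. deriv_bound m (\<lambda>x. c * wt (- real k) x) \<phi> \<longrightarrow> cmod (f \<phi>) \<le> C * c)"
    by (elim exE)
  have C: "0 \<le> C"
    "\<And>\<phi> c. \<lbrakk>\<phi> \<in> schwartz; 0 \<le> c; deriv_bound m (\<lambda>x. c * wt (- real k) x) \<phi>\<rbrakk> \<Longrightarrow> cmod (f \<phi>) \<le> C * c"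
    using C' by simp_all
  obtain M where M: "0 < M" "\<And>y::real^'n. wt (- real k) ((- 1 / t) *\<^sub>R y + (1 / t) *\<^sub>R x) \<le> M * wt (- real k) y"
    using wt_affine_le[of "- 1 / t" "real k" "(1 / t) *\<^sub>R x"] t by auto
  define a where "a = \<bar>1 / t ^ CARD('n)\<bar> * max 1 \<bar>- 1 / t\<bar> ^ m * M"
  have a: "0 \<le> a" using M(1) by (simp add: a_def)
  have bound: "cmod (rescale t x f \<phi>) \<le> C * (a * s)"
    if \<phi>: "\<phi> \<in> schwartz" and s: "0 \<le> s" "schwartz_seminorm k m \<phi> = ennreal s" for \<phi> s
  proof -
    have "deriv_bound m (\<lambda>x. s * wt (- real k) x) \<phi>"
      by (rule deriv_bound_of_seminorm[OF schwartz_smooth[OF \<phi>] _ s(1)]) (simp add: s)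
    from deriv_bound_cmult[OF deriv_bound_affine[OF this, of "- 1 / t" "(1 / t) *\<^sub>R x"], of "of_real (1 / t ^ CARD('n))"]
    have "deriv_bound m (\<lambda>y. a * s * wt (- real k) y) (\<lambda>y. dilate t \<phi> (x - y))"
      unfolding dilate_reflect_affine
    proof (rule deriv_bound_mono)
      fix y :: "real^'n"
      let ?w = "wt (- real k) ((- 1 / t) *\<^sub>R y + (1 / t) *\<^sub>R x)"
      have "cmod (complex_of_real (1 / t ^ CARD('n))) * (max 1 \<bar>- 1 / t\<bar> ^ m * (s * ?w)) \<le>
          \<bar>1 / t ^ CARD('n)\<bar> * (max 1 \<bar>- 1 / t\<bar> ^ m * (s * (M * wt (- real k) y)))"
        unfolding norm_of_real using s(1) M(2)[of y] by (intro mult_left_mono) auto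
      also have "\<dots> = a * s * wt (- real k) y" by (simp only: a_def mult_ac)
      finally show "cmod (complex_of_real (1 / t ^ CARD('n))) * (max 1 \<bar>- 1 / t\<bar> ^ m * (s * ?w)) \<le> a * s * wt (- real k) y" .
    qed simp
    then show ?thesis
      unfolding rescale_def using a s(1) by (intro C(2) schwartz_dilate_reflect \<phi> t) auto
  qed
  show ?thesis
    unfolding tempered_def
  proof (intro conjI ballI allI)
    fix \<phi> \<psi> :: "real^'n \<Rightarrow> complex" and c assume S: "\<phi> \<in> schwartz" "\<psi> \<in> schwartz"
    show "rescale t x f (\<lambda>x. \<phi> x + \<psi> x) = rescale t x f \<phi> + rescale t x f \<psi>"
      using tempered_add[OF f schwartz_dilate_reflect[OF S(1) t, of x] schwartz_dilate_reflect[OF S(2) t, of x]]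
      by (simp add: rescale_def dilate_def distrib_left)
  next
    fix \<phi> :: "real^'n \<Rightarrow> complex" and c assume S: "\<phi> \<in> schwartz"
    show "rescale t x f (\<lambda>x. c * \<phi> x) = c * rescale t x f \<phi>"
      using tempered_cmult[OF f schwartz_dilate_reflect[OF S t, of x], of c]
      by (simp add: rescale_def dilate_def mult.left_commute)
  next
    show "\<exists>k m. \<exists>C::real. \<forall>\<phi>\<in>schwartz. ennreal (cmod (rescale t x f \<phi>)) \<le> ennreal C * schwartz_seminorm k m \<phi>"
    proof (rule exI[of _ k], rule exI[of _ m], rule exI[of _ "C * a"], rule ballI)
      fix \<phi> :: "real^'n \<Rightarrow> complex" assume S: "\<phi> \<in> schwartz"
      have "schwartz_seminorm k m \<phi> < \<infinity>" using S by (simp add: schwartz_def)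
      then obtain s where s: "0 \<le> s" "schwartz_seminorm k m \<phi> = ennreal s"
        by (cases "schwartz_seminorm k m \<phi>") auto
      have "ennreal (cmod (rescale t x f \<phi>)) \<le> ennreal (C * a * s)"
        using bound[OF S s] by (intro ennreal_leI) (simp add: mult.assoc)
      also have "\<dots> = ennreal (C * a) * schwartz_seminorm k m \<phi>"
        using s C(1) a by (simp add: ennreal_mult)
      finally show "ennreal (cmod (rescale t x f \<phi>)) \<le> ennreal (C * a) * schwartz_seminorm k m \<phi>" .
    qed
  qed
qed

text \<open>For dist v z < 1 the point x - t z lies in the cone of aperture 1 and height t over x -
  t v, so the nontangential supremum in \<open>grand_maximal\<close> supplies the pointwise
  condition. In the averages the factors t^n cancel.\<close>

lemma controlled_rescale:
  fixes f :: "(real^'n::finite \<Rightarrow> complex) \<Rightarrow> complex"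
  assumes f: "tempered f" and t: "0 < t" and \<mu>: "0 < \<mu>"
    and G: "grand_maximal N f \<in> borel_measurable lebesgue"
    and avg: "\<And>\<rho>. 0 < \<rho> \<Longrightarrow> (\<integral>\<^sup>+y\<in>cball x \<rho>. epowr (grand_maximal N f y) r \<partial>lebesgue) \<le> ennreal (\<mu> * \<rho> ^ CARD('n))"
  shows "controlled N r (rescale t x f) (\<lambda>v. grand_maximal N f (x + (- t) *\<^sub>R v)) \<mu>"
  unfolding controlled_def
proof (intro conjI ballI allI impI tempered_rescale f t \<mu>)
  note m = lebesgue_scale(2)[of "- t" x]
  show "(\<lambda>v. grand_maximal N f (x + (- t) *\<^sub>R v)) \<in> borel_measurable lebesgue"
    by (rule measurable_compose[OF m G]) (use t in simp)
  fix \<Psi> :: "real^'n \<Rightarrow> complex" and z v :: "real^'n" assume \<Psi>: "\<Psi> \<in> test_class N" and vz: "dist v z < 1"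
  have "norm ((x - t *\<^sub>R z) - (x + (- t) *\<^sub>R v)) = t * dist v z"
    using t by (simp add: dist_norm scaleR_diff_right[symmetric])
  then have "norm ((x - t *\<^sub>R z) - (x + (- t) *\<^sub>R v)) < t" using vz t by simp
  then have "ennreal (cmod (distr_conv (dilate t \<Psi>) f (x - t *\<^sub>R z))) \<le> grand_maximal N f (x + (- t) *\<^sub>R v)"
    unfolding grand_maximal_def
    by (intro SUP_upper2[OF \<Psi>] SUP_upper2[where i = "(x - t *\<^sub>R z, t)"]) auto
  moreover have "rescale t x f (\<lambda>x. \<Psi> (x - z)) = distr_conv (dilate t \<Psi>) f (x - t *\<^sub>R z)"
    using t by (simp add: rescale_def distr_conv_def dilate_def scaleR_diff_right algebra_simps)
  ultimately show "ennreal (cmod (rescale t x f (\<lambda>x. \<Psi> (x - z)))) \<le> grand_maximal N f (x + (- t) *\<^sub>R v)" by simp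
next
  fix \<rho> :: real assume \<rho>: "0 < \<rho>"
  define g where "g = (\<lambda>y. epowr (grand_maximal N f y) r)"
  have g: "g \<in> borel_measurable lebesgue" unfolding g_def by (rule borel_measurable_epowr[OF G])
  have gi: "(\<lambda>y. g y * indicator (cball x (t * \<rho>)) y) \<in> borel_measurable lebesgue"
    by (intro borel_measurable_times_ennreal g borel_measurable_indicator) simp
  have ind: "indicator (cball x (t * \<rho>)) (x + (- t) *\<^sub>R v) = (indicator (cball 0 \<rho>) v :: ennreal)" for v
    using t by (simp add: indicator_def dist_norm)
  have "ennreal (t ^ CARD('n)) * (\<integral>\<^sup>+v\<in>cball 0 \<rho>. g (x + (- t) *\<^sub>R v) \<partial>lebesgue) = (\<integral>\<^sup>+y\<in>cball x (t * \<rho>). g y \<partial>lebesgue)"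
    using nn_integral_lebesgue_scale[OF _ gi, of "- t" x] t by (simp only: ind) simp
  also have "\<dots> \<le> ennreal (\<mu> * (t * \<rho>) ^ CARD('n))" unfolding g_def using t \<rho> by (intro avg) simp
  also have "\<dots> = ennreal (t ^ CARD('n)) * ennreal (\<mu> * \<rho> ^ CARD('n))"
    using t \<mu> \<rho> by (simp add: ennreal_mult[symmetric] power_mult_distrib mult_ac)
  finally have "(\<integral>\<^sup>+v\<in>cball 0 \<rho>. g (x + (- t) *\<^sub>R v) \<partial>lebesgue) \<le> ennreal (\<mu> * \<rho> ^ CARD('n))"
    using t by (subst (asm) ennreal_mult_le_mult_iff) auto
  then show "(\<integral>\<^sup>+v\<in>cball 0 \<rho>. epowr (grand_maximal N f (x + (- t) *\<^sub>R v)) r \<partial>lebesgue) \<le> ennreal (\<mu> * \<rho> ^ CARD('n))"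
    by (simp only: g_def)
qed

text \<open>The dilation is normalised in L^1, so its Fourier transform at \<xi> is that of \<psi>
  at R \<xi>; the ball of radius R becomes the unit ball.\<close>

lemma cutoff_rescale:
  fixes \<psi> :: "real^'n::finite \<Rightarrow> complex"
  assumes \<psi>: "\<psi> \<in> cutoffs R" and R: "0 < R"
  shows "(\<lambda>s. of_real ((1 / R) ^ CARD('n)) * \<psi> ((1 / R) *\<^sub>R s)) \<in> cutoffs 1"
proof -
  obtain U where S: "\<psi> \<in> schwartz" and U: "open U" "cball 0 R \<subseteq> U" "\<And>\<xi>. \<xi> \<in> U \<Longrightarrow> fourier \<psi> \<xi> = 1"
    using \<psi> by (auto simp: cutoffs_def)
  let ?\<psi> = "\<lambda>s. of_real ((1 / R) ^ CARD('n)) * \<psi> ((1 / R) *\<^sub>R s)"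
  have S': "?\<psi> \<in> schwartz" using schwartz_cmult[OF schwartz_affine[OF S, of "1 / R" 0]] R by simp
  have c\<psi>: "continuous_on UNIV \<psi>" using smooth_continuous[OF schwartz_smooth[OF S], of UNIV "[]"] by simp
  have F: "fourier ?\<psi> \<xi> = fourier \<psi> (R *\<^sub>R \<xi>)" for \<xi>
  proof -
    let ?h = "\<lambda>s. \<psi> s * cis (- 2 * pi * (s \<bullet> (R *\<^sub>R \<xi>)))"
    have "continuous_on UNIV ?h" by (intro continuous_intros c\<psi>)
    then have "?h \<in> borel_measurable borel" by (rule borel_measurable_continuous_onI)
    then have "?h \<in> borel_measurable lborel" by simp
    then have h: "?h \<in> borel_measurable lebesgue" by (rule measurable_completion)
    have "fourier \<psi> (R *\<^sub>R \<xi>) = (\<integral>s. of_real (\<bar>1 / R\<bar> ^ DIM(real^'n)) * ?h (0 + (1 / R) *\<^sub>R s) \<partial>lebesgue)"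
      unfolding fourier_def by (rule integral_lebesgue_scale[OF _ h]) (use R in simp)
    also have "\<dots> = fourier ?\<psi> \<xi>" unfolding fourier_def using R by (simp add: mult_ac)
    finally show ?thesis ..
  qed
  have "open ((\<lambda>\<xi>. R *\<^sub>R \<xi>) -` U)" by (rule continuous_open_vimage[OF U(1)]) (auto intro!: continuous_intros)
  moreover have "cball 0 1 \<subseteq> (\<lambda>\<xi>. R *\<^sub>R \<xi>) -` U"
  proof
    fix \<xi> :: "real^'n" assume "\<xi> \<in> cball 0 1"
    then have "R *\<^sub>R \<xi> \<in> cball 0 R" using R by (simp add: mult_left_le)
    then show "\<xi> \<in> (\<lambda>\<xi>. R *\<^sub>R \<xi>) -` U" using U(2) by blast
  qed
  moreover have "\<forall>\<xi>\<in>(\<lambda>\<xi>. R *\<^sub>R \<xi>) -` U. fourier ?\<psi> \<xi> = 1" using U(3) F by simp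
  ultimately show ?thesis using S' unfolding cutoffs_def by blast
qed

text \<open>The substitution v = R (x - y) in the defining convolution; the dilation of \<psi> in
  the cutoff undoes the one inside \<open>rescale\<close>.\<close>

lemma bochner_riesz_rescale:
  fixes f :: "(real^'n::finite \<Rightarrow> complex) \<Rightarrow> complex"
  assumes f: "tempered f" and \<delta>: "0 < \<delta>" and R: "0 < R" and \<psi>: "\<psi> \<in> cutoffs R"
  shows "bochner_riesz \<delta> R \<psi> f x = (\<integral>v. br_kernel \<delta> v *
     rescale (1 / R) x f (\<lambda>s. (\<lambda>s. of_real ((1 / R) ^ CARD('n)) * \<psi> ((1 / R) *\<^sub>R s)) (s - v)) \<partial>lebesgue)"
proof -
  let ?\<psi> = "\<lambda>s. of_real ((1 / R) ^ CARD('n)) * \<psi> ((1 / R) *\<^sub>R s)"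
  define t where "t = 1 / R"
  have t: "0 < t" using R by (simp add: t_def)
  let ?h = "\<lambda>v. br_kernel \<delta> v * rescale t x f (\<lambda>s. ?\<psi> (s - v))"
  have S: "?\<psi> \<in> schwartz" using cutoff_rescale[OF \<psi> R] by (simp add: cutoffs_def)
  have U: "rescale t x f (\<lambda>s. ?\<psi> (s - v)) = distr_conv \<psi> f (x - t *\<^sub>R v)" for v
    using R by (simp add: rescale_def distr_conv_def dilate_def t_def scaleR_diff_right power_one_over algebra_simps)
  obtain C where "deriv_bound 0 (\<lambda>x. C * wt (- (\<delta> + (real CARD('n) + 1) / 2)) x) (br_kernel \<delta> :: real^'n \<Rightarrow> complex)"
    by (rule deriv_bound_br_kernel[OF \<delta>])
  then have Kc: "continuous_on UNIV (br_kernel \<delta> :: real^'n \<Rightarrow> complex)"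
    unfolding deriv_bound_0 by (meson continuous_at_imp_continuous_on differentiable_imp_continuous_within)
  have "continuous_on UNIV ?h"
    by (rule continuous_on_mult[OF Kc continuous_on_tempered_translate[OF tempered_rescale[OF f t] S]])
  then have "?h \<in> borel_measurable borel" by (rule borel_measurable_continuous_onI)
  then have "?h \<in> borel_measurable lborel" by simp
  then have h: "?h \<in> borel_measurable lebesgue" by (rule measurable_completion)
  have "(\<integral>v. ?h v \<partial>lebesgue) = (\<integral>y. of_real (\<bar>- 1 / t\<bar> ^ DIM(real^'n)) * ?h ((1 / t) *\<^sub>R x + (- 1 / t) *\<^sub>R y) \<partial>lebesgue)"
    by (rule integral_lebesgue_scale[OF _ h]) (use t in simp)
  also have "\<dots> = (\<integral>y. dilate t (br_kernel \<delta>) (x - y) * distr_conv \<psi> f y \<partial>lebesgue)"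
  proof (rule Bochner_Integration.integral_cong[OF refl])
    fix y :: "real^'n"
    have e: "(1 / t) *\<^sub>R x + (- 1 / t) *\<^sub>R y = (1 / t) *\<^sub>R (x - y)" by (simp add: scaleR_diff_right)
    have "x - t *\<^sub>R (1 / t) *\<^sub>R (x - y) = y" using t by simp
    then show "of_real (\<bar>- 1 / t\<bar> ^ DIM(real^'n)) * ?h ((1 / t) *\<^sub>R x + (- 1 / t) *\<^sub>R y) = dilate t (br_kernel \<delta>) (x - y) * distr_conv \<psi> f y"
      unfolding e U using t by (simp add: dilate_def power_one_over)
  qed
  also have "\<dots> = bochner_riesz \<delta> R \<psi> f x" by (simp add: bochner_riesz_def t_def)
  finally show ?thesis by (simp only: t_def)
qed

lemma weak_norm_tail:
  assumes p: "0 < p" and A: "weak_norm p w G = ennreal A" "0 \<le> A" and l: "0 < l"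
  shows "weighted_measure w {x. G x > ennreal l} \<le> ennreal ((A / l) powr p)"
proof -
  let ?m = "weighted_measure w {x. G x > ennreal l}"
  have le: "ennreal l * epowr ?m (1 / p) \<le> ennreal A"
    unfolding A(1)[symmetric] weak_norm_def using l by (intro SUP_upper) simp
  \<comment> \<open>\<open>epowr\<close> maps infinity to infinity, so infinite mass would
    contradict the finite weak norm.\<close>
  have "?m \<noteq> \<infinity>"
  proof
    assume "?m = \<infinity>"
    then have "ennreal l * epowr ?m (1 / p) = \<infinity>" using l by (simp add: epowr_def ennreal_mult_top)
    then show False using le by (simp add: top_unique)
  qed
  then obtain b where b: "0 \<le> b" "?m = ennreal b" by (cases ?m) auto
  then have "ennreal (l * b powr (1 / p)) \<le> ennreal A"
    using le l by (simp add: epowr_def ennreal_mult)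
  then have "b powr (1 / p) \<le> A / l" using A(2) l by (simp add: ennreal_le_iff field_simps)
  then have "(b powr (1 / p)) powr p \<le> (A / l) powr p" using p by (intro powr_mono2) auto
  then have "b \<le> (A / l) powr p" using p b(1) by (simp add: powr_powr)
  then show ?thesis unfolding b(2) by (rule ennreal_leI)
qed

theorem theorem1p1:
  fixes p \<delta> :: real and N :: nat and w :: "real^'n::finite \<Rightarrow> real"
  assumes "0 < p" and "p \<le> 1"
    and "\<delta> > real CARD('n) / p - (real CARD('n) + 1) / 2"
    and "w \<in> A1_weights"
    and "int N \<ge> \<lfloor>real CARD('n) * (critical_index w / p - 1)\<rfloor>"
  shows "\<exists>C::real. C > 0 \<and>
    (\<forall>f\<in>weak_Hardy N p w. \<forall>\<Psi>. (\<forall>R>0. \<Psi> R \<in> cutoffs R) \<longrightarrow>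
       weak_norm p w (max_bochner_riesz \<delta> \<Psi> f) \<le> ennreal C * weak_Hardy_norm N p w f)"
proof -
  define n where "n = real CARD('n)"
  have n: "1 \<le> n" by (simp add: n_def)
  define A where "A = \<delta> + (n + 1) / 2"
  have nA: "n / p < A" using assms(3) by (simp add: A_def n_def)
  have "n \<le> n / p" using assms(1,2) n by (simp add: le_divide_eq mult_left_le)
  \<comment> \<open>From n/p \<ge> n it follows that \<delta> > n - (n + 1)/2 = (n - 1)/2 \<ge>
    0.\<close>
  then have \<delta>: "0 < \<delta>" using nA n unfolding A_def by argo
  have A: "0 < A" using \<delta> n by (simp add: A_def add_pos_nonneg)
  \<comment> \<open>The midpoint of n/A and p: r < p gives room for the maximal theorem, r > n/A
    gives n/r < A for the kernel.\<close>
  define r where "r = (p + n / A) / 2"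
  have nAp: "n / A < p" using nA A assms(1) by (simp add: divide_less_eq mult.commute)
  have nA0: "0 < n / A" using n A by simp
  have mid: "a < (b + a) / 2" "(b + a) / 2 < b" "0 < (b + a) / 2" if "a < b" "0 < a" for a b :: real
    using that by simp_all
  have r: "0 < r" "r < p" "n / A < r"
    unfolding r_def by (rule mid[OF nAp nA0])+
  have r1: "r \<le> 1" using r(2) assms(2) by simp
  have rA: "n / r < A" using r(1,3) A by (simp add: divide_less_eq mult.commute)
  \<comment> \<open>A weak L^p bound for G is a weak L^q bound for G^r, with q > 1.\<close>
  define q where "q = p / r"
  have q: "1 < q" using r by (simp add: q_def)
  obtain C1 where C1: "0 \<le> C1"
    "\<And>u (G :: real^'n \<Rightarrow> ennreal) \<mu> \<psi>. \<lbrakk>controlled N r u G \<mu>; \<psi> \<in> cutoffs 1\<rbrakk> \<Longrightarrow>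
       cmod (\<integral>v. br_kernel \<delta> v * u (\<lambda>s. \<psi> (s - v)) \<partial>lebesgue) \<le> C1 * \<mu> powr (1 / r)"
    using br_kernel_unit_estimate[OF r(1) r1 \<delta>, of N] rA unfolding A_def n_def by blast
  obtain C2 where C2: "0 \<le> C2"
    "\<And>g A l. \<lbrakk>g \<in> borel_measurable lebesgue; 0 \<le> A; 0 < l;
       \<And>s. 0 < s \<Longrightarrow> weighted_measure w {x. g x > ennreal s} \<le> ennreal (A * s powr - q)\<rbrakk> \<Longrightarrow>
     weighted_measure w (super_balls g l) \<le> ennreal (C2 * A * l powr - q)"
    using super_balls_weak[OF assms(4) q] by blast
  define C where "C = C2 powr (1 / p) * (C1 + 1) + 1"
  show ?thesis
  proof (intro exI[of _ C] conjI ballI allI impI)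
    show "0 < C" using C1(1) by (simp add: C_def add_nonneg_pos)
    fix f :: "(real^'n \<Rightarrow> complex) \<Rightarrow> complex" and \<Psi> :: "real \<Rightarrow> real^'n \<Rightarrow> complex"
    assume f: "f \<in> weak_Hardy N p w" and \<Psi>: "\<forall>R>0. \<Psi> R \<in> cutoffs R"
    let ?G = "grand_maximal N f"
    have ft: "tempered f" and Gm: "?G \<in> borel_measurable lebesgue" and fin: "weak_norm p w ?G < \<infinity>"
      using f by (auto simp: weak_Hardy_def weak_Lp_def)
    obtain B where B: "0 \<le> B" "weak_norm p w ?G = ennreal B" using fin by (cases "weak_norm p w ?G") auto
    define g where "g = (\<lambda>y. epowr (?G y) r)"
    have gm: "g \<in> borel_measurable lebesgue" unfolding g_def by (rule borel_measurable_epowr[OF Gm])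
    have tail: "weighted_measure w {x. g x > ennreal s} \<le> ennreal (B powr p * s powr - q)" if s: "0 < s" for s
    proof -
      have "ennreal (s powr (1 / r)) < ?G x" if "ennreal s < g x" for x
      proof (rule ccontr)
        assume "\<not> ?thesis"
        then have le: "?G x \<le> ennreal (s powr (1 / r))" by simp
        then have "?G x \<noteq> \<infinity>" by (metis ennreal_less_top infinity_ennreal_def not_le)
        then obtain b where b: "0 \<le> b" "?G x = ennreal b" by (cases "?G x") auto
        have "b \<le> s powr (1 / r)" using le b by (simp add: ennreal_le_iff)
        then have "b powr r \<le> (s powr (1 / r)) powr r" using b r by (intro powr_mono2) auto
        also have "\<dots> = s" using r s by (simp add: powr_powr)
        finally have "g x \<le> ennreal s" unfolding g_def b(2) epowr_def using b(1) by (simp add: ennreal_leI)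
        with that show False by simp
      qed
      then have "weighted_measure w {x. g x > ennreal s} \<le> weighted_measure w {x. ?G x > ennreal (s powr (1 / r))}"
        by (intro weighted_measure_mono) auto
      also have "\<dots> \<le> ennreal ((B / s powr (1 / r)) powr p)"
        using s by (intro weak_norm_tail[OF assms(1) B(2,1)]) simp
      also have "(B / s powr (1 / r)) powr p = B powr p * s powr - q"
        using s B(1) by (simp add: powr_divide powr_powr q_def powr_minus_divide)
      finally show ?thesis .
    qed
    have main: "ennreal l * epowr (weighted_measure w {x. max_bochner_riesz \<delta> \<Psi> f x > ennreal l}) (1 / p) \<le> ennreal (C * B)"
      if l: "0 < l" for l
    proof -
      \<comment> \<open>Off the exceptional set every Bochner-Riesz mean is at most C1 k, so this k
        pushes it below l; the added 1 avoids division by 0.\<close>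
      define k where "k = l / (C1 + 1)"
      have k: "0 < k" "C1 * k \<le> l" using l C1(1) by (auto simp: k_def field_simps add_nonneg_pos)
      define \<mu> where "\<mu> = k powr r"
      have \<mu>: "0 < \<mu>" using k by (simp add: \<mu>_def)
      have \<mu>r: "\<mu> powr (1 / r) = k" using k r by (simp add: \<mu>_def powr_powr)
      \<comment> \<open>At a point outside \<open>super_balls g \<mu>\<close> all centred averages
        of G^r are at most \<mu>, whatever the radius. The rescaled distributions are then
        controlled with this same \<mu> for every R, which takes care of the supremum.\<close>
      have sub: "{x. max_bochner_riesz \<delta> \<Psi> f x > ennreal l} \<subseteq> super_balls g \<mu>"
      proof (rule ccontr)
        assume "\<not> ?thesis"
        then obtain x where x: "max_bochner_riesz \<delta> \<Psi> f x > ennreal l" "x \<notin> super_balls g \<mu>" by blast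
        have avg: "(\<integral>\<^sup>+y\<in>cball x \<rho>. epowr (?G y) r \<partial>lebesgue) \<le> ennreal (\<mu> * \<rho> ^ CARD('n))" if "0 < \<rho>" for \<rho>
        proof (rule ccontr)
          assume "\<not> ?thesis"
          then have "ennreal (\<mu> * \<rho> ^ CARD('n)) < (\<integral>\<^sup>+y\<in>cball x \<rho>. g y \<partial>lebesgue)" by (simp add: g_def)
          then have "x \<in> super_balls g \<mu>" unfolding super_balls_def using that
            by (intro UN_I[of "(x, \<rho>)"]) auto
          then show False using x(2) by blast
        qed
        have "max_bochner_riesz \<delta> \<Psi> f x \<le> ennreal l"
          unfolding max_bochner_riesz_def
        proof (rule SUP_least)
          fix R :: real assume "R \<in> {0<..}"
          then have R: "0 < R" by simp
          have \<Psi>R: "\<Psi> R \<in> cutoffs R" using \<Psi> R by blast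
          have "controlled N r (rescale (1 / R) x f) (\<lambda>v. ?G (x + (- (1 / R)) *\<^sub>R v)) \<mu>"
            using R by (intro controlled_rescale[OF ft _ \<mu> Gm avg]) auto
          from C1(2)[OF this cutoff_rescale[OF \<Psi>R R]]
          have "cmod (bochner_riesz \<delta> R (\<Psi> R) f x) \<le> C1 * k"
            unfolding bochner_riesz_rescale[OF ft \<delta> R \<Psi>R] \<mu>r .
          then show "ennreal (cmod (bochner_riesz \<delta> R (\<Psi> R) f x)) \<le> ennreal l"
            using k(2) by (intro ennreal_leI) simp
        qed
        with x(1) show False by simp
      qed
      let ?m = "weighted_measure w {x. max_bochner_riesz \<delta> \<Psi> f x > ennreal l}"
      have "?m \<le> weighted_measure w (super_balls g \<mu>)" by (rule weighted_measure_mono[OF sub])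
      also have "\<dots> \<le> ennreal (C2 * B powr p * \<mu> powr - q)"
        by (rule C2(2)[OF gm _ \<mu> tail]) simp
      also have "\<mu> powr - q = k powr - p" using r by (simp add: \<mu>_def powr_powr q_def)
      finally have m: "?m \<le> ennreal (C2 * B powr p * k powr - p)" .
      then have "?m \<noteq> \<infinity>" by (metis ennreal_less_top infinity_ennreal_def not_le)
      then obtain b where b: "0 \<le> b" "?m = ennreal b" by (cases ?m) auto
      have "b \<le> C2 * B powr p * k powr - p"
        using m b C2(1) by (simp add: ennreal_le_iff)
      then have "b powr (1 / p) \<le> (C2 * B powr p * k powr - p) powr (1 / p)"
        using b(1) assms(1) by (intro powr_mono2) auto
      also have "\<dots> = C2 powr (1 / p) * B * k powr - 1"
        using C2(1) B(1) k(1) assms(1) by (simp add: powr_mult powr_powr)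
      also have "k powr - 1 = (C1 + 1) / l" using k(1) l C1(1) by (simp add: powr_minus_divide k_def)
      finally have "l * b powr (1 / p) \<le> C2 powr (1 / p) * (C1 + 1) * B"
        using l by (simp add: field_simps)
      also have "\<dots> \<le> C * B" using B(1) by (intro mult_right_mono) (auto simp: C_def)
      finally have "ennreal (l * b powr (1 / p)) \<le> ennreal (C * B)" by (rule ennreal_leI)
      then show ?thesis using l b by (simp add: epowr_def ennreal_mult)
    qed
    have "weak_norm p w (max_bochner_riesz \<delta> \<Psi> f) \<le> ennreal (C * B)"
      unfolding weak_norm_def by (rule SUP_least) (use main in auto)
    also have "\<dots> = ennreal C * weak_Hardy_norm N p w f"
      using \<open>0 < C\<close> B by (simp add: weak_Hardy_norm_def ennreal_mult)
    finally show "weak_norm p w (max_bochner_riesz \<delta> \<Psi> f) \<le> ennreal C * weak_Hardy_norm N p w f" .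
  qed
qed

end
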